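(* For each $n\in\mathbb{N}$ let $\mathbf{d}=\mathbf{d}^{(n)}=(d_1,\dots,d_n)$ be a degree sequence of positive integers with $\ell_n=\sum_{i\in[n]}d_i$ even. Suppose that $\mathbf{d}$ satisfies the degree regularity conditions (a) and (b) below with respect to a probability mass function $(p_k)_{k\in\mathbb{N}}$ whose minimal degree $d_{\mathrm{min}}:=\min\{k\in\mathbb{N}: p_k>0\}$ satisfies $d_{\mathrm{min}}\ge 3$, that $\mathbf{d}$ satisfies the polynomial distribution condition below with some exponent $\tau\in(2,3)$, and that $d_i\ge d_{\mathrm{min}}$ for all $i\in[n]$. Then $$\frac{\mathrm{diam}(\mathrm{CM}_n)}{\log\log n}\longrightarrow \frac{2}{\log(d_{\mathrm{min}}-1)}+\frac{2}{|\log(\tau-2)|}$$ in probability as $n\to\infty$.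
   Context: Configuration model: given $\mathbf{d}=(d_1,\dots,d_n)$ with $\ell_n$ even, $\mathrm{CM}_n$ is the random multigraph on $[n]=\{1,\dots,n\}$ obtained by attaching $d_i$ half-edges to vertex $i$ and pairing all half-edges uniformly at random to form edges (self-loops and multiple edges allowed). $\mathrm{diam}$ denotes the graph diameter (maximal graph distance). Empirical degree distribution: $p_k^{(n)}=\frac1n\sum_{i\in[n]}\mathbf 1_{\{d_i=k\}}$, and $F_{\mathbf d,n}(x)=\frac1n\sum_{i\in[n]}\mathbf 1_{\{d_i\le x\}}$. Degree regularity conditions: (a) for every $k\in\mathbb{N}$, $p_k^{(n)}\to p_k$ as $n\to\infty$; (b) $\sum_k kp_k<\infty$ and $\sum_k kp_k^{(n)}\to\sum_k kp_k$. Polynomial distribution condition with exponent $\tau\in(2,3)$: for every $\delta>0$ there exist $\alpha=\alpha(\delta)>1/2$, $c_1(\delta)>0$, $c_2(\delta)>0$ such that for every $n\in\mathbb{N}$, $1-F_{\mathbf d,n}(x)\ge c_1x^{-(\tau-1+\delta)}$ for all $x\le n^\alpha$, and $1-F_{\mathbf d,n}(x)\le c_2x^{-(\tau-1-\delta)}$ for all $x\ge1$. *)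

theory Defs
  imports "HOL-Probability.Probability"
begin

text \<open>Vertices of the n-th graph are 0,...,n-1 (shift of [n] = {1..n}).
  A degree sequence is d :: nat \<Rightarrow> nat, with d i the degree of vertex i (i < n).\<close>

definition half_edges :: "nat \<Rightarrow> (nat \<Rightarrow> nat) \<Rightarrow> (nat \<times> nat) set" where
  "half_edges n d = {(i, j). i < n \<and> j < d i}"

text \<open>Perfect matchings of the half-edges: fixed-point-free involutions of the
  half-edge set (identity outside it).\<close>
definition pairings :: "nat \<Rightarrow> (nat \<Rightarrow> nat) \<Rightarrow> ((nat \<times> nat) \<Rightarrow> (nat \<times> nat)) set" where
  "pairings n d = {\<sigma>. (\<forall>h. h \<notin> half_edges n d \<longrightarrow> \<sigma> h = h) \<and>
      (\<forall>h \<in> half_edges n d. \<sigma> h \<in> half_edges n d \<and> \<sigma> h \<noteq> h \<and> \<sigma> (\<sigma> h) = h)}"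

definition CM :: "nat \<Rightarrow> (nat \<Rightarrow> nat) \<Rightarrow> ((nat \<times> nat) \<Rightarrow> (nat \<times> nat)) pmf" where
  "CM n d = pmf_of_set (pairings n d)"

definition cm_adj :: "nat \<Rightarrow> (nat \<Rightarrow> nat) \<Rightarrow> ((nat \<times> nat) \<Rightarrow> (nat \<times> nat)) \<Rightarrow> (nat \<times> nat) set" where
  "cm_adj n d \<sigma> = {(u, v). u < n \<and> v < n \<and>
      (\<exists>j k. j < d u \<and> k < d v \<and> \<sigma> (u, j) = (v, k))}"

definition graph_dist :: "(nat \<times> nat) set \<Rightarrow> nat \<Rightarrow> nat \<Rightarrow> nat" where
  "graph_dist E u v = (LEAST k. (u, v) \<in> E ^^ k)"

definition cm_diam :: "nat \<Rightarrow> (nat \<Rightarrow> nat) \<Rightarrow> ((nat \<times> nat) \<Rightarrow> (nat \<times> nat)) \<Rightarrow> nat" where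
  "cm_diam n d \<sigma> = Max {graph_dist (cm_adj n d \<sigma>) u v | u v.
      u < n \<and> v < n \<and> (u, v) \<in> (cm_adj n d \<sigma>)\<^sup>*}"

definition emp_pk :: "nat \<Rightarrow> (nat \<Rightarrow> nat) \<Rightarrow> nat \<Rightarrow> real" where
  "emp_pk n d k = real (card {i. i < n \<and> d i = k}) / real n"

definition emp_F :: "nat \<Rightarrow> (nat \<Rightarrow> nat) \<Rightarrow> real \<Rightarrow> real" where
  "emp_F n d x = real (card {i. i < n \<and> real (d i) \<le> x}) / real n"

end

theory Submission
  imports Defs "HOL-Combinatorics.Permutations" "HOL-Real_Asymp.Real_Asymp"
begin

text \<open>Write \<open>D\<close> for the minimal degree and \<open>L = ln (ln n)\<close>. A uniform pairing can be revealed one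
  half-edge at a time, so probabilities are averages over the partner of any chosen half-edge, and all
  bounds follow by induction over partial matchings.

  Upper bound. The exploration from a vertex meets at most one collision with probability \<open>1 - o(1/n)\<close>,
  and each collision destroys only two of the at least three initial branches; hence every vertex reaches degree
  \<open>(ln n) powr \<sigma>\<close> within \<open>(1 + o(1)) L / ln (D - 1)\<close> steps. From degree \<open>u\<close>
  one finds a neighbour of degree about \<open>u powr (1 / (\<tau> - 2))\<close>, so \<open>(1 + o(1)) L / \<bar>ln (\<tau> - 2)\<bar>\<close> further steps
  lead to a vertex of degree above \<open>n powr (1/2)\<close>, and any two such vertices are adjacent.

  Lower bound. By a second moment argument there are many vertices whose ball of radius
  \<open>(1 - o(1)) L / ln (D - 1)\<close> only contains vertices of degree \<open>D\<close>. Its boundary is polylogarithmic, and a first moment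
  bound on paths with doubly exponentially growing degree truncation shows that most pairs of such balls are at
  distance at least \<open>(1 - o(1)) 2 L / \<bar>ln (\<tau> - 2)\<bar>\<close>.\<close>

section \<open>Uniform matchings and partial matchings\<close>

text \<open>The exploration has to succeed from all \<open>n\<close> vertices at once. A collision
  among \<open>n powr o(1)\<close> explored half-edges has probability
  \<open>n powr (-1 + o(1))\<close>, too large for a union bound, while two collisions cost at most
  a constant times \<open>n powr (-3/2)\<close>; this is why exactly one is tolerated and why
  minimal degree three suffices. The constant \<open>1 / ln (D - 1)\<close> has the same origin on
  both sides: keeping a whole ball of radius \<open>k\<close> free of large degrees costs an
  exponential of order \<open>(D - 1) ^ k\<close>, which competes with \<open>n\<close> exactly when
  \<open>k\<close> is about \<open>L / ln (D - 1)\<close>. Conditioning is replaced by counting: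
  \<open>match_prob S M E\<close> is the proportion of the completions of a revealed matching
  \<open>M\<close> that lie in \<open>E\<close>, and near-independence of two balls is a statement
  about ratios of numbers of matchings. \<open>cm_diam\<close> is a maximum over connected pairs
  only. The event \<open>distant\<close> therefore includes disconnected pairs, and its rarity is
  needed for the lower bound on the diameter as well.\<close>

definition matchings :: "'a set \<Rightarrow> ('a \<Rightarrow> 'a) set" where
  "matchings S = {\<sigma>. (\<forall>h. h \<notin> S \<longrightarrow> \<sigma> h = h) \<and> (\<forall>h\<in>S. \<sigma> h \<in> S \<and> \<sigma> h \<noteq> h \<and> \<sigma> (\<sigma> h) = h)}"

text \<open>Revealed pairs are stored in both directions, so \<open>Domain M\<close> is the set of
  all half-edges already used and its cardinality counts two per edge.\<close>

definition partial_matching :: "'a set \<Rightarrow> ('a \<times> 'a) set \<Rightarrow> bool" where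
  "partial_matching S M \<longleftrightarrow> Domain M \<subseteq> S \<and> sym M \<and> irrefl M \<and> single_valued M"

definition ext :: "'a set \<Rightarrow> ('a \<times> 'a) set \<Rightarrow> ('a \<Rightarrow> 'a) set" where
  "ext S M = {\<sigma> \<in> matchings S. \<forall>(a,b)\<in>M. \<sigma> a = b}"

definition addp :: "'a \<Rightarrow> 'a \<Rightarrow> ('a \<times> 'a) set \<Rightarrow> ('a \<times> 'a) set" where
  "addp h y M = insert (h,y) (insert (y,h) M)"

text \<open>The double factorial \<open>(n - 1)!!\<close> for even \<open>n\<close> and
  \<open>0\<close> for odd \<open>n\<close>: a fixed element has \<open>n - 1\<close> possible
  partners.\<close>

fun num_matchings :: "nat \<Rightarrow> nat" where
  "num_matchings 0 = 1" | "num_matchings (Suc 0) = 0" | "num_matchings (Suc (Suc n)) = Suc n * num_matchings n"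

text \<open>Conditional probability of \<open>E\<close> given the revealed pairs \<open>M\<close>.
  It is \<open>0\<close> if \<open>M\<close> has no completion, so the averaging identity below
  needs no parity hypothesis.\<close>

definition match_prob :: "'a set \<Rightarrow> ('a \<times> 'a) set \<Rightarrow> ('a \<Rightarrow> 'a) set \<Rightarrow> real" where
  "match_prob S M E = real (card (ext S M \<inter> E)) / real (card (ext S M))"

lemma num_matchings_even_pos: "even n \<Longrightarrow> num_matchings n > 0"
  by (induction n rule: num_matchings.induct) auto

lemma num_matchings_odd: "odd n \<Longrightarrow> num_matchings n = 0"
  by (induction n rule: num_matchings.induct) auto

lemma finite_matchings: "finite S \<Longrightarrow> finite (matchings S)"
proof -
  assume "finite S"
  have "matchings S \<subseteq> {p. p permutes S}"
  proof
    fix p assume p: "p \<in> matchings S"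
    have pp: "p (p x) = x" for x using p by (cases "x \<in> S") (auto simp: matchings_def)
    have "\<exists>!x. p x = y" for y by (rule ex1I[of _ "p y"]) (use pp in \<open>auto simp: pp\<close>)
    then show "p \<in> {p. p permutes S}"
      using p by (auto simp: matchings_def permutes_def)
  qed
  then show ?thesis using finite_permutations[OF \<open>finite S\<close>] finite_subset by blast
qed

lemma finite_ext: "finite S \<Longrightarrow> finite (ext S M)"
  using finite_matchings[of S] by (auto simp: ext_def)

lemma ext_empty [simp]: "ext S {} = matchings S" by (auto simp: ext_def)

lemma partial_matching_empty [simp]: "partial_matching S {}" by (auto simp: partial_matching_def sym_def irrefl_def single_valued_def)

lemma Domain_addp [simp]: "Domain (addp h y M) = insert h (insert y (Domain M))"
  by (auto simp: addp_def)

lemma partial_matching_addp: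
  assumes "partial_matching S M" "h \<in> S - Domain M" "y \<in> S - Domain M" "h \<noteq> y"
  shows "partial_matching S (addp h y M)"
proof -
  have "sym (addp h y M)" using assms(1) by (auto simp: partial_matching_def addp_def sym_def)
  moreover have "irrefl (addp h y M)" using assms(1,4) by (auto simp: partial_matching_def addp_def irrefl_def)
  moreover have "single_valued (addp h y M)"
    using assms by (auto simp: partial_matching_def addp_def single_valued_def)
  ultimately show ?thesis using assms by (auto simp: partial_matching_def)
qed

lemma extD: "\<sigma> \<in> ext S M \<Longrightarrow> (a,b) \<in> M \<Longrightarrow> \<sigma> a = b" by (auto simp: ext_def)

lemma ext_matchings: "\<sigma> \<in> ext S M \<Longrightarrow> \<sigma> \<in> matchings S" by (auto simp: ext_def)

lemma ext_addp_subset: "ext S (addp h y M) \<subseteq> ext S M" by (auto simp: ext_def addp_def)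

lemma ext_addpD: "\<sigma> \<in> ext S (addp h y M) \<Longrightarrow> \<sigma> h = y" by (auto simp: ext_def addp_def)

text \<open>The partner of a free half-edge is free: if \<open>\<sigma> h\<close> were already
  matched in \<open>M\<close>, the involution would make \<open>h\<close> its partner there, and
  symmetry of \<open>M\<close> would put \<open>h\<close> into \<open>Domain M\<close>.\<close>

lemma ext_step:
  assumes "partial_matching S M" "h \<in> S - Domain M"
  shows "ext S M = (\<Union>y\<in>S - Domain M - {h}. ext S (addp h y M))"
proof
  show "ext S M \<subseteq> (\<Union>y\<in>S - Domain M - {h}. ext S (addp h y M))"
  proof
    fix \<sigma> assume s: "\<sigma> \<in> ext S M"
    have m: "\<sigma> h \<in> S" "\<sigma> h \<noteq> h" "\<sigma> (\<sigma> h) = h"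
      using s assms(2) by (auto simp: ext_def matchings_def)
    have "\<sigma> h \<notin> Domain M"
    proof
      assume "\<sigma> h \<in> Domain M"
      then obtain b where b: "(\<sigma> h, b) \<in> M" by auto
      then have "b = h" using extD[OF s b] m by simp
      then have "(h, \<sigma> h) \<in> M" using b assms(1) by (auto simp: partial_matching_def sym_def)
      then show False using assms(2) by auto
    qed
    moreover have "\<sigma> \<in> ext S (addp h (\<sigma> h) M)"
      using s m by (auto simp: ext_def addp_def)
    ultimately show "\<sigma> \<in> (\<Union>y\<in>S - Domain M - {h}. ext S (addp h y M))" using m by auto
  qed
next
  show "(\<Union>y\<in>S - Domain M - {h}. ext S (addp h y M)) \<subseteq> ext S M"
    by (intro UN_least ext_addp_subset)
qed

lemma card_ext_step:
  assumes "finite S" "partial_matching S M" "h \<in> S - Domain M"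
  shows "card (ext S M \<inter> E) = (\<Sum>y\<in>S - Domain M - {h}. card (ext S (addp h y M) \<inter> E))"
proof -
  have "ext S M \<inter> E = (\<Union>y\<in>S - Domain M - {h}. ext S (addp h y M) \<inter> E)"
    using ext_step[OF assms(2,3)] by blast
  also have "card \<dots> = (\<Sum>y\<in>S - Domain M - {h}. card (ext S (addp h y M) \<inter> E))"
    using assms(1) by (intro card_UN_disjoint) (auto simp: finite_ext dest: ext_addpD)
  finally show ?thesis .
qed

lemma ext_full:
  assumes "partial_matching S M" "Domain M = S"
  shows "card (ext S M) = 1"
proof -
  define t where "t = (\<lambda>h. if h \<in> S then THE b. (h,b) \<in> M else h)"
  have t: "t h = b" if "(h,b) \<in> M" for h b
  proof -
    have "h \<in> S" using that assms(2) by auto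
    moreover have "(THE b. (h,b) \<in> M) = b"
      using that assms(1) by (intro the_equality) (auto simp: partial_matching_def single_valued_def)
    ultimately show ?thesis by (simp add: t_def)
  qed
  have ext: "t \<in> matchings S"
    unfolding matchings_def
  proof (clarsimp, intro conjI allI impI ballI)
    fix h assume "h \<notin> S" then show "t h = h" by (simp add: t_def)
  next
    fix h assume "h \<in> S"
    then obtain b where b: "(h,b) \<in> M" using assms(2) by auto
    then have b': "(b,h) \<in> M" using assms(1) by (auto simp: partial_matching_def sym_def)
    show "t h \<in> S" "t h \<noteq> h" "t (t h) = h"
      using t[OF b] t[OF b'] b b' assms by (auto simp: partial_matching_def irrefl_def)
  qed
  have "ext S M = {t}"
  proof
    show "ext S M \<subseteq> {t}"
    proof
      fix \<sigma> assume s: "\<sigma> \<in> ext S M"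
      have "\<sigma> h = t h" for h
      proof (cases "h \<in> S")
        case True then obtain b where b: "(h,b) \<in> M" using assms(2) by auto
        then show ?thesis using t[OF b] extD[OF s b] by simp
      next
        case False then show ?thesis using s by (auto simp: ext_def matchings_def t_def)
      qed
      then show "\<sigma> \<in> {t}" by auto
    qed
  qed (use ext t in \<open>auto simp: ext_def\<close>)
  then show ?thesis by simp
qed

lemma card_free:
  assumes "finite S" "partial_matching S M"
  shows "card (S - Domain M) = card S - card (Domain M)" "card (Domain M) \<le> card S"
  using assms by (auto simp: partial_matching_def card_Diff_subset finite_subset card_mono)

text \<open>Induction on the number \<open>k\<close> of free elements: a fixed free \<open>h\<close>
  has \<open>k - 1\<close> possible partners and each choice leaves \<open>k - 2\<close> free
  elements. The count depends on \<open>M\<close> only through its size; this gives uniformity of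
  the partner and, later, near-independence of distant balls.\<close>

lemma card_ext:
  assumes "finite S" "partial_matching S M"
  shows "card (ext S M) = num_matchings (card S - card (Domain M))"
  using assms(2)
proof (induction "card (S - Domain M)" arbitrary: M rule: less_induct)
  case less
  show ?case
  proof (cases "Domain M = S")
    case True then show ?thesis using ext_full[OF less.prems] by simp
  next
    case False
    then obtain h where h: "h \<in> S - Domain M" using less.prems by (auto simp: partial_matching_def)
    define k where "k = card (S - Domain M)"
    have kk: "k = card S - card (Domain M)" using card_free[OF assms(1) less.prems] by (simp add: k_def)
    have k0: "k > 0" using h assms(1) by (auto simp: k_def card_gt_0_iff)
    have ind: "card (ext S (addp h y M)) = num_matchings (k - 2)" if y: "y \<in> S - Domain M - {h}" for y
    proof -
      have pm: "partial_matching S (addp h y M)" using less.prems h y by (intro partial_matching_addp) auto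
      have e: "S - Domain (addp h y M) = S - Domain M - {h,y}" by auto
      have c: "card (S - Domain (addp h y M)) = k - 2"
        unfolding e k_def using h y assms(1) by (subst card_Diff_subset) auto
      have "card (ext S (addp h y M)) = num_matchings (card S - card (Domain (addp h y M)))"
        by (rule less.hyps[OF _ pm]) (use c k0 k_def in auto)
      then show ?thesis using card_free[OF assms(1) pm] c by simp
    qed
    have "card (ext S M) = (\<Sum>y\<in>S - Domain M - {h}. card (ext S (addp h y M)))"
      using card_ext_step[OF assms(1) less.prems h, of UNIV] by simp
    also have "\<dots> = card (S - Domain M - {h}) * num_matchings (k - 2)" using ind by simp
    also have "card (S - Domain M - {h}) = k - 1" using h assms(1) by (simp add: k_def)
    also have "(k - 1) * num_matchings (k - 2) = num_matchings k" using k0 by (cases k rule: num_matchings.cases) auto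
    finally show ?thesis using kk by simp
  qed
qed

text \<open>All choices of the partner of \<open>h\<close> have equally many completions, so the
  partner is uniform among the other free half-edges. The half-edge to reveal may be chosen freely;
  every exploration below is an induction that uses this identity. Without any completion both sides
  are \<open>0\<close>.\<close>

lemma match_prob_step:
  assumes "finite S" "partial_matching S M" "h \<in> S - Domain M"
  shows "match_prob S M E = (\<Sum>y\<in>S - Domain M - {h}. match_prob S (addp h y M) E) / real (card (S - Domain M) - 1)"
proof -
  define k where "k = card (S - Domain M)"
  have kk: "k = card S - card (Domain M)" using card_free[OF assms(1,2)] by (simp add: k_def)
  have k0: "k > 0" using assms by (auto simp: k_def card_gt_0_iff)
  have ce: "card (ext S (addp h y M)) = num_matchings (k - 2)" if y: "y \<in> S - Domain M - {h}" for y
  proof -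
    have pm: "partial_matching S (addp h y M)" using assms y by (intro partial_matching_addp) auto
    have e: "S - Domain (addp h y M) = S - Domain M - {h,y}" by auto
    have c: "card (S - Domain (addp h y M)) = k - 2"
      unfolding e k_def using y assms by (subst card_Diff_subset) auto
    then show ?thesis using card_ext[OF assms(1) pm] card_free[OF assms(1) pm] by simp
  qed
  have df: "num_matchings k = (k - 1) * num_matchings (k - 2)" using k0 by (cases k rule: num_matchings.cases) auto
  have "match_prob S M E = (\<Sum>y\<in>S - Domain M - {h}. real (card (ext S (addp h y M) \<inter> E))) / real (num_matchings k)"
    unfolding match_prob_def card_ext_step[OF assms] card_ext[OF assms(1,2)] kk by simp
  also have "\<dots> = (\<Sum>y\<in>S - Domain M - {h}. real (card (ext S (addp h y M) \<inter> E)) / real (num_matchings (k-2))) / real (k - 1)"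
    unfolding df by (simp add: sum_divide_distrib mult.commute)
  also have "\<dots> = (\<Sum>y\<in>S - Domain M - {h}. match_prob S (addp h y M) E) / real (k - 1)"
    unfolding match_prob_def using ce by simp
  finally show ?thesis unfolding k_def .
qed

lemma match_prob_nonneg [simp]: "match_prob S M E \<ge> 0" by (simp add: match_prob_def)

lemma match_prob_le1: "finite S \<Longrightarrow> match_prob S M E \<le> 1"
  unfolding match_prob_def using card_mono[OF finite_ext[of S M], of "ext S M \<inter> E"] by (auto simp: divide_le_eq_1)

lemma match_prob_mono: "finite S \<Longrightarrow> ext S M \<inter> E \<subseteq> F \<Longrightarrow> match_prob S M E \<le> match_prob S M F"
  unfolding match_prob_def by (intro divide_right_mono) (auto intro!: card_mono simp: finite_ext)

lemma match_prob_eq0: "ext S M \<inter> E = {} \<Longrightarrow> match_prob S M E = 0" by (simp add: match_prob_def)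

lemma match_prob_eq1: "finite S \<Longrightarrow> ext S M \<subseteq> E \<Longrightarrow> ext S M \<noteq> {} \<Longrightarrow> match_prob S M E = 1"
  by (simp add: match_prob_def Int_absorb2 finite_ext card_gt_0_iff)

lemma match_prob_UN:
  assumes "finite S" "finite I"
  shows "match_prob S M (\<Union>i\<in>I. E i) \<le> (\<Sum>i\<in>I. match_prob S M (E i))"
proof -
  have "card (ext S M \<inter> (\<Union>i\<in>I. E i)) \<le> (\<Sum>i\<in>I. card (ext S M \<inter> E i))"
    using card_UN_le[OF assms(2), of "\<lambda>i. ext S M \<inter> E i"] by (simp only: Int_UN_distrib)
  then have "real (card (ext S M \<inter> (\<Union>i\<in>I. E i))) \<le> (\<Sum>i\<in>I. real (card (ext S M \<inter> E i)))"
    by (metis of_nat_le_iff of_nat_sum)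
  then show ?thesis unfolding match_prob_def by (simp add: sum_divide_distrib[symmetric] divide_right_mono)
qed

lemma match_prob_UN_subset:
  assumes "finite S" "finite I" "ext S M \<inter> E \<subseteq> (\<Union>i\<in>I. G i)"
  shows "match_prob S M E \<le> (\<Sum>i\<in>I. match_prob S M (G i))"
  using match_prob_mono[OF assms(1,3)] match_prob_UN[OF assms(1,2), of M G] by linarith

lemma match_prob_Un: "finite S \<Longrightarrow> match_prob S M (A \<union> B) \<le> match_prob S M A + match_prob S M B"
  using match_prob_UN[of S "{True,False}" M "\<lambda>b. if b then A else B"] by (simp add: Un_commute)

text \<open>Revealing one half-edge of \<open>A\<close> at a time destroys at most two of them, and each
  revealed one misses \<open>B\<close> with probability at most \<open>1 - |B|/|S|\<close>.\<close>
lemma match_prob_no_pair: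
  assumes "finite S" "partial_matching S M" "A \<subseteq> S - Domain M" "B \<subseteq> S - Domain M" "A \<inter> B = {}"
  shows "match_prob S M {\<sigma>. \<forall>a\<in>A. \<sigma> a \<notin> B} \<le> exp (- real (card A) * real (card B) / (2 * real (card S)))"
  using assms(2-)
proof (induction "card A" arbitrary: A M rule: less_induct)
  case less
  have fA: "finite A" "finite B" using less.prems assms(1) by (meson Diff_subset finite_subset order_trans)+
  \<comment> \<open>The denominator is doubled because one revelation may use up two elements of
    \<open>A\<close>: missing \<open>B\<close> has probability at most \<open>1 - 2 * b\<close>, and
    the exponent loses at most \<open>2 * b\<close>.\<close>
  define b where "b = real (card B) / (2 * real (card S))"
  have b0: "b \<ge> 0" by (simp add: b_def)
  show ?case
  proof (cases "A = {}")
    case True then show ?thesis using match_prob_le1[OF assms(1)] by simp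
  next
    case False
    then obtain h where h: "h \<in> A" by auto
    have hS: "h \<in> S - Domain M" using h less.prems by auto
    let ?E = "{\<sigma>. \<forall>a\<in>A. \<sigma> a \<notin> B}"
    let ?Y = "S - Domain M - {h}"
    have bd: "match_prob S (addp h y M) ?E \<le> (if y \<in> B then 0 else exp (- (real (card A) - 2) * b))" if y: "y \<in> ?Y" for y
    proof (cases "y \<in> B")
      case True
      have "ext S (addp h y M) \<inter> ?E = {}" using True h by (auto dest: ext_addpD)
      then show ?thesis using True by (simp add: match_prob_eq0)
    next
      case False
      let ?A = "A - {h,y}"
      have lt: "card ?A < card A" using h fA by (intro psubset_card_mono) auto
      have pm: "partial_matching S (addp h y M)" using less.prems y hS by (intro partial_matching_addp) auto
      have "match_prob S (addp h y M) ?E \<le> match_prob S (addp h y M) {\<sigma>. \<forall>a\<in>?A. \<sigma> a \<notin> B}"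
        by (intro match_prob_mono assms) auto
      also have "\<dots> \<le> exp (- real (card ?A) * real (card B) / (2 * real (card S)))"
        by (rule less.hyps[OF lt pm]) (use less.prems False h in auto)
      also have "\<dots> \<le> exp (- (real (card A) - 2) * b)"
      proof -
        have "card A \<le> card ?A + card {h,y}"
          using card_mono[of "?A \<union> {h,y}" A] card_Un_le[of ?A "{h,y}"] fA by (auto intro: order_trans)
        also have "card {h,y} \<le> 2" by (simp add: card_insert_if)
        finally have "real (card A) - 2 \<le> real (card ?A)" by linarith
        then have "(real (card A) - 2) * b \<le> real (card ?A) * b" using b0 by (intro mult_right_mono) auto
        then have "- real (card ?A) * b \<le> - (real (card A) - 2) * b" by linarith
        then show ?thesis by (simp add: b_def)
      qed
      finally show ?thesis using False by simp
    qed
    define k where "k = card (S - Domain M)"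
    have cY: "card ?Y = k - 1" using hS assms(1) by (simp add: k_def)
    have BY: "B \<subseteq> ?Y" using less.prems h by auto
    have kS: "k \<le> card S" unfolding k_def using assms(1) by (intro card_mono) auto
    have "match_prob S M ?E = (\<Sum>y\<in>?Y. match_prob S (addp h y M) ?E) / real (k - 1)"
      unfolding k_def by (rule match_prob_step[OF assms(1) less.prems(1) hS])
    also have "\<dots> \<le> (\<Sum>y\<in>?Y. if y \<in> B then 0 else exp (- (real (card A) - 2) * b)) / real (k - 1)"
      by (intro divide_right_mono sum_mono bd) auto
    also have "(\<Sum>y\<in>?Y. if y \<in> B then 0 else exp (- (real (card A) - 2) * b)) = (\<Sum>y\<in>?Y - B. exp (- (real (card A) - 2) * b))"
      using assms(1) by (intro sum.mono_neutral_cong_right) auto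
    also have "\<dots> = (real (k - 1) - real (card B)) * exp (- (real (card A) - 2) * b)"
      using BY fA cY card_mono[OF _ BY] assms(1) by (simp add: card_Diff_subset of_nat_diff)
    also have "\<dots> / real (k - 1) \<le> (1 - 2 * b) * exp (- (real (card A) - 2) * b)"
    \<comment> \<open>Without candidates the quotient is a division by zero; then \<open>B\<close>
      is empty, \<open>b = 0\<close>, and the bound is trivial.\<close>
    proof (cases "k - 1 = 0")
      case True
      have "?Y = {}" using cY True assms(1) by (metis card_0_eq finite_Diff)
      then have "B = {}" using BY by blast
      then have "card B = 0" by simp
      then show ?thesis using True b_def by simp
    next
      case False
      have "real (card B) / real (card S) \<le> real (card B) / real (k - 1)"
        using False kS by (intro divide_left_mono) auto
      then have "(real (k - 1) - real (card B)) / real (k - 1) \<le> 1 - 2 * b"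
        using False by (simp add: b_def diff_divide_distrib)
      from mult_right_mono[OF this, of "exp (- (real (card A) - 2) * b)"] show ?thesis by simp
    qed
    also have "\<dots> \<le> exp (- 2 * b) * exp (- (real (card A) - 2) * b)"
      using exp_ge_add_one_self[of "- 2 * b"] by (intro mult_right_mono) auto
    also have "\<dots> = exp (- real (card A) * b)"
      by (simp add: exp_add[symmetric] algebra_simps)
    also have "\<dots> = exp (- real (card A) * real (card B) / (2 * real (card S)))"
      by (simp add: b_def)
    finally show ?thesis .
  qed
qed

section \<open>Half-edges and the configuration model as a uniform matching\<close>

lemma half_edges_eq: "half_edges n d = Sigma {..<n} (\<lambda>i. {..<d i})"
  by (auto simp: half_edges_def)

lemma finite_half_edges [simp]: "finite (half_edges n d)"
  by (auto simp: half_edges_eq)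

lemma card_half_edges: "card (half_edges n d) = (\<Sum>i<n. d i)"
  unfolding half_edges_eq by simp

lemma prob_CM:
  assumes "even (\<Sum>i<n. d i)"
  shows "measure_pmf.prob (CM n d) E = match_prob (half_edges n d) {} E"
proof -
  have p: "pairings n d = matchings (half_edges n d)" by (simp add: pairings_def matchings_def)
  have "card (matchings (half_edges n d)) > 0"
    using card_ext[of "half_edges n d" "{}"] num_matchings_even_pos[OF assms] by (simp add: card_half_edges)
  then have "matchings (half_edges n d) \<noteq> {}" by auto
  then show ?thesis unfolding CM_def p match_prob_def
    by (simp add: measure_pmf_of_set finite_matchings Int_commute)
qed

section \<open>Exploration towards the core\<close>

definition hes :: "(nat \<Rightarrow> nat) \<Rightarrow> nat set \<Rightarrow> (nat \<times> nat) set" where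
  "hes d X = Sigma X (\<lambda>i. {..<d i})"

lemma hes_mono: "X \<subseteq> Y \<Longrightarrow> hes d X \<subseteq> hes d Y" by (auto simp: hes_def)

lemma hes_subset: "X \<subseteq> {..<n} \<Longrightarrow> hes d X \<subseteq> half_edges n d"
  by (auto simp: hes_def half_edges_def)

lemma mem_hes [simp]: "(x, j) \<in> hes d X \<longleftrightarrow> x \<in> X \<and> j < d x" by (auto simp: hes_def)

lemma finite_hes [simp]: "finite X \<Longrightarrow> finite (hes d X)" by (simp add: hes_def)

lemma card_hes: "finite X \<Longrightarrow> card (hes d X) = (\<Sum>i\<in>X. d i)" by (simp add: hes_def)

lemma sum_half_edges:
  fixes g :: "nat \<Rightarrow> real"
  assumes "finite X" shows "(\<Sum>y\<in>hes d X. g (fst y)) = (\<Sum>i\<in>X. real (d i) * g i)"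
proof -
  have "(\<Sum>y\<in>hes d X. g (fst y)) = (\<Sum>(i,j)\<in>Sigma X (\<lambda>i. {..<d i}). g i)"
    unfolding hes_def by (intro sum.cong) auto
  also have "\<dots> = (\<Sum>i\<in>X. \<Sum>j<d i. g i)" using assms by (subst sum.Sigma[symmetric]) auto
  finally show ?thesis by simp
qed

lemma cm_adjI:
  assumes "h \<in> half_edges n d" "\<sigma> h \<in> half_edges n d"
  shows "(fst h, fst (\<sigma> h)) \<in> cm_adj n d \<sigma>"
  using assms by (cases h; cases "\<sigma> h") (auto simp: cm_adj_def half_edges_def)

lemma cm_adjI_ext:
  assumes "\<sigma> \<in> matchings (half_edges n d)" "h \<in> half_edges n d"
  shows "(fst h, fst (\<sigma> h)) \<in> cm_adj n d \<sigma>"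
  using assms by (intro cm_adjI) (auto simp: matchings_def)

definition far_from_core :: "nat \<Rightarrow> (nat \<Rightarrow> nat) \<Rightarrow> nat \<Rightarrow> nat \<Rightarrow> nat \<Rightarrow> ((nat \<times> nat) \<Rightarrow> (nat \<times> nat)) set" where
  "far_from_core n d K R v = {\<sigma>. \<forall>z t. z < n \<and> K \<le> d z \<and> t \<le> R \<longrightarrow> (v, z) \<notin> cm_adj n d \<sigma> ^^ t}"

text \<open>\<open>f r\<close> plays the role of a bound on the probability that a half-edge with
  \<open>r\<close> steps left does not lead to degree at least \<open>K\<close>. In
  \<open>rec\<close> the partner is averaged over the unexplored half-edges: a core vertex ends the
  exploration and contributes \<open>0\<close>, any other one the product over its
  \<open>d (fst y) - 1\<close> remaining half-edges. The inequality holds for every explored set of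
  at most \<open>N\<close> half-edges, so the law of the past never enters.\<close>

locale exploration =
  fixes n :: nat and d :: "nat \<Rightarrow> nat" and K R N :: nat and f :: "nat \<Rightarrow> real"
  assumes f0: "f 0 = 1" and fpos: "\<And>r. f r > 0" and fle: "\<And>r. r \<le> R \<Longrightarrow> f R \<le> f r"
    and rec: "\<And>X r. X \<subseteq> {..<n} \<Longrightarrow> card (hes d X) \<le> N \<Longrightarrow> r < R \<Longrightarrow>
      (\<Sum>y\<in>half_edges n d - hes d X. if d (fst y) < K then f r ^ (d (fst y) - 1) else 0)
        \<le> f (Suc r) * real (card (half_edges n d - hes d X))"
    and N: "N < card (half_edges n d)"
begin

abbreviation "H \<equiv> half_edges n d"

text \<open>Bound for the chance that a revealed partner is itself active: there are at most
  \<open>N\<close> active half-edges, against at least \<open>card H - N\<close> unexplored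
  ones.\<close>

definition q where "q = real N / real (card H - N)"

text \<open>\<open>e\<close> is the number of further collisions after which the argument gives up.
  The first summand is the survival product with two factors, each at least \<open>f R\<close>,
  removed for every one of the \<open>e - 1\<close> collisions still tolerated; the second bounds
  the probability of \<open>e\<close> collisions within \<open>T\<close> steps.\<close>

definition bnd :: "nat \<Rightarrow> real \<Rightarrow> nat \<Rightarrow> real" where
  "bnd e P T = (if e = 0 then 1 else P / (f R)^(2 * (e - 1)) + (real T * q)^e)"

lemma q0: "q \<ge> 0" by (simp add: q_def)

text \<open>Here \<open>\<rho> x\<close> is the number of steps still allowed from the explored vertex \<open>x\<close> and \<open>2 - e\<close> the number
  of collisions so far. The product over the active half-edges is a supermartingale except at a collision,
  which removes two factors and thus increases it by at most \<open>1 / f R ^ 2\<close>; the sum of the powers of \<open>K\<close> bounds the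
  number of remaining steps, hence the probability of further collisions.\<close>
lemma explore:
  assumes "partial_matching H M" "X \<subseteq> {..<n}" "Domain M \<subseteq> hes d X"
    and "\<And>x. x \<in> X \<Longrightarrow> d x < K \<and> \<rho> x \<le> R \<and> (\<forall>\<sigma>\<in>ext H M. \<exists>t\<le>R - \<rho> x. (v, x) \<in> cm_adj n d \<sigma> ^^ t)"
    and "card (hes d X) + K * (\<Sum>h\<in>hes d X - Domain M. K ^ \<rho> (fst h)) \<le> N" and "e \<le> 2"
  shows "match_prob H M (far_from_core n d K R v) \<le>
    bnd e (\<Prod>h\<in>hes d X - Domain M. f (\<rho> (fst h))) (\<Sum>h\<in>hes d X - Domain M. K ^ \<rho> (fst h))"
  using assms
proof (induction "\<Sum>h\<in>hes d X - Domain M. K ^ \<rho> (fst h)" arbitrary: M X \<rho> e rule: less_induct)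
  case less
  let ?A = "hes d X - Domain M" and ?E = "far_from_core n d K R v"
  define P where "P = (\<Prod>h\<in>?A. f (\<rho> (fst h)))"
  define T where "T = (\<Sum>h\<in>?A. K ^ \<rho> (fst h))"
  have finX: "finite X" using less.prems(2) finite_subset by blast
  have finA: "finite ?A" using finX by simp
  have P0: "P > 0" unfolding P_def by (intro prod_pos) (simp add: fpos)
  have FR: "0 < f R" "f R \<le> 1" using fpos fle[of 0] f0 by auto
  have AH: "hes d X \<subseteq> H" by (rule hes_subset[OF less.prems(2)])
  show ?case unfolding P_def[symmetric] T_def[symmetric]
  proof (cases "e = 0")
    case True then show "match_prob H M ?E \<le> bnd e P T" by (simp add: bnd_def match_prob_le1)
  next
    case e: False
    show "match_prob H M ?E \<le> bnd e P T"
    proof (cases "\<exists>h\<in>?A. \<rho> (fst h) \<noteq> 0")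
      \<comment> \<open>No active half-edge has steps left: all factors are \<open>f 0 = 1\<close>,
        so the claimed bound is at least \<open>1\<close>.\<close>
      case False
      then have "P = 1" unfolding P_def by (intro prod.neutral) (auto simp: f0)
      moreover have "1 \<le> 1 / (f R)^(2 * (e - 1))" using FR by (simp add: power_le_one)
      ultimately have "1 \<le> bnd e P T" using e q0 by (simp add: bnd_def add_increasing2)
      then show ?thesis using match_prob_le1[of H M ?E] by auto
    next
      case True
      then obtain h where h: "h \<in> ?A" "\<rho> (fst h) \<noteq> 0" by auto
      then obtain r where r: "\<rho> (fst h) = Suc r" using not0_implies_Suc by blast
      have hX: "fst h \<in> X" using h by (auto simp: hes_def)
      have rR: "Suc r \<le> R" using less.prems(4)[OF hX] r by auto
      have K0: "K > 0" using less.prems(4)[OF hX] by auto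
      have hS: "h \<in> H - Domain M" using h AH by auto
      define A' where "A' = ?A - {h}"
      define B where "B = H - hes d X"
      have Y: "H - Domain M - {h} = A' \<union> B" "A' \<inter> B = {}" "finite A'" "finite B"
        using AH h less.prems(3) finA by (auto simp: A'_def B_def)
      define a where "a = real (card A')"
      define b where "b = real (card B)"
      have PA: "P = f (Suc r) * (\<Prod>h\<in>A'. f (\<rho> (fst h)))"
        unfolding P_def A'_def using prod.remove[OF finA h(1), of "\<lambda>h. f (\<rho> (fst h))"] r by simp
      have TA: "T = K ^ Suc r + (\<Sum>h\<in>A'. K ^ \<rho> (fst h))"
        unfolding T_def A'_def using sum.remove[OF finA h(1), of "\<lambda>h. K ^ \<rho> (fst h)"] r by simp
      have T1: "1 \<le> T" using TA K0 by (metis One_nat_def Suc_leI add_gr_0 zero_less_power)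
      have cXN: "card (hes d X) \<le> N" using less.prems(5) by simp
      have reach: "\<exists>t\<le>R - r. (v, fst y) \<in> cm_adj n d \<sigma> ^^ t"
        if s: "\<sigma> \<in> ext H (addp h y M)" and y: "y \<in> H" for \<sigma> y
      proof -
        have s1: "\<sigma> \<in> ext H M" using subsetD[OF ext_addp_subset s] .
        obtain t where t: "t \<le> R - \<rho> (fst h)" "(v, fst h) \<in> cm_adj n d \<sigma> ^^ t"
          using less.prems(4)[OF hX] s1 by blast
        have "(fst h, fst y) \<in> cm_adj n d \<sigma>"
          using cm_adjI_ext[OF ext_matchings[OF s], of h] hS ext_addpD[OF s] by simp
        then have "(v, fst y) \<in> cm_adj n d \<sigma> ^^ Suc t" using t(2) by (rule relpow_Suc_I[rotated])
        moreover have "Suc t \<le> R - r" using t(1) r rR by simp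
        ultimately show ?thesis by blast
      qed
      \<comment> \<open>A collision. With \<open>e = 1\<close> the bound is abandoned at
        \<open>1\<close>; with \<open>e = 2\<close> the induction continues with
        \<open>e = 1\<close>, and removing the factors of \<open>h\<close> and \<open>y\<close>
        raises the product by at most \<open>1 / (f R)^2\<close>.\<close>
      have ca: "match_prob H (addp h y M) ?E \<le> (if e = 1 then 1 else P / (f R)^2 + real (T - 1) * q)"
        if y: "y \<in> A'" for y
      proof (cases "e = 1")
        case True then show ?thesis by (simp add: match_prob_le1)
      next
        case False
        then have e2: "e = 2" using e less.prems(6) by simp
        have yA: "y \<in> ?A" "y \<noteq> h" using y by (auto simp: A'_def)
        have pm: "partial_matching H (addp h y M)" using yA AH hS by (intro partial_matching_addp less.prems) auto
        have Aeq: "hes d X - Domain (addp h y M) = A' - {y}" by (auto simp: A'_def)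
        have T': "T = K ^ Suc r + (K ^ \<rho> (fst y) + (\<Sum>h\<in>A' - {y}. K ^ \<rho> (fst h)))"
          unfolding TA using sum.remove[OF Y(3) y, of "\<lambda>h. K ^ \<rho> (fst h)"] by simp
        have P': "P = f (Suc r) * (f (\<rho> (fst y)) * (\<Prod>h\<in>A' - {y}. f (\<rho> (fst h))))"
          unfolding PA using prod.remove[OF Y(3) y, of "\<lambda>h. f (\<rho> (fst h))"] by simp
        have Kp: "K ^ Suc r \<ge> 1" using K0 by (metis One_nat_def Suc_leI zero_less_power)
        have Tl: "(\<Sum>h\<in>A' - {y}. K ^ \<rho> (fst h)) \<le> T - 1" using T' Kp by linarith
        then have Tl': "(\<Sum>h\<in>A' - {y}. K ^ \<rho> (fst h)) < T" using T1 by linarith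
        have st: "\<And>x. x \<in> X \<Longrightarrow> d x < K \<and> \<rho> x \<le> R \<and> (\<forall>\<sigma>\<in>ext H (addp h y M). \<exists>t\<le>R - \<rho> x. (v, x) \<in> cm_adj n d \<sigma> ^^ t)"
          using less.prems(4) subsetD[OF ext_addp_subset] by metis
        have "match_prob H (addp h y M) ?E \<le> bnd 1 (\<Prod>h\<in>A' - {y}. f (\<rho> (fst h))) (\<Sum>h\<in>A' - {y}. K ^ \<rho> (fst h))"
        proof (rule less.hyps[where X = X and M = "addp h y M" and \<rho> = \<rho> and e = 1, unfolded Aeq])
          show "(\<Sum>h\<in>A' - {y}. K ^ \<rho> (fst h)) < (\<Sum>h\<in>hes d X - Domain M. K ^ \<rho> (fst h))"
            using Tl' T_def by simp
          show "card (hes d X) + K * (\<Sum>h\<in>A' - {y}. K ^ \<rho> (fst h)) \<le> N"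
            using less.prems(5) Tl' mult_le_mono2[of _ T K] unfolding T_def[symmetric]
            by (meson add_left_mono le_trans less_imp_le)
          show "Domain (addp h y M) \<subseteq> hes d X" using h yA less.prems(3) by auto
        qed (use pm less.prems(2) st in auto)
        also have "\<dots> = (\<Prod>h\<in>A' - {y}. f (\<rho> (fst h))) + real (\<Sum>h\<in>A' - {y}. K ^ \<rho> (fst h)) * q"
          by (simp add: bnd_def)
        also have "\<dots> \<le> P / (f R)^2 + real (T - 1) * q"
        proof (rule add_mono)
          let ?p = "\<Prod>h\<in>A' - {y}. f (\<rho> (fst h))"
          have p0: "?p \<ge> 0" by (intro prod_nonneg) (simp add: fpos less_imp_le)
          have yX: "fst y \<in> X" using yA by (auto simp: hes_def)
          have "f R * f R \<le> f (Suc r) * f (\<rho> (fst y))"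
            using fle[OF rR] fle[of "\<rho> (fst y)"] less.prems(4)[OF yX] FR by (intro mult_mono) (auto simp: fpos less_imp_le)
          then have "?p * (f R * f R) \<le> ?p * (f (Suc r) * f (\<rho> (fst y)))" using p0 by (intro mult_left_mono)
          also have "\<dots> = P" by (simp add: P' mult_ac)
          finally show "?p \<le> P / (f R)^2" using FR by (simp add: pos_le_divide_eq power2_eq_square)
          show "real (\<Sum>h\<in>A' - {y}. K ^ \<rho> (fst h)) * q \<le> real (T - 1) * q"
            using Tl q0 by (intro mult_right_mono) (simp_all only: of_nat_le_iff)
        qed
        finally show ?thesis using e2 by simp
      qed
      define c where "c = P / (f R)^(2 * (e - 1))"
      have c0: "c \<ge> 0" using P0 FR by (simp add: c_def)
      \<comment> \<open>A new vertex. Degree at least \<open>K\<close> makes the event impossible;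
        otherwise the factor \<open>f (Suc r)\<close> of \<open>h\<close> is replaced by a factor
        \<open>f r\<close> for each of the \<open>d (fst y) - 1\<close> new half-edges.\<close>
      have cb: "match_prob H (addp h y M) ?E \<le> c / f (Suc r) * (if d (fst y) < K then f r ^ (d (fst y) - 1) else 0) + (real (T - 1) * q) ^ e"
        if y: "y \<in> B" for y
      proof (cases "d (fst y) < K")
        case False
        have yH: "y \<in> H" using y by (auto simp: B_def)
        have "ext H (addp h y M) \<inter> ?E = {}"
        proof (rule ccontr)
          assume "ext H (addp h y M) \<inter> ?E \<noteq> {}"
          then obtain \<sigma> where s: "\<sigma> \<in> ext H (addp h y M)" "\<sigma> \<in> ?E" by auto
          obtain t where t: "t \<le> R - r" "(v, fst y) \<in> cm_adj n d \<sigma> ^^ t" using reach[OF s(1) yH] by blast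
          have "fst y < n" using yH by (auto simp: half_edges_def)
          then show False using s(2) t False by (auto simp: far_from_core_def)
        qed
        then show ?thesis using False q0 by (simp add: match_prob_eq0)
      next
        case dK: True
        define z where "z = fst y"
        have zX: "z \<notin> X" and zn: "z < n" and yz: "snd y < d z" and yH: "y \<in> H"
          using y by (auto simp: B_def z_def half_edges_def hes_def)
        define X' where "X' = insert z X"
        define \<rho>' where "\<rho>' = \<rho>(z := r)"
        define Zh where "Zh = hes d {z} - {y}"
        have yhz: "y \<in> hes d {z}" using yz by (cases y) (auto simp: z_def)
        have cZ: "card Zh = d z - 1" using yhz by (simp add: Zh_def card_hes)
        have hesX': "hes d X' = hes d X \<union> hes d {z}" "hes d X \<inter> hes d {z} = {}"
          using zX by (auto simp: X'_def hes_def)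
        have Aeq: "hes d X' - Domain (addp h y M) = A' \<union> Zh"
        proof -
          have "hes d {z} \<inter> Domain M = {}" using less.prems(3) hesX'(2) by blast
          moreover have "h \<notin> hes d {z}" using h(1) hesX'(2) by blast
          moreover have "y \<notin> hes d X" using yhz hesX'(2) by blast
          ultimately show ?thesis unfolding hesX'(1) Domain_addp A'_def Zh_def by blast
        qed
        have dis: "A' \<inter> Zh = {}" using hesX'(2) by (auto simp: A'_def Zh_def)
        have finZ: "finite Zh" by (simp add: Zh_def)
        have onA: "\<rho>' (fst g) = \<rho> (fst g)" if "g \<in> A'" for g
          using that zX by (auto simp: A'_def \<rho>'_def hes_def)
        have onZ: "\<rho>' (fst g) = r" if "g \<in> Zh" for g
          using that by (auto simp: Zh_def \<rho>'_def hes_def)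
        have PP: "(\<Prod>h\<in>A' \<union> Zh. f (\<rho>' (fst h))) = (\<Prod>h\<in>A'. f (\<rho> (fst h))) * f r ^ (d z - 1)"
          unfolding prod.union_disjoint[OF Y(3) finZ dis] using onA onZ cZ by simp
        have TT: "(\<Sum>h\<in>A' \<union> Zh. K ^ \<rho>' (fst h)) = (\<Sum>h\<in>A'. K ^ \<rho> (fst h)) + (d z - 1) * K ^ r"
          unfolding sum.union_disjoint[OF Y(3) finZ dis] using onA onZ cZ by simp
        \<comment> \<open>The weights \<open>K ^ \<rho>\<close> are chosen for this: fewer than
          \<open>K - 1\<close> new half-edges with one step less weigh strictly less than the
          consumed one. Hence \<open>T\<close> drops at every revelation, which gives termination
          and bounds the number of steps.\<close>
        have "(d z - 1) * K ^ r + 1 \<le> K ^ Suc r"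
        proof -
          have "(d z - 1) * K ^ r + 1 * K ^ r \<le> K * K ^ r"
            unfolding add_mult_distrib[symmetric] using dK yz z_def by (intro mult_right_mono) auto
          moreover have "1 \<le> K ^ r" using K0 by (metis One_nat_def Suc_leI zero_less_power)
          ultimately show ?thesis by simp
        qed
        then have Tl: "(\<Sum>h\<in>A' \<union> Zh. K ^ \<rho>' (fst h)) \<le> T - 1" unfolding TT TA by linarith
        then have Tl': "(\<Sum>h\<in>A' \<union> Zh. K ^ \<rho>' (fst h)) < T" using T1 by linarith
        have pm: "partial_matching H (addp h y M)"
          using y hS less.prems(3) h yH by (intro partial_matching_addp less.prems) (auto simp: B_def)
        have st: "d x < K \<and> \<rho>' x \<le> R \<and> (\<forall>\<sigma>\<in>ext H (addp h y M). \<exists>t\<le>R - \<rho>' x. (v, x) \<in> cm_adj n d \<sigma> ^^ t)"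
          if x: "x \<in> X'" for x
        proof (cases "x = z")
          case True
          then have *: "x = fst y" "\<rho>' (fst y) = r" by (auto simp: \<rho>'_def z_def)
          show ?thesis unfolding * using dK rR reach[OF _ yH] by auto
        next
          case False
          then have "x \<in> X" "\<rho>' x = \<rho> x" using x by (auto simp: X'_def \<rho>'_def)
          then show ?thesis using less.prems(4) subsetD[OF ext_addp_subset] by metis
        qed
        have "match_prob H (addp h y M) ?E \<le> bnd e (\<Prod>h\<in>A' \<union> Zh. f (\<rho>' (fst h))) (\<Sum>h\<in>A' \<union> Zh. K ^ \<rho>' (fst h))"
        proof (rule less.hyps[where X = X' and M = "addp h y M" and \<rho> = \<rho>' and e = e, unfolded Aeq])
          show "(\<Sum>h\<in>A' \<union> Zh. K ^ \<rho>' (fst h)) < (\<Sum>h\<in>hes d X - Domain M. K ^ \<rho> (fst h))"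
            using Tl' T_def by simp
          have "card (hes d X') = card (hes d X) + d z"
            unfolding hesX'(1) using hesX'(2) finX by (subst card_Un_disjoint) (auto simp: card_hes)
          moreover have "d z + K * (\<Sum>h\<in>A' \<union> Zh. K ^ \<rho>' (fst h)) \<le> K * T"
          proof -
            have "K * (\<Sum>h\<in>A' \<union> Zh. K ^ \<rho>' (fst h)) \<le> K * (T - 1)" using Tl by (rule mult_le_mono2)
            moreover have "K + K * (T - 1) = K * T" using T1 by (cases T) auto
            moreover have "d z \<le> K" using dK z_def by simp
            ultimately show ?thesis using add_mono by metis
          qed
          ultimately show "card (hes d X') + K * (\<Sum>h\<in>A' \<union> Zh. K ^ \<rho>' (fst h)) \<le> N"
            using less.prems(5) unfolding T_def[symmetric] by linarith
          show "Domain (addp h y M) \<subseteq> hes d X'" using h yhz less.prems(3) hesX'(1) by auto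
          show "X' \<subseteq> {..<n}" using zn less.prems(2) by (auto simp: X'_def)
        qed (use pm st less.prems(6) in auto)
        also have "\<dots> = c / f (Suc r) * f r ^ (d z - 1) + (real (\<Sum>h\<in>A' \<union> Zh. K ^ \<rho>' (fst h)) * q) ^ e"
          unfolding bnd_def PP c_def PA using e fpos[of "Suc r"] by simp
        also have "\<dots> \<le> c / f (Suc r) * f r ^ (d z - 1) + (real (T - 1) * q) ^ e"
          using Tl q0 by (intro add_left_mono power_mono mult_right_mono) (simp_all only: of_nat_le_iff, auto intro!: mult_nonneg_nonneg sum_nonneg)
        finally show ?thesis using dK by (simp add: z_def)
      qed
      have sA: "(\<Sum>y\<in>A'. match_prob H (addp h y M) ?E) \<le> a * (if e = 1 then 1 else P / (f R)^2 + real (T - 1) * q)"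
        using sum_mono[of A' _ "\<lambda>_. (if e = 1 then 1 else P / (f R)^2 + real (T - 1) * q)", OF ca] by (simp add: a_def)
      have sB: "(\<Sum>y\<in>B. match_prob H (addp h y M) ?E) \<le> c * b + b * (real (T - 1) * q) ^ e"
      proof -
        have "(\<Sum>y\<in>B. match_prob H (addp h y M) ?E) \<le> (\<Sum>y\<in>B. c / f (Suc r) * (if d (fst y) < K then f r ^ (d (fst y) - 1) else 0) + (real (T - 1) * q) ^ e)"
          by (rule sum_mono) (rule cb)
        also have "\<dots> = c / f (Suc r) * (\<Sum>y\<in>B. if d (fst y) < K then f r ^ (d (fst y) - 1) else 0) + b * (real (T - 1) * q) ^ e"
          by (simp add: sum.distrib sum_distrib_left b_def)
        also have "\<dots> \<le> c / f (Suc r) * (f (Suc r) * b) + b * (real (T - 1) * q) ^ e"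
          using rec[OF less.prems(2) cXN, of r] rR c0 fpos[of "Suc r"]
          by (intro add_right_mono mult_left_mono) (auto simp: B_def b_def)
        finally show ?thesis using fpos[of "Suc r"] by simp
      qed
      have cY: "real (card (H - Domain M) - 1) = a + b"
      proof -
        have "card (H - Domain M) - 1 = card (H - Domain M - {h})" using hS by simp
        then show ?thesis unfolding Y(1) using Y by (simp add: card_Un_disjoint a_def b_def)
      qed
      have aq: "a \<le> q * (a + b)"
      proof -
        have "A' \<subseteq> hes d X" by (auto simp: A'_def)
        then have "card A' \<le> card (hes d X)" using finX by (intro card_mono) auto
        then have c1: "card A' \<le> N" using cXN by simp
        have "card H - N \<le> card (A' \<union> B)"
        proof -
          have "H \<subseteq> (A' \<union> B) \<union> hes d X" by (auto simp: B_def)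
          then have "card H \<le> card ((A' \<union> B) \<union> hes d X)" using Y finX by (intro card_mono) auto
          also have "\<dots> \<le> card (A' \<union> B) + card (hes d X)" by (rule card_Un_le)
          finally show ?thesis using cXN by simp
        qed
        then have "real (card H - N) \<le> a + b" using Y by (simp add: card_Un_disjoint a_def b_def)
        moreover have "a \<le> real N" using c1 by (simp add: a_def)
        moreover have "real (card H - N) > 0" using N by simp
        ultimately have "a * real (card H - N) \<le> real N * (a + b)" by (intro mult_mono) (auto simp: a_def)
        then show ?thesis using \<open>real (card H - N) > 0\<close> by (simp add: q_def field_simps)
      qed
      have "match_prob H M ?E = (\<Sum>y\<in>A' \<union> B. match_prob H (addp h y M) ?E) / (a + b)"
        using match_prob_step[OF _ less.prems(1) hS, of ?E] unfolding cY Y(1) by simp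
      also have "(\<Sum>y\<in>A' \<union> B. match_prob H (addp h y M) ?E) = (\<Sum>y\<in>A'. match_prob H (addp h y M) ?E) + (\<Sum>y\<in>B. match_prob H (addp h y M) ?E)"
        using Y by (intro sum.union_disjoint) auto
      also have "\<dots> \<le> (a + b) * bnd e P T"
      proof -
        define s where "s = real (T - 1)"
        have s: "s \<ge> 0" "real T = s + 1" using T1 by (auto simp: s_def)
        have ab: "a \<ge> 0" "b \<ge> 0" by (auto simp: a_def b_def)
        consider "e = 1" | "e = 2" using e less.prems(6) by linarith
        then show ?thesis
        proof cases
          case 1
          \<comment> \<open>Collisions make up at most the fraction \<open>q\<close> of all
            partners, which raises \<open>s * q\<close> to \<open>(s + 1) * q\<close>.\<close>
          have "a * 1 + (c * b + b * (s * q)) \<le> (a + b) * (c + (s + 1) * q)"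
          proof -
            have "a * c \<ge> 0" "a * (s * q) \<ge> 0" using ab c0 s q0 by auto
            then show ?thesis using aq by (simp add: algebra_simps)
          qed
          then show ?thesis using sA sB 1 s by (simp add: bnd_def c_def s_def[symmetric])
        next
          case 2
          \<comment> \<open>The term \<open>c\<close> is common to collisions and new vertices and
            simply averages. Collisions add \<open>s * q^2\<close>, for which
            \<open>(s + 1)^2\<close> has room next to \<open>s^2\<close>.\<close>
          have "a * (c + s * q) + (c * b + b * (s * q)^2) \<le> (a + b) * (c + ((s + 1) * q)^2)"
          proof -
            have 1: "a * (s * q) \<le> q * (a + b) * (s * q)" using aq s q0 by (intro mult_right_mono) auto
            have 2: "b * (s * q)^2 \<le> (a + b) * (s * q)^2" using ab by (intro mult_right_mono) auto
            have "(a + b) * ((s * q)^2 + s * q^2) \<le> (a + b) * ((s + 1) * q)^2"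
            proof (rule mult_left_mono)
              have "0 \<le> s * q^2" "0 \<le> q^2" using s by auto
              then show "(s * q)^2 + s * q^2 \<le> ((s + 1) * q)^2" by (simp add: power2_eq_square algebra_simps)
            qed (use ab in simp)
            then show ?thesis using 1 2 by (simp add: algebra_simps power2_eq_square)
          qed
          then show ?thesis using sA sB 2 s by (simp add: bnd_def c_def s_def[symmetric])
        qed
      qed
      finally have *: "match_prob H M ?E \<le> (a + b) * bnd e P T / (a + b)"
        by (simp add: divide_right_mono a_def b_def)
      have "bnd e P T \<ge> 0" using P0 FR q0 by (simp add: bnd_def)
      then show ?thesis using * by (cases "a + b = 0") auto
    qed
  qed
qed

text \<open>The root starts with at least three factors \<open>f R\<close>; the tolerated collision
  takes two and one remains. The initial weight \<open>d v * K ^ R\<close> is at most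
  \<open>K ^ Suc R\<close>.\<close>

lemma far_from_core_bound:
  assumes "v < n" "3 \<le> d v" "d v < K" "K + K * K ^ Suc R \<le> N"
  shows "match_prob H {} (far_from_core n d K R v) \<le> f R + (real (K ^ Suc R) * q) ^ 2"
proof -
  have FR: "0 < f R" "f R \<le> 1" using fpos fle[of 0] f0 by auto
  have T: "(\<Sum>h\<in>hes d {v}. K ^ R) = d v * K ^ R" by (simp add: card_hes)
  have P: "(\<Prod>h\<in>hes d {v}. f R) = f R ^ d v" by (simp add: card_hes)
  have TK: "d v * K ^ R \<le> K ^ Suc R" using assms(3) by simp
  have "d v + K * (d v * K ^ R) \<le> N"
    using assms(3,4) mult_le_mono2[OF TK, of K] by linarith
  moreover have "\<exists>t\<le>R - R. (v, v) \<in> cm_adj n d \<sigma> ^^ t" for \<sigma> by (intro exI[of _ 0]) auto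
  ultimately have "match_prob H {} (far_from_core n d K R v) \<le> bnd 2 (f R ^ d v) (d v * K ^ R)"
    using explore[of "{}" "{v}" "\<lambda>_. R" v 2] assms by (simp add: T P card_hes)
  also have "\<dots> = f R ^ d v / (f R)^2 + (real (d v * K ^ R) * q) ^ 2" by (simp add: bnd_def)
  also have "\<dots> \<le> f R + (real (K ^ Suc R) * q) ^ 2"
  proof (rule add_mono)
    have "f R ^ d v \<le> f R ^ 3" using FR assms(2) by (intro power_decreasing) auto
    then show "f R ^ d v / (f R)^2 \<le> f R" using FR by (simp add: divide_le_eq power3_eq_cube power2_eq_square mult_ac)
    show "(real (d v * K ^ R) * q) ^ 2 \<le> (real (K ^ Suc R) * q) ^ 2"
      using TK q0 by (intro power_mono mult_right_mono) (simp_all only: of_nat_le_iff, auto)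
  qed
  finally show ?thesis .
qed

end

text \<open>A proportion \<open>\<rho>\<close> of the half-edges leads to degree above
  \<open>x0\<close> and contributes at most \<open>F ^ x0\<close>, the rest at most
  \<open>1\<close>. It is applied with \<open>x0\<close> about \<open>1 / (1 - F)\<close>, where
  \<open>F ^ x0\<close> is bounded away from \<open>1\<close>.\<close>

lemma exploration_average:
  fixes F :: real
  assumes "finite W" "0 \<le> F" "F \<le> 1"
    and hi: "\<rho> * real (card W) \<le> real (card {y \<in> W. x0 < d (fst y)})"
  shows "(\<Sum>y\<in>W. if d (fst y) < K then F ^ (d (fst y) - 1) else 0) \<le> (1 - \<rho> * (1 - F ^ x0)) * real (card W)"
proof -
  let ?U = "{y \<in> W. x0 < d (fst y)}"
  have "(\<Sum>y\<in>W. if d (fst y) < K then F ^ (d (fst y) - 1) else 0) \<le> (\<Sum>y\<in>W. 1 - (if x0 < d (fst y) then 1 - F ^ x0 else 0))"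
  proof (rule sum_mono)
    fix y assume "y \<in> W"
    have "F ^ (d (fst y) - 1) \<le> F ^ x0" if "x0 < d (fst y)"
      using that assms by (intro power_decreasing) auto
    moreover have "F ^ (d (fst y) - 1) \<le> 1" "0 \<le> F ^ x0" using assms by (auto simp: power_le_one)
    ultimately show "(if d (fst y) < K then F ^ (d (fst y) - 1) else 0) \<le> 1 - (if x0 < d (fst y) then 1 - F ^ x0 else 0)"
      by auto
  qed
  also have "\<dots> = real (card W) - (1 - F ^ x0) * real (card ?U)"
    unfolding sum_subtractf using assms(1) by (simp add: sum.If_cases Int_def conj_commute)
  also have "\<dots> \<le> real (card W) - (1 - F ^ x0) * (\<rho> * real (card W))"
    using hi assms by (intro diff_left_mono mult_left_mono) (auto simp: power_le_one)
  finally show ?thesis by (simp add: algebra_simps)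
qed

text \<open>The last step into the core, which starts the recursion at \<open>F = f 0 = 1\<close>:
  vertices of degree above \<open>K\<close> contribute \<open>0\<close> instead of a power of
  \<open>F\<close>.\<close>

lemma exploration_average_core:
  fixes F :: real
  assumes "finite W" "0 \<le> F" "F \<le> 1"
    and hi: "\<rho> * real (card W) \<le> real (card {y \<in> W. K < d (fst y)})"
  shows "(\<Sum>y\<in>W. if d (fst y) < K then F ^ (d (fst y) - 1) else 0) \<le> (1 - \<rho>) * real (card W)"
proof -
  have "(\<Sum>y\<in>W. if d (fst y) < K then F ^ (d (fst y) - 1) else 0) \<le> (\<Sum>y\<in>W. 1 - (if K < d (fst y) then 1 else 0))"
    using assms by (intro sum_mono) (auto simp: power_le_one)
  also have "\<dots> = real (card W) - real (card {y \<in> W. K < d (fst y)})"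
    unfolding sum_subtractf using assms(1) by (simp add: sum.If_cases Int_def conj_commute)
  also have "\<dots> \<le> real (card W) - \<rho> * real (card W)" using hi by simp
  finally show ?thesis by (simp add: algebra_simps)
qed

text \<open>The size-biased degree tail, not normalised. Weighting by the degree lowers the exponent
  of the tail by one, which is how \<open>\<tau> - 2\<close> arises from
  \<open>\<tau> - 1\<close>.\<close>

definition vol :: "nat \<Rightarrow> (nat \<Rightarrow> nat) \<Rightarrow> real \<Rightarrow> real" where
  "vol n d x = (\<Sum>i\<in>{i. i < n \<and> x < real (d i)}. real (d i))"

lemma card_hes_vol: "real (card (hes d {i. i < n \<and> x < real (d i)})) = vol n d x"
  by (simp add: card_hes vol_def)

lemma relpow_sym: "sym E \<Longrightarrow> (u, v) \<in> E ^^ t \<Longrightarrow> (v, u) \<in> E ^^ t"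
proof (induction t arbitrary: v)
  case (Suc t)
  then obtain w where w: "(u, w) \<in> E ^^ t" "(w, v) \<in> E" by auto
  then have "(w, u) \<in> E ^^ t" "(v, w) \<in> E" using Suc by (auto simp: sym_def)
  then show ?case by (meson relpow_Suc_I2)
qed auto

lemma sym_cm_adj:
  assumes "\<sigma> \<in> matchings (half_edges n d)" shows "sym (cm_adj n d \<sigma>)"
proof (rule symI)
  fix u v assume "(u, v) \<in> cm_adj n d \<sigma>"
  then obtain j k where jk: "u < n" "v < n" "j < d u" "k < d v" "\<sigma> (u,j) = (v,k)"
    by (auto simp: cm_adj_def)
  then have "\<sigma> (v,k) = (u,j)" 
  proof -
    have "(u,j) \<in> half_edges n d" using jk by (simp add: half_edges_def)
    then have "\<sigma> (\<sigma> (u,j)) = (u,j)" using assms by (simp add: matchings_def)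
    then show ?thesis using jk by simp
  qed
  then show "(v, u) \<in> cm_adj n d \<sigma>" using jk by (auto simp: cm_adj_def)
qed

text \<open>The survival probabilities \<open>f r\<close> are \<open>1 - g r\<close>. First \<open>g\<close> grows by
  \<open>g (r+1) = c5 * g r powr \<theta>\<close> (with \<open>c5 = c / (8 * C)\<close> and \<open>\<gamma>\<close> the logarithm of the fixed
  point), which takes doubly logarithmically many steps from \<open>exp (\<gamma> - y)\<close> to \<open>exp (\<gamma> - 1)\<close>;
  afterwards \<open>f (r+1) = f r ^ (D - 1)\<close>.\<close>

lemma core_reached:
  fixes n D K N s2 k2 R :: nat and d :: "nat \<Rightarrow> nat" and \<theta> c C \<gamma> y X :: real
  assumes vol: "\<And>x. 1 \<le> x \<Longrightarrow> x \<le> X \<Longrightarrow> c * real n * x powr (-\<theta>) \<le> vol n d x"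
    and len: "real (card (half_edges n d)) \<le> C * real n"
    and D: "\<And>i. i < n \<Longrightarrow> D \<le> d i" "3 \<le> D"
    and c: "0 < c" "c \<le> C" and th: "0 < \<theta>" "\<theta> < 1" and y: "0 \<le> y"
    and \<gamma>: "\<gamma> = ln (c / (8 * C)) / (1 - \<theta>)"
    and K1: "exp (\<gamma> - y) \<le> c / (2 * C) * real K powr (-\<theta>)" "1 \<le> K" "real K \<le> 2 * exp (y - \<gamma>)"
    and X: "2 * exp (y - \<gamma>) \<le> X"
    and Nb: "real N \<le> c / 2 * real n * (2 * exp (y - \<gamma>)) powr (-\<theta>)" "N < card (half_edges n d)"
      "N = K + K * K ^ Suc R" and R: "R = Suc s2 + k2" and v: "v < n"
  shows "match_prob (half_edges n d) {} (far_from_core n d K R v) \<le>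
     (1 - exp (\<gamma> - \<theta> ^ s2 * y)) ^ ((D - 1) ^ k2) + (real (K ^ Suc R) * (real N / real (card (half_edges n d) - N))) ^ 2"
proof -
  let ?H = "half_edges n d"
  define g where "g = (\<lambda>r. exp (\<gamma> - \<theta> ^ r * y))"
  \<comment> \<open>The index shift gives \<open>f 1 = 1 - g 0\<close>, where \<open>g 0\<close>
    bounds from below the chance of entering the core in one step. At \<open>r = Suc s2\<close> the
    last formula would give \<open>1 - g s2\<close> too, so the two regimes fit together.\<close>
  define f where "f = (\<lambda>r. if r = 0 then 1 else if r \<le> Suc s2 then 1 - g (r - 1) else (1 - g s2) ^ ((D - 1) ^ (r - Suc s2)))"
  \<comment> \<open>Twice \<open>1 / g 0\<close>, an upper bound for all degree thresholds that
    occur.\<close>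
  define Xm where "Xm = 2 * exp (y - \<gamma>)"
  have C0: "C > 0" using c by simp
  have n0: "n > 0" using v by simp
  have gam: "\<gamma> < 0" unfolding \<gamma> using c th by (intro divide_neg_pos) auto
  have g0: "0 < g r" "g r < 1" for r
  proof -
    show "0 < g r" by (simp add: g_def)
    have "\<gamma> - \<theta> ^ r * y < 0" using gam y th by (smt (verit) mult_nonneg_nonneg zero_le_power)
    then show "g r < 1" by (simp add: g_def)
  qed
  have gmono: "g r \<le> g s" if "r \<le> s" for r s
  proof -
    have "\<theta> ^ s * y \<le> \<theta> ^ r * y" using that th y by (intro mult_right_mono power_decreasing) auto
    then show ?thesis by (simp add: g_def)
  qed
  \<comment> \<open>In logarithms the recursion sends \<open>t\<close> to
    \<open>ln (c / (8 * C)) + \<theta> * t\<close>. Its fixed point is \<open>\<gamma>\<close>, and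
    the distance to it shrinks by the factor \<open>\<theta>\<close> in every step.\<close>
  have gSuc: "g (Suc r) = c / (8 * C) * g r powr \<theta>" for r
  proof -
    have "c / (8 * C) = exp ((1 - \<theta>) * \<gamma>)" unfolding \<gamma> using c C0 th by simp
    then show ?thesis by (simp add: g_def powr_def exp_add[symmetric] algebra_simps)
  qed
  have Dm: "(D - 1) ^ k \<ge> 1" for k using D(2) by (intro one_le_power) auto
  have fpos: "f r > 0" for r using g0[of "r - 1"] g0[of s2] by (simp add: f_def)
  have fR: "f R = (1 - g s2) ^ ((D - 1) ^ k2)" using R by (auto simp: f_def)
  have fle: "f R \<le> f r" if r: "r \<le> R" for r
  proof -
    have g1: "0 \<le> 1 - g s2" "1 - g s2 \<le> 1" using g0[of s2] by auto
    show ?thesis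
    proof (cases "r \<le> Suc s2")
      case True
      have "(1 - g s2) ^ ((D - 1) ^ k2) \<le> (1 - g s2) ^ 1" using g1 Dm by (intro power_decreasing) auto
      moreover have "1 - g s2 \<le> f r" using True gmono[of "r - 1" s2] g1 by (auto simp: f_def)
      ultimately show ?thesis using fR by simp
    next
      case False
      have "(D - 1) ^ (r - Suc s2) \<le> (D - 1) ^ k2" using r R D(2) by (intro power_increasing) auto
      then show ?thesis unfolding fR using False g1 by (auto simp: f_def intro!: power_decreasing)
    qed
  qed
  \<comment> \<open>The \<open>N\<close> explored half-edges take away at most half of the lower
    bound for \<open>vol\<close>, so the density of large degrees among the unexplored half-edges is
    still at least \<open>c / (2 * C) * x powr (-\<theta>)\<close>.\<close>
  have hi: "c / (2 * C) * x powr (-\<theta>) * real (card (?H - hes d Y)) \<le> real (card {y \<in> ?H - hes d Y. x < real (d (fst y))})"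
    if Y: "Y \<subseteq> {..<n}" "card (hes d Y) \<le> N" and x: "1 \<le> x" "x \<le> Xm" for Y x
  proof -
    let ?V = "{i. i < n \<and> x < real (d i)}"
    have eq: "{y \<in> ?H - hes d Y. x < real (d (fst y))} = hes d ?V - hes d Y"
      by (auto simp: hes_def half_edges_def)
    have "card (hes d ?V) - card (hes d Y) \<le> card (hes d ?V - hes d Y)"
      using Y finite_subset[OF Y(1)] by (intro diff_card_le_card_Diff) auto
    then have "vol n d x - real N \<le> real (card (hes d ?V - hes d Y))"
      using Y(2) card_hes_vol[of d n x] by linarith
    moreover have "c * real n * x powr (-\<theta>) \<le> vol n d x" using x X by (intro vol) (auto simp: Xm_def)
    moreover have "real N \<le> c / 2 * real n * x powr (-\<theta>)"
    proof -
      have "Xm powr (-\<theta>) \<le> x powr (-\<theta>)" using x th by (intro powr_mono2') auto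
      then have "c / 2 * real n * Xm powr (-\<theta>) \<le> c / 2 * real n * x powr (-\<theta>)" using c by (intro mult_left_mono) auto
      then show ?thesis using Nb(1) by (simp add: Xm_def)
    qed
    ultimately have "c / 2 * real n * x powr (-\<theta>) \<le> real (card (hes d ?V - hes d Y))" by linarith
    moreover have "c / (2 * C) * x powr (-\<theta>) * real (card (?H - hes d Y)) \<le> c / 2 * real n * x powr (-\<theta>)"
    proof -
      have "real (card (?H - hes d Y)) \<le> real (card ?H)" by (simp add: card_mono)
      then have "real (card (?H - hes d Y)) \<le> C * real n" using len by linarith
      then have "c / (2 * C) * x powr (-\<theta>) * real (card (?H - hes d Y)) \<le> c / (2 * C) * x powr (-\<theta>) * (C * real n)"
        using c by (intro mult_left_mono) auto
      also have "\<dots> = c / 2 * real n * x powr (-\<theta>)" using C0 by simp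
      finally show ?thesis .
    qed
    ultimately show ?thesis unfolding eq by linarith
  qed
  interpret exploration n d K R N f
  proof
    show "f 0 = 1" by (simp add: f_def)
    show "N < card ?H" using Nb(2) .
    fix Y r assume Y: "Y \<subseteq> {..<n}" "card (hes d Y) \<le> N" and r: "r < R"
    let ?W = "?H - hes d Y"
    have finW: "finite ?W" by simp
    consider "r = 0" | "r > 0" "r \<le> s2" | "r > s2" "r > 0" by linarith
    then show "(\<Sum>y\<in>?W. if d (fst y) < K then f r ^ (d (fst y) - 1) else 0) \<le> f (Suc r) * real (card ?W)"
    proof cases
      case 1
      have "(\<Sum>y\<in>?W. if d (fst y) < K then f r ^ (d (fst y) - 1) else 0) \<le> (1 - c / (2 * C) * real K powr (-\<theta>)) * real (card ?W)"
        by (rule exploration_average_core) (use finW 1 hi[OF Y, of "real K"] K1 in \<open>auto simp: f_def Xm_def\<close>)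
      also have "\<dots> \<le> f (Suc r) * real (card ?W)"
        using 1 K1(1) by (intro mult_right_mono) (auto simp: f_def g_def)
      finally show ?thesis .
    next
      case 2
      \<comment> \<open>About \<open>1 / g (r - 1)\<close> half-edges, each failing with probability
        \<open>1 - g (r - 1)\<close>, all fail with probability at most \<open>exp (-1)\<close>,
        hence at most \<open>1/2\<close>.\<close>
      define x0 where "x0 = nat \<lceil>1 / g (r - 1)\<rceil>"
      have x01: "1 / g (r - 1) \<le> real x0" unfolding x0_def by linarith
      have gg: "1 / g (r - 1) \<ge> 1" using g0[of "r - 1"] by simp
      have x02: "real x0 \<le> 2 * (1 / g (r - 1))" unfolding x0_def using gg by linarith
      have x03: "1 \<le> real x0" using x01 gg by linarith
      have "1 / g (r - 1) \<le> exp (y - \<gamma>)"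
      proof -
        have "g 0 \<le> g (r - 1)" by (rule gmono) simp
        then have "1 / g (r - 1) \<le> 1 / g 0" using g0 by (intro divide_left_mono) auto
        also have "1 / g 0 = exp (y - \<gamma>)" by (simp add: g_def exp_diff)
        finally show ?thesis .
      qed
      then have x04: "real x0 \<le> Xm" using x02 by (simp add: Xm_def)
      define F where "F = f r"
      have F: "F = 1 - g (r - 1)" using 2 by (simp add: F_def f_def)
      have F1: "0 \<le> F" "F \<le> 1" using g0[of "r - 1"] F by auto
      define \<rho> where "\<rho> = c / (2 * C) * real x0 powr (-\<theta>)"
      have "(\<Sum>y\<in>?W. if d (fst y) < K then F ^ (d (fst y) - 1) else 0) \<le> (1 - \<rho> * (1 - F ^ x0)) * real (card ?W)"
        by (rule exploration_average) (use finW F1 hi[OF Y x03 x04] in \<open>auto simp: \<rho>_def\<close>)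
      also have "\<dots> \<le> f (Suc r) * real (card ?W)"
      proof (rule mult_right_mono)
        have "F ^ x0 \<le> exp (- g (r - 1)) ^ x0"
          using exp_ge_add_one_self[of "- g (r - 1)"] F1 F by (intro power_mono) auto
        also have "\<dots> = exp (- (real x0 * g (r - 1)))" by (simp add: exp_of_nat_mult[symmetric])
        also have "\<dots> \<le> exp (- 1)" using x01 g0[of "r - 1"] by (simp add: field_simps)
        also have "\<dots> \<le> 1 / 2" using exp_ge_add_one_self[of 1] by (simp add: exp_minus field_simps)
        finally have F2: "1 / 2 \<le> 1 - F ^ x0" by simp
        \<comment> \<open>One factor \<open>1/2\<close> is lost by rounding \<open>x0\<close> up to
          at most \<open>2 / g (r - 1)\<close>, another by \<open>F ^ x0 \<le> 1/2\<close>; together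
          with \<open>c / (2 * C)\<close> they give the constant \<open>c / (8 * C)\<close>.\<close>
        have "(2 * (1 / g (r - 1))) powr (-\<theta>) \<le> real x0 powr (-\<theta>)"
          using x02 x03 th by (intro powr_mono2') auto
        moreover have "(2 * (1 / g (r - 1))) powr (-\<theta>) = 2 powr (-\<theta>) * g (r - 1) powr \<theta>"
          using g0[of "r - 1"] by (simp add: powr_mult powr_divide powr_minus field_simps)
        moreover have "(1 / 2) * g (r - 1) powr \<theta> \<le> 2 powr (-\<theta>) * g (r - 1) powr \<theta>"
        proof (rule mult_right_mono)
          have "(2::real) powr (-1) \<le> 2 powr (-\<theta>)" using th by (intro powr_mono) auto
          then show "1 / 2 \<le> (2::real) powr (-\<theta>)" by simp
        qed simp
        ultimately have "(1 / 2) * g (r - 1) powr \<theta> \<le> real x0 powr (-\<theta>)" by linarith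
        then have "c / (2 * C) * ((1 / 2) * g (r - 1) powr \<theta>) \<le> \<rho>"
          unfolding \<rho>_def using c C0 by (intro mult_left_mono) auto
        then have "c / (2 * C) * ((1 / 2) * g (r - 1) powr \<theta>) * (1 / 2) \<le> \<rho> * (1 - F ^ x0)"
          using F2 c C0 by (intro mult_mono) (auto intro!: mult_nonneg_nonneg order_trans[of 0 "c / (2 * C) * ((1 / 2) * g (r - 1) powr \<theta>)" \<rho>])
        moreover have "g r = c / (8 * C) * g (r - 1) powr \<theta>" using gSuc[of "r - 1"] 2 by simp
        ultimately have "g r \<le> \<rho> * (1 - F ^ x0)" by (simp add: field_simps)
        then show "1 - \<rho> * (1 - F ^ x0) \<le> f (Suc r)" using 2 by (simp add: f_def)
      qed simp
      finally show ?thesis unfolding F_def .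
    next
      case 3
      have g1: "0 \<le> 1 - g s2" "1 - g s2 \<le> 1" using g0[of s2] by auto
      have frr: "f r = (1 - g s2) ^ ((D - 1) ^ (r - Suc s2))"
      proof (cases "r = Suc s2")
        case True then show ?thesis by (simp add: f_def)
      qed (use 3 in \<open>simp add: f_def\<close>)
      have "Suc r - Suc s2 = Suc (r - Suc s2)" using 3 by simp
      then have fS: "f (Suc r) = f r ^ (D - 1)"
        unfolding frr using 3 by (simp add: f_def power_mult[symmetric] mult.commute)
      have f1: "f r \<le> 1" unfolding frr using g1 by (simp add: power_le_one)
      have "(\<Sum>y\<in>?W. if d (fst y) < K then f r ^ (d (fst y) - 1) else 0) \<le> (\<Sum>y\<in>?W. f r ^ (D - 1))"
      proof (rule sum_mono)
        fix y assume "y \<in> ?W"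
        then have "D \<le> d (fst y)" using D by (auto simp: half_edges_def)
        then show "(if d (fst y) < K then f r ^ (d (fst y) - 1) else 0) \<le> f r ^ (D - 1)"
          using f1 fpos[of r] by (auto intro!: power_decreasing)
      qed
      then show ?thesis by (simp add: fS mult.commute)
    qed
  qed (use fpos fle in auto)
  have q: "q = real N / real (card ?H - N)" by (simp add: q_def)
  show ?thesis
  proof (cases "d v < K")
    case True
    have "3 \<le> d v" using D v by (meson le_trans)
    then show ?thesis using far_from_core_bound[OF v _ True] Nb(3) q fR by (simp add: g_def)
  next
    \<comment> \<open>A start inside the core has distance \<open>0\<close> from it, so the event is
      impossible.\<close>
    case False
    have "\<sigma> \<notin> far_from_core n d K R v" for \<sigma>
    proof
      assume "\<sigma> \<in> far_from_core n d K R v"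
      then have "v < n \<and> K \<le> d v \<and> 0 \<le> R \<longrightarrow> (v, v) \<notin> cm_adj n d \<sigma> ^^ 0"
        unfolding far_from_core_def by blast
      then show False using v False by simp
    qed
    then have "match_prob ?H {} (far_from_core n d K R v) = 0" by (intro match_prob_eq0) auto
    then show ?thesis using g0[of s2] by (simp add: g_def)
  qed
qed

section \<open>The upper bound\<close>

lemma match_prob_no_edge:
  assumes "V \<subseteq> {..<n}" "i < n" "i \<notin> V"
  shows "match_prob (half_edges n d) {} {\<sigma>. \<forall>z\<in>V. (i, z) \<notin> cm_adj n d \<sigma>}
    \<le> exp (- real (d i) * real (card (hes d V)) / (2 * real (card (half_edges n d))))"
proof -
  let ?H = "half_edges n d"
  have "match_prob ?H {} {\<sigma>. \<forall>z\<in>V. (i, z) \<notin> cm_adj n d \<sigma>} \<le> match_prob ?H {} {\<sigma>. \<forall>a\<in>hes d {i}. \<sigma> a \<notin> hes d V}"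
  proof (rule match_prob_mono, simp, clarsimp)
    fix \<sigma> j a k
    assume s: "\<sigma> \<in> matchings ?H" "\<forall>z\<in>V. (i, z) \<notin> cm_adj n d \<sigma>" "j < d i" "\<sigma> (i, j) \<in> hes d V"
    have "(fst (i,j), fst (\<sigma> (i,j))) \<in> cm_adj n d \<sigma>"
      using s assms by (intro cm_adjI_ext) (auto simp: half_edges_def)
    moreover have "fst (\<sigma> (i,j)) \<in> V" using s(4) by (auto simp: hes_def)
    ultimately show False using s(2) by auto
  qed
  also have "\<dots> \<le> exp (- real (card (hes d {i})) * real (card (hes d V)) / (2 * real (card ?H)))"
    using assms hes_subset[of "{i}" n d] hes_subset[of V n d]
    by (intro match_prob_no_pair) (auto simp: hes_def)
  finally show ?thesis by (simp add: card_hes)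
qed

text \<open>The value \<open>t = 0\<close> is included, so \<open>i\<close> itself may be the vertex
  of large degree. This removes the case in which the half-edges of \<open>i\<close> are not
  disjoint from the target.\<close>

definition no_step_up :: "nat \<Rightarrow> (nat \<Rightarrow> nat) \<Rightarrow> real \<Rightarrow> nat \<Rightarrow> ((nat \<times> nat) \<Rightarrow> (nat \<times> nat)) set" where
  "no_step_up n d b i = {\<sigma>. \<forall>z t. z < n \<and> b < real (d z) \<and> t \<le> 1 \<longrightarrow> (i, z) \<notin> cm_adj n d \<sigma> ^^ t}"

lemma match_prob_no_step_up:
  assumes "i < n" "a \<le> real (d i)" "w \<le> vol n d b" "0 \<le> a" "0 \<le> w"
  shows "match_prob (half_edges n d) {} (no_step_up n d b i) \<le> exp (- a * w / (2 * real (card (half_edges n d))))"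
proof (cases "b < real (d i)")
  case True
  have "\<sigma> \<notin> no_step_up n d b i" for \<sigma>
  proof
    assume "\<sigma> \<in> no_step_up n d b i"
    then have "i < n \<and> b < real (d i) \<and> 0 \<le> (1::nat) \<longrightarrow> (i, i) \<notin> cm_adj n d \<sigma> ^^ 0"
      unfolding no_step_up_def by blast
    then show False using True assms by simp
  qed
  then have "match_prob (half_edges n d) {} (no_step_up n d b i) = 0" by (intro match_prob_eq0) auto
  then show ?thesis by simp
next
  case False
  let ?V = "{i. i < n \<and> b < real (d i)}" and ?H = "half_edges n d"
  have "match_prob ?H {} (no_step_up n d b i) \<le> match_prob ?H {} {\<sigma>. \<forall>z\<in>?V. (i, z) \<notin> cm_adj n d \<sigma>}"
  proof (rule match_prob_mono)
    show "ext ?H {} \<inter> no_step_up n d b i \<subseteq> {\<sigma>. \<forall>z\<in>?V. (i, z) \<notin> cm_adj n d \<sigma>}"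
    proof (rule subsetI, rule CollectI, rule ballI)
      fix \<sigma> z assume "\<sigma> \<in> ext ?H {} \<inter> no_step_up n d b i" "z \<in> ?V"
      then have "(i, z) \<notin> cm_adj n d \<sigma> ^^ 1" unfolding no_step_up_def by blast
      then show "(i, z) \<notin> cm_adj n d \<sigma>" by simp
    qed
  qed simp
  also have "\<dots> \<le> exp (- real (d i) * real (card (hes d ?V)) / (2 * real (card ?H)))"
    using assms False by (intro match_prob_no_edge) auto
  also have "\<dots> \<le> exp (- a * w / (2 * real (card ?H)))"
  proof -
    have "a * w \<le> real (d i) * real (card (hes d ?V))"
      unfolding card_hes_vol using assms by (intro mult_mono) auto
    then have "a * w / (2 * real (card ?H)) \<le> real (d i) * real (card (hes d ?V)) / (2 * real (card ?H))"
      by (intro divide_right_mono) auto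
    then show ?thesis by simp
  qed
  finally show ?thesis .
qed

text \<open>Contains every configuration with a disconnected pair, so its small probability includes
  connectivity of the graph.\<close>

definition distant :: "nat \<Rightarrow> (nat \<Rightarrow> nat) \<Rightarrow> real \<Rightarrow> ((nat \<times> nat) \<Rightarrow> (nat \<times> nat)) set" where
  "distant n d T = {\<sigma>. \<exists>u<n. \<exists>v<n. \<forall>t. real t \<le> T \<longrightarrow> (u, v) \<notin> cm_adj n d \<sigma> ^^ t}"

text \<open>The thresholds \<open>u\<close> are numbered downwards: \<open>u s\<close> is the core
  level, \<open>u 0\<close> the top. Outside three unions of bad events each vertex reaches the core
  in \<open>R\<close> steps, climbs to the top in \<open>s\<close> steps, and two top vertices are
  equal or adjacent, which explains \<open>2 * (R + s) + 1\<close>.\<close>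

lemma distant_union_bound:
  fixes u :: "nat \<Rightarrow> real"
  assumes K: "u s \<le> real K" and T: "2 * (real R + real s) + 1 \<le> T"
    and p1: "\<And>v. v < n \<Longrightarrow> match_prob (half_edges n d) {} (far_from_core n d K R v) \<le> e1"
    and p2: "\<And>k i. k < s \<Longrightarrow> i < n \<Longrightarrow> u (Suc k) \<le> real (d i) \<Longrightarrow> match_prob (half_edges n d) {} (no_step_up n d (u k) i) \<le> e2"
    and p3: "\<And>i j. i < n \<Longrightarrow> j < n \<Longrightarrow> i \<noteq> j \<Longrightarrow> u 0 \<le> real (d i) \<Longrightarrow> u 0 \<le> real (d j) \<Longrightarrow>
       match_prob (half_edges n d) {} {\<sigma>. (i, j) \<notin> cm_adj n d \<sigma>} \<le> e3"
    and e: "0 \<le> e2" "0 \<le> e3"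
  shows "match_prob (half_edges n d) {} (distant n d T) \<le> real n * e1 + real s * real n * e2 + real n ^ 2 * e3"
proof -
  let ?H = "half_edges n d"
  define A where "A = (\<Union>v\<in>{..<n}. far_from_core n d K R v)"
  define B where "B = (\<Union>ki\<in>{..<s} \<times> {..<n}. if u (Suc (fst ki)) \<le> real (d (snd ki)) then no_step_up n d (u (fst ki)) (snd ki) else {})"
  define C where "C = (\<Union>ij\<in>{..<n} \<times> {..<n}. if fst ij \<noteq> snd ij \<and> u 0 \<le> real (d (fst ij)) \<and> u 0 \<le> real (d (snd ij)) then {\<sigma>. ij \<notin> cm_adj n d \<sigma>} else {})"
  have "ext ?H {} \<inter> distant n d T \<subseteq> A \<union> (B \<union> C)"
  proof (rule ccontr)
    assume "\<not> ext ?H {} \<inter> distant n d T \<subseteq> A \<union> (B \<union> C)"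
    then obtain \<sigma> where s: "\<sigma> \<in> matchings ?H" "\<sigma> \<in> distant n d T" and n: "\<sigma> \<notin> A" "\<sigma> \<notin> B" "\<sigma> \<notin> C" by auto
    let ?E = "cm_adj n d \<sigma>"
    have step: "\<exists>z<n. \<exists>t\<le>1. u k < real (d z) \<and> (i, z) \<in> ?E ^^ t" if "k < s" "i < n" "u (Suc k) \<le> real (d i)" for k i
    proof -
      have "\<sigma> \<notin> no_step_up n d (u k) i" using n(2) that unfolding B_def by force
      then show ?thesis unfolding no_step_up_def by blast
    qed
    have climb: "k \<le> s \<Longrightarrow> i < n \<Longrightarrow> u k \<le> real (d i) \<Longrightarrow> \<exists>z<n. \<exists>t\<le>k. u 0 \<le> real (d z) \<and> (i, z) \<in> ?E ^^ t" for k i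
    proof (induction k arbitrary: i)
      case 0
      then show ?case by (intro exI[of _ i] conjI exI[of _ 0]) auto
    next
      case (Suc k)
      obtain z t where z: "z < n" "t \<le> 1" "u k < real (d z)" "(i, z) \<in> ?E ^^ t" using step[of k i] Suc.prems by auto
      obtain z' t' where z': "z' < n" "t' \<le> k" "u 0 \<le> real (d z')" "(z, z') \<in> ?E ^^ t'"
        using Suc.IH[of z] Suc.prems z by auto
      have "(i, z') \<in> ?E ^^ (t + t')" using z(4) z'(4) by (auto simp: relpow_add)
      moreover have "t + t' \<le> Suc k" using z z' by simp
      ultimately show ?case using z' by blast
    qed
    have hub: "\<exists>z<n. \<exists>t\<le>R + s. u 0 \<le> real (d z) \<and> (i, z) \<in> ?E ^^ t" if "i < n" for i
    proof -
      have "\<sigma> \<notin> far_from_core n d K R i" using n(1) that unfolding A_def by blast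
      then obtain z t where z: "z < n" "K \<le> d z" "t \<le> R" "(i, z) \<in> ?E ^^ t" unfolding far_from_core_def by blast
      have "u s \<le> real (d z)" using K z(2) by linarith
      then obtain z' t' where z': "z' < n" "t' \<le> s" "u 0 \<le> real (d z')" "(z, z') \<in> ?E ^^ t'"
        using climb[of s z] z by auto
      have "(i, z') \<in> ?E ^^ (t + t')" using z(4) z'(4) by (auto simp: relpow_add)
      moreover have "t + t' \<le> R + s" using z z' by simp
      ultimately show ?thesis using z' by blast
    qed
    obtain a b where ab: "a < n" "b < n" "\<And>t. real t \<le> T \<Longrightarrow> (a, b) \<notin> ?E ^^ t"
      using s(2) unfolding distant_def by blast
    obtain z t where z: "z < n" "t \<le> R + s" "u 0 \<le> real (d z)" "(a, z) \<in> ?E ^^ t" using hub[OF ab(1)] by blast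
    obtain z' t' where z': "z' < n" "t' \<le> R + s" "u 0 \<le> real (d z')" "(b, z') \<in> ?E ^^ t'" using hub[OF ab(2)] by blast
    have zb: "(z', b) \<in> ?E ^^ t'" using relpow_sym[OF sym_cm_adj[OF s(1)] z'(4)] .
    have "\<exists>w\<le>1. (z, z') \<in> ?E ^^ w"
    proof (cases "z = z'")
      case True then show ?thesis by (intro exI[of _ 0]) auto
    next
      case False
      have "(z, z') \<in> ?E"
      proof (rule ccontr)
        assume "(z, z') \<notin> ?E"
        then have "\<sigma> \<in> C" unfolding C_def using z z' False by (intro UN_I[of "(z, z')"]) auto
        then show False using n(3) by simp
      qed
      then show ?thesis by (intro exI[of _ 1]) auto
    qed
    then obtain w where w: "w \<le> 1" "(z, z') \<in> ?E ^^ w" by blast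
    have "(a, z') \<in> ?E ^^ (t + w)" using z(4) w(2) by (auto simp: relpow_add)
    then have "(a, b) \<in> ?E ^^ (t + w + t')" using zb unfolding relpow_add[of "t + w"] by blast
    moreover have "real (t + w + t') \<le> T"
    proof -
      have "t + w + t' \<le> 2 * (R + s) + 1" using add_mono[OF add_mono[OF z(2) w(1)] z'(2)] by simp
      then have "real (t + w + t') \<le> real (2 * (R + s) + 1)" by (simp only: of_nat_le_iff)
      then show ?thesis using T by simp
    qed
    ultimately show False using ab(3) by blast
  qed
  then have "match_prob ?H {} (distant n d T) \<le> match_prob ?H {} (A \<union> (B \<union> C))" by (intro match_prob_mono) auto
  also have "\<dots> \<le> match_prob ?H {} A + (match_prob ?H {} B + match_prob ?H {} C)"
    using match_prob_Un[of ?H "{}" A "B \<union> C"] match_prob_Un[of ?H "{}" B C] by simp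
  also have "match_prob ?H {} A \<le> (\<Sum>v<n. e1)"
    unfolding A_def by (rule order_trans[OF match_prob_UN sum_mono]) (auto intro!: p1)
  also have "match_prob ?H {} B \<le> (\<Sum>ki\<in>{..<s} \<times> {..<n}. e2)"
    unfolding B_def by (rule order_trans[OF match_prob_UN sum_mono]) (auto intro!: p2 simp: match_prob_eq0 e)
  also have "match_prob ?H {} C \<le> (\<Sum>ij\<in>{..<n} \<times> {..<n}. e3)"
    unfolding C_def by (rule order_trans[OF match_prob_UN sum_mono]) (auto intro!: p3 simp: match_prob_eq0 e)
  finally show ?thesis by (simp add: power2_eq_square)
qed

section \<open>Choice of the parameters for the upper bound\<close>

lemma filterlim_ln_real: "filterlim (\<lambda>n::nat. ln (real n)) at_top sequentially"
  by real_asymp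

text \<open>To be applied with \<open>\<theta>\<close> slightly above \<open>\<tau> - 2\<close>.
  Everything is expressed through \<open>x = ln n\<close> and \<open>L = ln x\<close>, so the
  asymptotic inequalities are collected beforehand for real arguments and the final error becomes a
  function of \<open>x\<close>.\<close>

lemma upper_tail_whp:
  fixes d :: "nat \<Rightarrow> nat \<Rightarrow> nat" and \<theta> \<alpha> c C \<eta> :: real and D :: nat
  assumes vol: "\<And>n x. 1 \<le> n \<Longrightarrow> 1 \<le> x \<Longrightarrow> x \<le> real n powr \<alpha> \<Longrightarrow> c * real n * x powr (-\<theta>) \<le> vol n (d n) x"
    and len: "\<And>n. real (card (half_edges n (d n))) \<le> C * real n"
    and D: "\<And>n i. i < n \<Longrightarrow> D \<le> d n i" "3 \<le> D"
    and c: "0 < c" "c \<le> C" and th: "0 < \<theta>" "\<theta> < 1" and al: "1/2 < \<alpha>" and \<eta>: "0 < \<eta>"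
  shows "(\<lambda>n. match_prob (half_edges n (d n)) {} (distant n (d n) ((1 + \<eta>) * (2 / ln (real D - 1) + 2 / \<bar>ln \<theta>\<bar>) * ln (ln (real n))))) \<longlonglongrightarrow> 0"
proof -
  define A where "A = \<bar>ln \<theta>\<bar>"
  define B where "B = ln (real D - 1)"
  have A0: "A > 0" "ln \<theta> = - A" using th by (auto simp: A_def)
  have B0: "B > 0" using D(2) by (simp add: B_def)
  have C0: "C > 0" using c by simp
  \<comment> \<open>This value makes a climb from one threshold to the next fail with probability at
    most \<open>n powr (-2)\<close>.\<close>
  define c3 where "c3 = 4 * C / c"
  have c30: "c3 > 0" using c C0 by (simp add: c3_def)
  define p where "p = 1 / (1 - \<theta>)"
  have p0: "p > 0" using th by (simp add: p_def)
  \<comment> \<open>\<open>exp (\<sigma> * L)\<close> has to exceed the core degree, which is of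
    order \<open>(c3 * x) powr p\<close>; the extra power of \<open>x\<close> absorbs the
    constants.\<close>
  define \<sigma> where "\<sigma> = p + 1"
  have s0: "\<sigma> > 0" using p0 by (simp add: \<sigma>_def)
  define \<gamma> where "\<gamma> = ln (c / (8 * C)) / (1 - \<theta>)"
  have gam: "\<gamma> < 0" unfolding \<gamma>_def using c th by (intro divide_neg_pos) auto
  have st: "\<sigma> * \<theta> < \<sigma>" using s0 th by simp
  have ev: "eventually (\<lambda>n. P (ln (real n))) sequentially" if "eventually P at_top" for P
    using that filterlim_ln_real by (rule eventually_compose_filterlim)
  have lnln: "filterlim (\<lambda>x::real. ln x) at_top at_top" by real_asymp
  have evL: "eventually (\<lambda>n. P (ln (ln (real n)))) sequentially" if "eventually P at_top" for P
    using ev[OF eventually_compose_filterlim[OF that lnln]] .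
  have e1: "eventually (\<lambda>x. exp (ln (c3 * x) * p + \<alpha>) + 1 \<le> exp (\<sigma> * ln x)) at_top"
    unfolding \<sigma>_def using c30 p0 by real_asymp
  have e2: "eventually (\<lambda>x. ln (c3 * x) * p \<le> \<alpha> * x) at_top" using c30 p0 al by real_asymp
  have e3: "eventually (\<lambda>x. 1 \<le> c3 * x) at_top" using c30 by real_asymp
  have cc: "0 < c / (2 * C)" using c C0 by simp
  have e4: "eventually (\<lambda>x. exp \<gamma> * exp (- (\<sigma> * ln x)) \<le> c / (2 * C) * exp (- (\<sigma> * \<theta> * ln x))) at_top"
    using cc st by real_asymp
  have e5: "eventually (\<lambda>x. 2 * exp (- \<gamma>) * exp (\<sigma> * ln x) \<le> exp (\<alpha> * x)) at_top"
    using s0 al by real_asymp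
  define C6 where "C6 = (1 + \<eta>) / B + 1"
  have C60: "C6 > 0" using \<eta> B0 by (simp add: C6_def add_pos_pos)
  have e6: "eventually (\<lambda>x. 2 * exp (\<sigma> * ln x * (C6 * ln x)) \<le> exp (x/8)) at_top"
    using s0 C60 by real_asymp
  have e7: "eventually (\<lambda>x. exp (x/8) \<le> c / 2 * exp x * (2 * exp (- \<gamma>) * exp (\<sigma> * ln x)) powr (-\<theta>)) at_top"
  proof -
    have "c / 2 > 0" "2 * exp (- \<gamma>) > 0" using c by auto
    then show ?thesis using s0 by real_asymp
  qed
  define k9 where "k9 = \<eta> * (1 / B + 2 / A)"
  have k90: "k9 > 0" using \<eta> A0 B0 by (simp add: k9_def add_pos_pos)
  have e9: "eventually (\<lambda>L. 2 * ln (\<sigma> * L) / A + 9 \<le> k9 * L) at_top" using k90 A0 s0 by real_asymp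
  define k10 where "k10 = \<eta> / (2 * B) + 1"
  have k100: "k10 > 0" using \<eta> B0 by (simp add: k10_def add_pos_pos)
  have e10: "eventually (\<lambda>L. 5 + ln (\<sigma> * L) / A \<le> k10 * L) at_top" using k100 A0 s0 by real_asymp
  have g1: "exp (\<gamma> - 1) > 0" by simp
  have e11: "eventually (\<lambda>x. exp (- exp (\<gamma> - 1) * exp ((1 + \<eta>/2) * ln x)) \<le> exp (-2 * x)) at_top"
    using g1 \<eta> by real_asymp
  have e12: "eventually (\<lambda>L. 1 \<le> L \<and> 1 \<le> \<sigma> * L) at_top" using s0 by (intro eventually_conj) real_asymp+
  have e13: "eventually (\<lambda>x::real. 1 \<le> x \<and> 4 \<le> exp (x / 2)) at_top" by (intro eventually_conj) real_asymp+
  let ?T = "\<lambda>n. (1 + \<eta>) * (2 / B + 2 / A) * ln (ln (real n))"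
  \<comment> \<open>Union bounds over start vertices, over climbing steps and over pairs of top
    vertices. The last one vanishes because \<open>\<alpha> > 1/2\<close>.\<close>
  let ?bd = "\<lambda>x. exp x * (exp (-2*x) + 4 * exp (- 3/2*x)) + (ln x / A + 1) * exp x * exp (-2*x)
     + exp x ^ 2 * exp (- exp (2*\<alpha>*x) / (2 * C * exp x))"
  have main: "eventually (\<lambda>n. match_prob (half_edges n (d n)) {} (distant n (d n) (?T n)) \<le> ?bd (ln (real n))) sequentially"
    using ev[OF e1] ev[OF e2] ev[OF e3] ev[OF e4] ev[OF e5] ev[OF e6] ev[OF e7] evL[OF e9] evL[OF e10] ev[OF e11] evL[OF e12] ev[OF e13] eventually_gt_at_top[of 0]
  proof eventually_elim
    case (elim n)
    let ?H = "half_edges n (d n)"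
    define x where "x = ln (real n)"
    define L where "L = ln x"
    note el = elim[folded x_def, folded L_def]
    have nx: "real n = exp x" using el(13) by (simp add: x_def)
    have x1: "x \<ge> 1" and L1: "L \<ge> 1" "\<sigma> * L \<ge> 1" using el by auto
    have xL: "exp L = x" using x1 by (simp add: L_def)
    \<comment> \<open>The solution of \<open>b = \<theta> * b + ln (c3 * x)\<close>, the logarithm
      of the degree at which climbing makes no progress; the core must lie above it.\<close>
    define b where "b = ln (c3 * x) * p"
    have b0: "0 \<le> b" unfolding b_def using el(3) p0 by simp
    have b1: "b \<le> \<alpha> * x" using el(2) by (simp add: b_def)
    \<comment> \<open>Solves \<open>u (Suc k) = c3 * x * u k powr \<theta>\<close> with
      \<open>u 0 = n powr \<alpha>\<close>, read downwards from the top.\<close>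
    define u where "u = (\<lambda>k. exp (b + \<theta> ^ k * (\<alpha> * x - b)))"
    \<comment> \<open>The three lengths ensure \<open>\<theta> ^ s1 \<le> 1 / x\<close>,
      \<open>\<theta> ^ s2 * y \<le> 1\<close> and
      \<open>(D - 1) ^ k2 \<ge> x powr (1 + \<eta>/2)\<close>. Only \<open>s1\<close> and
      \<open>k2\<close> are of order \<open>L\<close>; \<open>s2\<close> is of order
      \<open>ln L\<close>.\<close>
    define s1 where "s1 = nat \<lceil>L / A\<rceil>"
    define s2 where "s2 = nat \<lceil>ln (\<sigma> * L) / A\<rceil>"
    define k2 where "k2 = nat \<lceil>(1 + \<eta>/2) * L / B\<rceil>"
    define K where "K = nat \<lceil>exp (b + \<alpha>)\<rceil>"
    define R where "R = Suc s2 + k2"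
    define N where "N = K + K * K ^ Suc R"
    define y where "y = \<sigma> * L"
    have s1b: "L / A \<le> real s1" "real s1 \<le> L / A + 1"
    proof -
      have "0 \<le> L / A" using L1 A0 by (intro divide_nonneg_pos) auto
      then show "L / A \<le> real s1" "real s1 \<le> L / A + 1" unfolding s1_def by linarith+
    qed
    have s2b: "ln (\<sigma> * L) / A \<le> real s2" "real s2 \<le> ln (\<sigma> * L) / A + 1"
    proof -
      have "0 \<le> ln (\<sigma> * L) / A" using L1 A0 by (intro divide_nonneg_pos) auto
      then show "ln (\<sigma> * L) / A \<le> real s2" "real s2 \<le> ln (\<sigma> * L) / A + 1" unfolding s2_def by linarith+
    qed
    have k2b: "(1 + \<eta>/2) * L / B \<le> real k2" "real k2 \<le> (1 + \<eta>/2) * L / B + 1"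
    proof -
      have "0 \<le> (1 + \<eta>/2) * L / B" using L1 B0 \<eta> by (intro divide_nonneg_pos) auto
      then show "(1 + \<eta>/2) * L / B \<le> real k2" "real k2 \<le> (1 + \<eta>/2) * L / B + 1" unfolding k2_def by linarith+
    qed
    have thp: "\<theta> ^ s \<le> exp (- l)" if "l / A \<le> real s" for s l
    proof -
      have "\<theta> ^ s = exp (- (A * real s))" using th A0 by (simp add: exp_of_nat_mult exp_minus flip: powr_realpow) (simp add: powr_def A0 mult.commute exp_minus)
      moreover have "l \<le> A * real s" using that A0 by (simp add: field_simps)
      ultimately show ?thesis by simp
    qed
    have K1: "exp (b + \<alpha>) \<le> real K" "real K \<le> exp (b + \<alpha>) + 1" 
    proof -
      have "0 \<le> exp (b + \<alpha>)" by simp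
      then show "exp (b + \<alpha>) \<le> real K" "real K \<le> exp (b + \<alpha>) + 1" unfolding K_def by linarith+
    qed
    have K2: "real K \<le> exp (\<sigma> * L)" using K1(2) el(1) by (simp add: b_def)
    have K3: "1 \<le> K"
    proof -
      have "1 \<le> exp (b + \<alpha>)" using b0 al by simp
      then show ?thesis using K1(1) by linarith
    qed
    have R1: "real R + 2 \<le> C6 * L"
    proof -
      have "real R + 2 \<le> (5 + ln (\<sigma> * L) / A) + (1 + \<eta>/2) * L / B" using s2b k2b by (simp add: R_def)
      also have "\<dots> \<le> k10 * L + (1 + \<eta>/2) * L / B" using el(9) by simp
      also have "\<dots> = C6 * L" using B0 by (simp add: k10_def C6_def field_simps)
      finally show ?thesis .
    qed
    \<comment> \<open>The exploration uses \<open>exp (O(L^2))\<close> half-edges, which is less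
      than \<open>n powr (1/8)\<close>; two collisions then cost at most
      \<open>4 * n powr (-3/2)\<close>.\<close>
    have N1: "real N \<le> exp (x / 8)"
    proof -
      have "K \<le> K * K ^ Suc R" using K3 by simp
      then have "N \<le> 2 * K ^ (R + 2)" by (simp add: N_def)
      then have "real N \<le> 2 * real K ^ (R + 2)" by (metis of_nat_le_iff of_nat_mult of_nat_numeral of_nat_power)
      also have "\<dots> \<le> 2 * exp (\<sigma> * L) ^ (R + 2)" using K2 by (intro mult_left_mono power_mono) auto
      also have "exp (\<sigma> * L) ^ (R + 2) = exp (\<sigma> * L * (real R + 2))" by (subst exp_of_nat_mult[symmetric]) (simp add: algebra_simps)
      also have "\<dots> \<le> exp (\<sigma> * L * (C6 * L))" using R1 s0 L1 by simp
      finally show ?thesis using el(6) by simp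
    qed
    have nl: "n \<le> card ?H"
    proof -
      have "(\<Sum>i<n. 1) \<le> (\<Sum>i<n. d n i)" using D by (intro sum_mono) (metis le_trans one_le_numeral lessThan_iff)
      then show ?thesis by (simp add: card_half_edges)
    qed
    have x8: "exp (x/8) < exp x" using x1 by simp
    have NH: "N < card ?H" using N1 nl nx x8 by (metis (mono_tags, opaque_lifting) le_less_trans less_le_trans of_nat_less_iff)
    have yg: "2 * exp (y - \<gamma>) = 2 * exp (- \<gamma>) * exp (\<sigma> * L)" by (simp add: y_def exp_diff exp_minus field_simps)
    have far: "match_prob ?H {} (far_from_core n (d n) K R v) \<le> exp (-2 * x) + 4 * exp (- 3/2*x)" if v: "v < n" for v
    proof -
      have "match_prob ?H {} (far_from_core n (d n) K R v) \<le>
        (1 - exp (\<gamma> - \<theta> ^ s2 * y)) ^ ((D - 1) ^ k2) + (real (K ^ Suc R) * (real N / real (card ?H - N))) ^ 2"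
      proof (rule core_reached[where X = "real n powr \<alpha>" and \<theta> = \<theta> and c = c and C = C and D = D and \<gamma> = \<gamma> and y = y])
        show "exp (\<gamma> - y) \<le> c / (2 * C) * real K powr - \<theta>"
        proof -
          have "exp (\<sigma> * L) powr (-\<theta>) \<le> real K powr - \<theta>" using K2 K3 th by (intro powr_mono2') auto
          then have "c / (2 * C) * exp (\<sigma> * L) powr (-\<theta>) \<le> c / (2 * C) * real K powr - \<theta>" using cc by (intro mult_left_mono) auto
          moreover have "exp (\<gamma> - y) = exp \<gamma> * exp (- (\<sigma> * L))" by (simp add: y_def exp_diff exp_minus field_simps)
          moreover have "exp (\<sigma> * L) powr (-\<theta>) = exp (- (\<sigma> * \<theta> * L))" by (simp add: powr_def mult_ac)
          ultimately show ?thesis using el(4) by simp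
        qed
        show "real K \<le> 2 * exp (y - \<gamma>)"
        proof -
          have "exp (\<sigma> * L) \<le> exp (y - \<gamma>)" using gam by (simp add: y_def)
          then show ?thesis using K2 by (smt (verit) exp_gt_zero)
        qed
        show "2 * exp (y - \<gamma>) \<le> real n powr \<alpha>"
          unfolding yg using el(5) by (simp add: nx powr_def)
        show "real N \<le> c / 2 * real n * (2 * exp (y - \<gamma>)) powr - \<theta>"
          unfolding yg using N1 el(7) by (simp add: nx)
        show "0 \<le> y" using L1 by (simp add: y_def)
      qed (use vol[of n] len[of n] D c th \<gamma>_def K3 NH N_def R_def v in auto)
      also have "(1 - exp (\<gamma> - \<theta> ^ s2 * y)) ^ ((D - 1) ^ k2) \<le> exp (-2 * x)"
      proof -
        have "\<theta> ^ s2 * y \<le> 1"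
        proof -
          have "\<theta> ^ s2 \<le> exp (- ln (\<sigma> * L))" by (rule thp[OF s2b(1)])
          also have "\<dots> = 1 / y" using L1 by (simp add: y_def exp_minus divide_inverse)
          finally show ?thesis using L1 by (simp add: y_def field_simps)
        qed
        \<comment> \<open>After \<open>s2\<close> steps the success probability is at least the
          constant \<open>exp (\<gamma> - 1)\<close>; the power \<open>(D - 1) ^ k2\<close> brings
          the failure probability below \<open>n powr (-2)\<close>.\<close>
        then have g: "exp (\<gamma> - 1) \<le> exp (\<gamma> - \<theta> ^ s2 * y)" by simp
        have g': "exp (\<gamma> - \<theta> ^ s2 * y) \<le> 1" using gam th L1 y_def by (smt (verit) exp_le_one_iff mult_nonneg_nonneg zero_le_power)
        have DD: "real (D - 1) = exp B" using D(2) by (simp add: B_def of_nat_diff)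
        have "exp ((1 + \<eta>/2) * L) \<le> real ((D - 1) ^ k2)"
        proof -
          have "(1 + \<eta>/2) * L \<le> real k2 * B" using k2b(1) B0 by (simp add: field_simps)
          then have "exp ((1 + \<eta>/2) * L) \<le> exp (real k2 * B)" by simp
          also have "\<dots> = exp B ^ k2" by (simp add: exp_of_nat_mult)
          finally show ?thesis using DD by (simp only: of_nat_power)
        qed
        then have "exp (\<gamma> - 1) * exp ((1 + \<eta>/2) * L) \<le> exp (\<gamma> - \<theta> ^ s2 * y) * real ((D - 1) ^ k2)"
          using g by (intro mult_mono) auto
        moreover have "(1 - exp (\<gamma> - \<theta> ^ s2 * y)) ^ ((D - 1) ^ k2) \<le> exp (- exp (\<gamma> - \<theta> ^ s2 * y)) ^ ((D - 1) ^ k2)"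
          using g' exp_ge_add_one_self[of "- exp (\<gamma> - \<theta> ^ s2 * y)"] by (intro power_mono) auto
        moreover have "exp (- exp (\<gamma> - \<theta> ^ s2 * y)) ^ ((D - 1) ^ k2) = exp (- (exp (\<gamma> - \<theta> ^ s2 * y) * real ((D - 1) ^ k2)))"
          by (simp add: exp_of_nat_mult[symmetric] mult.commute)
        ultimately have "(1 - exp (\<gamma> - \<theta> ^ s2 * y)) ^ ((D - 1) ^ k2) \<le> exp (- (exp (\<gamma> - 1) * exp ((1 + \<eta>/2) * L)))"
          by (smt (verit) exp_le_cancel_iff)
        then show ?thesis using el(10) unfolding mult_minus_left by (rule order_trans)
      qed
      also have "(real (K ^ Suc R) * (real N / real (card ?H - N))) ^ 2 \<le> 4 * exp (- 3/2*x)"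
      proof -
        have "K ^ Suc R \<le> N" using K3 by (simp add: N_def trans_le_add2)
        then have k: "real (K ^ Suc R) \<le> exp (x/8)" using N1 by (meson of_nat_le_iff order_trans)
        have "exp x / 2 \<le> exp x - exp (x / 8)"
        proof -
          have "exp (x/8) * 2 \<le> exp (x / 8) * exp (x / 2)" using el(12) by (intro mult_left_mono) auto
          also have "\<dots> \<le> exp x" using x1 by (simp add: exp_add[symmetric])
          finally show ?thesis by simp
        qed
        also have "\<dots> \<le> real (card ?H - N)" using nl N1 nx NH by (simp add: of_nat_diff)
        finally have h: "exp x / 2 \<le> real (card ?H - N)" .
        have "real N / real (card ?H - N) \<le> exp (x/8) / (exp x / 2)"
          using N1 h by (intro frac_le) auto
        then have "real (K ^ Suc R) * (real N / real (card ?H - N)) \<le> exp (x/8) * (exp (x/8) / (exp x / 2))"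
          using k by (intro mult_mono) auto
        also have "\<dots> = 2 * exp (- 3/4 * x)" by (simp add: exp_add[symmetric] exp_diff[symmetric] field_simps)
        finally have "(real (K ^ Suc R) * (real N / real (card ?H - N))) ^ 2 \<le> (2 * exp (- 3/4 * x)) ^ 2"
          by (intro power_mono) auto
        also have "\<dots> = 4 * exp (- 3/2 * x)" by (simp add: power2_eq_square exp_add[symmetric])
        finally show ?thesis .
      qed
      finally show ?thesis by simp
    qed
    have uln: "u k = exp (b + \<theta> ^ k * (\<alpha> * x - b))" for k by (simp add: u_def)
    have u0: "1 \<le> u k" "u k \<le> real n powr \<alpha>" for k
    proof -
      have t: "0 \<le> \<theta> ^ k" "\<theta> ^ k \<le> 1" using th by (auto simp: power_le_one)
      then have "0 \<le> \<theta> ^ k * (\<alpha> * x - b)" "\<theta> ^ k * (\<alpha> * x - b) \<le> 1 * (\<alpha> * x - b)"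
        using b1 by (auto intro!: mult_left_le_one_le)
      then show "1 \<le> u k" "u k \<le> real n powr \<alpha>" using b0 by (auto simp: uln nx powr_def)
    qed
    have lenn: "real (card ?H) \<le> C * exp x" using len[of n] nx by simp
    have H0: "real (card ?H) > 0" using NH by simp
    have "match_prob ?H {} (distant n (d n) (?T n)) \<le> real n * (exp (-2*x) + 4 * exp (- 3/2*x)) + real s1 * real n * exp (-2*x)
        + real n ^ 2 * exp (- exp (2*\<alpha>*x) / (2 * C * exp x))"
    proof (rule distant_union_bound[where u = u and s = s1 and K = K and R = R])
      show "u s1 \<le> real K"
      proof -
        have "\<theta> ^ s1 * (\<alpha> * x - b) \<le> exp (- L) * (\<alpha> * x)"
          using thp[OF s1b(1)] b0 b1 th by (intro mult_mono) auto
        also have "\<dots> = \<alpha>" using xL x1 by (simp add: exp_minus field_simps)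
        finally have "u s1 \<le> exp (b + \<alpha>)" by (simp add: uln)
        then show ?thesis using K1(1) by simp
      qed
      show "2 * (real R + real s1) + 1 \<le> ?T n"
      proof -
        have "2 * (real R + real s1) + 1 \<le> (2 * ln (\<sigma> * L) / A + 9) + 2 * ((1 + \<eta>/2) * L / B) + 2 * (L / A)"
          using s1b s2b k2b by (simp add: R_def)
        also have "\<dots> \<le> k9 * L + 2 * ((1 + \<eta>/2) * L / B) + 2 * (L / A)" using el(8) by simp
        also have "\<dots> = (1 + \<eta>) * (2 / B + 2 / A) * L" using A0 B0 by (simp add: k9_def field_simps)
        finally show ?thesis by (simp add: L_def x_def)
      qed
      show "match_prob ?H {} (far_from_core n (d n) K R v) \<le> exp (-2 * x) + 4 * exp (- 3/2*x)" if "v < n" for v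
        using far[OF that] .
      show "match_prob ?H {} (no_step_up n (d n) (u k) i) \<le> exp (-2*x)" if "k < s1" "i < n" "u (Suc k) \<le> real (d n i)" for k i
      proof -
        have "match_prob ?H {} (no_step_up n (d n) (u k) i) \<le> exp (- u (Suc k) * (c * real n * u k powr (-\<theta>)) / (2 * real (card ?H)))"
        proof (rule match_prob_no_step_up)
          show "c * real n * u k powr (-\<theta>) \<le> vol n (d n) (u k)" using u0 that by (intro vol) auto
        qed (use that u0 c in \<open>auto simp: u_def\<close>)
        also have "\<dots> \<le> exp (-2*x)"
        proof -
          have "u (Suc k) = c3 * x * u k powr \<theta>"
          proof -
            have "b = \<theta> * b + ln (c3 * x)" unfolding b_def p_def using th by (simp add: field_simps)
            moreover have "b + \<theta> ^ Suc k * (\<alpha> * x - b) = (b - \<theta> * b) + \<theta> * (b + \<theta> ^ k * (\<alpha> * x - b))" by (simp add: algebra_simps)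
            ultimately have "b + \<theta> ^ Suc k * (\<alpha> * x - b) = ln (c3 * x) + \<theta> * (b + \<theta> ^ k * (\<alpha> * x - b))" by linarith
            then have "u (Suc k) = exp (ln (c3 * x)) * exp (\<theta> * (b + \<theta> ^ k * (\<alpha> * x - b)))" by (simp add: uln exp_add)
            then show ?thesis using c30 x1 by (simp add: uln powr_def)
          qed
          moreover have "u k powr \<theta> * u k powr (-\<theta>) = 1" using u0[of k] by (simp add: powr_minus)
          ultimately have "u (Suc k) * (c * real n * u k powr (-\<theta>)) = c3 * c * x * real n"
            by (metis (no_types, opaque_lifting) mult.assoc mult.commute mult.right_neutral)
          also have "\<dots> = 4 * C * x * real n" using c by (simp add: c3_def)
          finally have eq: "u (Suc k) * (c * real n * u k powr (-\<theta>)) = 4 * C * x * real n" .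
          have "2 * x * (2 * real (card ?H)) \<le> 2 * x * (2 * (C * real n))" using len[of n] x1 by (intro mult_left_mono) auto
          then have "2 * x * (2 * real (card ?H)) \<le> 4 * C * x * real n" by (simp add: mult_ac)
          then have "2 * x \<le> 4 * C * x * real n / (2 * real (card ?H))" using H0 by (simp add: pos_le_divide_eq)
          then show ?thesis unfolding mult_minus_left eq by simp
        qed
        finally show ?thesis .
      qed
      show "match_prob ?H {} {\<sigma>. (i, j) \<notin> cm_adj n (d n) \<sigma>} \<le> exp (- exp (2*\<alpha>*x) / (2 * C * exp x))"
        if ij: "i < n" "j < n" "i \<noteq> j" "u 0 \<le> real (d n i)" "u 0 \<le> real (d n j)" for i j
      proof -
        have "match_prob ?H {} {\<sigma>. (i, j) \<notin> cm_adj n (d n) \<sigma>} \<le> exp (- real (d n i) * real (card (hes (d n) {j})) / (2 * real (card ?H)))"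
          using match_prob_no_edge[of "{j}" n i "d n"] ij by simp
        also have "\<dots> \<le> exp (- exp (2*\<alpha>*x) / (2 * C * exp x))"
        proof -
          have "exp (2*\<alpha>*x) = u 0 * u 0" by (simp add: u_def exp_add[symmetric])
          also have "\<dots> \<le> real (d n i) * real (d n j)" using ij u0[of 0] by (intro mult_mono) auto
          finally have "exp (2*\<alpha>*x) / (2 * C * exp x) \<le> real (d n i) * real (d n j) / (2 * real (card ?H))"
            using lenn H0 by (intro frac_le) auto
          then show ?thesis by (simp add: card_hes)
        qed
        finally show ?thesis .
      qed
    qed auto
    also have "\<dots> \<le> ?bd x"
      unfolding nx using s1b(2) by (intro add_mono mult_right_mono) (auto simp: L_def)
    finally show ?case by (simp add: x_def)
  qed
  have "(?bd \<longlongrightarrow> 0) at_top" using A0 C0 al by real_asymp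
  then have "((\<lambda>n. ?bd (ln (real n))) \<longlongrightarrow> 0) sequentially"
    using filterlim_ln_real by (rule filterlim_compose)
  then have "(\<lambda>n. match_prob (half_edges n (d n)) {} (distant n (d n) (?T n))) \<longlonglongrightarrow> 0"
    by (rule tendsto_sandwich[OF always_eventually main tendsto_const, rotated]) simp
  then show ?thesis by (simp add: A_def B_def)
qed

section \<open>Balls of minimal degree\<close>

lemma partial_matching_sym: "partial_matching S M \<Longrightarrow> (a, b) \<in> M \<Longrightarrow> (b, a) \<in> M"
  unfolding partial_matching_def by (meson symE)

primrec ball_at :: "(nat \<times> nat) set \<Rightarrow> nat \<Rightarrow> nat \<Rightarrow> nat set" where
  "ball_at E v 0 = {v}"
| "ball_at E v (Suc r) = ball_at E v r \<union> E `` ball_at E v r"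

lemma ball_at_mono: "r \<le> s \<Longrightarrow> ball_at E v r \<subseteq> ball_at E v s"
  by (induction s) (auto simp: le_Suc_eq)

lemma ball_at_relpow: "x \<in> ball_at E v r \<longleftrightarrow> (\<exists>t\<le>r. (v, x) \<in> E ^^ t)"
proof (induction r arbitrary: x)
  case (Suc r)
  show ?case
  proof
    assume "x \<in> ball_at E v (Suc r)"
    then consider "x \<in> ball_at E v r" | w where "w \<in> ball_at E v r" "(w, x) \<in> E" by auto
    then show "\<exists>t\<le>Suc r. (v, x) \<in> E ^^ t"
    proof cases
      case 1 then show ?thesis using Suc le_SucI by blast
    next
      case 2
      then obtain t where "t \<le> r" "(v, w) \<in> E ^^ t" using Suc by blast
      then have "(v, x) \<in> E ^^ Suc t" using 2 by auto
      then show ?thesis using \<open>t \<le> r\<close> Suc_le_mono by blast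
    qed
  next
    assume "\<exists>t\<le>Suc r. (v, x) \<in> E ^^ t"
    then obtain t where t: "t \<le> Suc r" "(v, x) \<in> E ^^ t" by blast
    show "x \<in> ball_at E v (Suc r)"
    proof (cases "t \<le> r")
      case True then show ?thesis using Suc t by auto
    next
      case False
      then have "t = Suc r" using t by simp
      then obtain w where "(v, w) \<in> E ^^ r" "(w, x) \<in> E" using t by auto
      then show ?thesis using Suc[of w] by auto
    qed
  qed
qed auto

definition min_degree_ball :: "nat \<Rightarrow> (nat \<Rightarrow> nat) \<Rightarrow> nat \<Rightarrow> nat \<Rightarrow> nat \<Rightarrow> ((nat \<times> nat) \<Rightarrow> (nat \<times> nat)) set" where
  "min_degree_ball n d D k v = {\<sigma>. \<forall>x\<in>ball_at (cm_adj n d \<sigma>) v k. d x = D}"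

lemma cm_adj_lt: "(x, y) \<in> cm_adj n d \<sigma> \<Longrightarrow> x < n \<and> y < n" by (auto simp: cm_adj_def)

lemma ball_at_lt: "v < n \<Longrightarrow> ball_at (cm_adj n d \<sigma>) v r \<subseteq> {..<n}"
  by (induction r) (auto dest: cm_adj_lt)

lemma cm_adjE:
  assumes "(x, w) \<in> cm_adj n d \<sigma>"
  obtains h where "h \<in> half_edges n d" "fst h = x" "fst (\<sigma> h) = w"
proof -
  obtain j k where jk: "x < n" "j < d x" "\<sigma> (x, j) = (w, k)" using assms by (auto simp: cm_adj_def)
  show ?thesis by (rule that[of "(x, j)"]) (use jk in \<open>auto simp: half_edges_def\<close>)
qed

text \<open>Number of pairings required below a half-edge with \<open>r\<close> steps left if every
  new vertex has degree \<open>D\<close>: its own, then those of \<open>D - 1\<close> half-edges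
  with one step less.\<close>

primrec tree_edges :: "nat \<Rightarrow> nat \<Rightarrow> nat" where
  "tree_edges D 0 = 0"
| "tree_edges D (Suc r) = 1 + (D - 1) * tree_edges D r"

lemma tree_edges_le: "3 \<le> D \<Longrightarrow> tree_edges D r + 1 \<le> (D - 1) ^ r"
proof (induction r)
  case (Suc r)
  have "(D - 1) * (tree_edges D r + 1) \<le> (D - 1) * (D - 1) ^ r" using Suc by (intro mult_le_mono2) auto
  then show ?case using Suc.prems by simp
qed auto

text \<open>A lower bound obtained by forcing a tree: as long as an active half-edge has steps left,
  its partner belongs to a fresh vertex of degree \<open>D\<close> with probability at least
  \<open>c\<close>, because at most \<open>Nx\<close> vertices are ever used. As
  \<open>\<rho>\<close> changes by at most one along revealed edges, all vertices within distance
  \<open>k\<close> of \<open>v\<close> are explored at the end.\<close>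

lemma explore_min_degree:
  fixes c :: real
  assumes D: "1 \<le> D" and c: "0 < c" "c \<le> 1"
    and cN: "c * real (card (half_edges n d)) \<le> real D * (real (card {i. i < n \<and> d i = D}) - real Nx)"
    and ev: "even (card (half_edges n d))"
    and "partial_matching (half_edges n d) M" "even (card (Domain M))" "X \<subseteq> {i. i < n \<and> d i = D}" "Domain M \<subseteq> hes d X"
    and "\<And>a b. (a,b) \<in> M \<Longrightarrow> \<rho> (fst a) \<le> \<rho> (fst b) + 1" "v \<in> X" "\<rho> v = k"
    and "card X + (\<Sum>h\<in>hes d X - Domain M. tree_edges D (\<rho> (fst h))) \<le> Nx"
  shows "c ^ (\<Sum>h\<in>hes d X - Domain M. tree_edges D (\<rho> (fst h))) \<le> match_prob (half_edges n d) M (min_degree_ball n d D k v)"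
  using assms(6-)
proof (induction "\<Sum>h\<in>hes d X - Domain M. tree_edges D (\<rho> (fst h))" arbitrary: M X \<rho> rule: less_induct)
  case less
  let ?H = "half_edges n d" and ?A = "hes d X - Domain M" and ?E = "min_degree_ball n d D k v"
  define T where "T = (\<Sum>h\<in>?A. tree_edges D (\<rho> (fst h)))"
  have Xn: "X \<subseteq> {..<n}" using less.prems(3) by auto
  have finX: "finite X" using Xn finite_subset by blast
  have finA: "finite ?A" using finX by simp
  have AH: "hes d X \<subseteq> ?H" by (rule hes_subset[OF Xn])
  show ?case
  proof (cases "T = 0")
    case True
    have z: "\<rho> (fst h) = 0" if "h \<in> ?A" for h
    proof -
      have "tree_edges D (\<rho> (fst h)) = 0" using True that finA unfolding T_def by simp
      then show ?thesis by (cases "\<rho> (fst h)") auto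
    qed
    have "card (ext ?H M) > 0"
      using card_ext[OF _ less.prems(1)] num_matchings_even_pos ev less.prems(2) by simp
    then have ne: "ext ?H M \<noteq> {}" by auto
    have "ext ?H M \<subseteq> ?E"
    proof
      fix \<sigma> assume s: "\<sigma> \<in> ext ?H M"
      \<comment> \<open>A vertex reached in fewer than \<open>k\<close> steps has positive
        \<open>\<rho>\<close>, so all its half-edges are matched in \<open>M\<close> and its
        neighbours lie in \<open>X\<close> again.\<close>
      have sub: "r \<le> k \<Longrightarrow> ball_at (cm_adj n d \<sigma>) v r \<subseteq> {x \<in> X. k - r \<le> \<rho> x}" for r
      proof (induction r)
        case 0 then show ?case using less.prems by auto
      next
        case (Suc r)
        have IH: "ball_at (cm_adj n d \<sigma>) v r \<subseteq> {x \<in> X. k - r \<le> \<rho> x}" using Suc by simp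
        have "w \<in> X \<and> k - Suc r \<le> \<rho> w" if x: "x \<in> ball_at (cm_adj n d \<sigma>) v r" and xw: "(x, w) \<in> cm_adj n d \<sigma>" for x w
        proof -
          have xX: "x \<in> X" "k - r \<le> \<rho> x" using IH x by auto
          obtain h where h: "h \<in> ?H" "fst h = x" "fst (\<sigma> h) = w" using cm_adjE[OF xw] .
          have "h \<in> hes d X" using h xX by (cases h) (auto simp: half_edges_def)
          moreover have "\<rho> (fst h) \<noteq> 0" using xX h Suc.prems by simp
          ultimately have "h \<in> Domain M" using z[of h] by (metis DiffI)
          then obtain b where b: "(h, b) \<in> M" by auto
          have "\<sigma> h = b" using extD[OF s b] .
          have "(b, h) \<in> M" using partial_matching_sym[OF less.prems(1) b] .
          then have "b \<in> hes d X" using less.prems(4) by auto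
          then have "w \<in> X" using h \<open>\<sigma> h = b\<close> by (auto simp: hes_def)
          moreover have "\<rho> x \<le> \<rho> w + 1" using less.prems(5)[OF b] h \<open>\<sigma> h = b\<close> by simp
          ultimately show ?thesis using xX by simp
        qed
        then show ?case using IH by (auto intro: diff_le_mono2 order_trans[OF diff_le_mono2[of r "Suc r"]])
      qed
      show "\<sigma> \<in> ?E" unfolding min_degree_ball_def using sub[of k] less.prems(3) by auto
    qed
    then have "match_prob ?H M ?E = 1" using ne by (intro match_prob_eq1) auto
    then show ?thesis using True T_def by simp
  next
    case False
    have "\<exists>h\<in>?A. tree_edges D (\<rho> (fst h)) \<noteq> 0"
    proof (rule ccontr)
      assume "\<not> ?thesis"
      then have "T = 0" unfolding T_def by (intro sum.neutral) auto
      then show False using False by simp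
    qed
    then obtain h where h: "h \<in> ?A" "tree_edges D (\<rho> (fst h)) \<noteq> 0" by blast
    then obtain r where r: "\<rho> (fst h) = Suc r" by (cases "\<rho> (fst h)") auto
    have hS: "h \<in> ?H - Domain M" using h AH by auto
    define Z where "Z = {i. i < n \<and> d i = D} - X"
    have finZ: "finite Z" by (simp add: Z_def)
    have ZD: "d z = D" "z < n" "z \<notin> X" if "z \<in> Z" for z using that by (auto simp: Z_def)
    have "real (card Z) = real (card {i. i < n \<and> d i = D}) - real (card X)"
      unfolding Z_def using less.prems(3) finX card_mono[OF _ less.prems(3)] by (simp add: card_Diff_subset of_nat_diff)
    moreover have "card X \<le> Nx" using less.prems(8) by simp
    ultimately have "real (card {i. i < n \<and> d i = D}) - real Nx \<le> real (card Z)" by simp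
    then have "real D * (real (card {i. i < n \<and> d i = D}) - real Nx) \<le> real D * real (card Z)" by (intro mult_left_mono) auto
    moreover have "card (hes d Z) = D * card Z" using finZ ZD by (simp add: card_hes)
    ultimately have cH: "c * real (card ?H) \<le> real (card (hes d Z))" using cN by simp
    have TA: "T = tree_edges D (Suc r) + (\<Sum>g\<in>?A - {h}. tree_edges D (\<rho> (fst g)))"
      unfolding T_def using sum.remove[OF finA h(1), of "\<lambda>h. tree_edges D (\<rho> (fst h))"] r by simp
    let ?Y = "?H - Domain M - {h}"
    have dXZ: "hes d X \<inter> hes d Z = {}" by (auto simp: hes_def Z_def)
    have ZY: "hes d Z \<subseteq> ?Y"
      using dXZ less.prems(4) h hes_subset[of Z n d] by (auto simp: Z_def)
    have step: "c ^ (T - 1) \<le> match_prob ?H (addp h y M) ?E" if y: "y \<in> hes d Z" for y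
    proof -
      define z where "z = fst y"
      have zZ: "z \<in> Z" and yz: "snd y < d z" using y by (auto simp: z_def hes_def)
      define X' where "X' = insert z X"
      define \<rho>' where "\<rho>' = \<rho>(z := r)"
      define Zh where "Zh = hes d {z} - {y}"
      have yhz: "y \<in> hes d {z}" using yz by (cases y) (auto simp: z_def)
      have cZ: "card Zh = D - 1" using yhz ZD[OF zZ] by (simp add: Zh_def card_hes)
      have hesX': "hes d X' = hes d X \<union> hes d {z}" "hes d X \<inter> hes d {z} = {}"
        using ZD[OF zZ] by (auto simp: X'_def hes_def)
      have Aeq: "hes d X' - Domain (addp h y M) = (?A - {h}) \<union> Zh"
      proof -
        have "hes d {z} \<inter> Domain M = {}" using less.prems(4) hesX'(2) by blast
        moreover have "h \<notin> hes d {z}" using h(1) hesX'(2) by blast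
        moreover have "y \<notin> hes d X" using yhz hesX'(2) by blast
        ultimately show ?thesis unfolding hesX'(1) Domain_addp Zh_def by blast
      qed
      have dis: "(?A - {h}) \<inter> Zh = {}" using hesX'(2) by (auto simp: Zh_def)
      have finZh: "finite Zh" by (simp add: Zh_def)
      have onA: "\<rho>' (fst g) = \<rho> (fst g)" if "g \<in> ?A - {h}" for g
        using that ZD[OF zZ] by (auto simp: \<rho>'_def hes_def)
      have onZ: "\<rho>' (fst g) = r" if "g \<in> Zh" for g
        using that by (auto simp: Zh_def \<rho>'_def hes_def)
      have fin1: "finite (?A - {h})" using finA by simp
      \<comment> \<open>Closing one half-edge at level \<open>Suc r\<close> and opening
        \<open>D - 1\<close> at level \<open>r\<close> lowers the count by exactly one, in step with
        the single factor \<open>c\<close> that is spent.\<close>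
      have TT: "(\<Sum>h\<in>hes d X' - Domain (addp h y M). tree_edges D (\<rho>' (fst h))) = T - 1"
        unfolding Aeq sum.union_disjoint[OF fin1 finZh dis] TA using onA onZ cZ by simp
      have T1: "T - 1 < T" using False by simp
      have pm: "partial_matching ?H (addp h y M)"
        using hS ZY y by (intro partial_matching_addp less.prems) auto
      have "c ^ (\<Sum>h\<in>hes d X' - Domain (addp h y M). tree_edges D (\<rho>' (fst h))) \<le> match_prob ?H (addp h y M) ?E"
      proof (rule less.hyps)
        show "(\<Sum>h\<in>hes d X' - Domain (addp h y M). tree_edges D (\<rho>' (fst h))) < (\<Sum>h\<in>?A. tree_edges D (\<rho> (fst h)))"
          unfolding TT using T1 T_def by simp
        show "partial_matching ?H (addp h y M)" by fact
        have "finite (Domain M)" using less.prems(4) finX finite_subset finite_hes by blast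
        moreover have "h \<noteq> y" "h \<notin> Domain M" "y \<notin> Domain M" using ZY y hS by auto
        ultimately show "even (card (Domain (addp h y M)))" using less.prems(2) by simp
        show "X' \<subseteq> {i. i < n \<and> d i = D}" using less.prems(3) ZD[OF zZ] by (auto simp: X'_def)
        show "Domain (addp h y M) \<subseteq> hes d X'" using h yhz less.prems(4) hesX'(1) by auto
        show "v \<in> X'" using less.prems by (simp add: X'_def)
        show "\<rho>' v = k" using less.prems ZD[OF zZ] by (auto simp: \<rho>'_def)
        have "card X' = card X + 1" using finX ZD[OF zZ] by (simp add: X'_def)
        then show "card X' + (\<Sum>h\<in>hes d X' - Domain (addp h y M). tree_edges D (\<rho>' (fst h))) \<le> Nx"
          unfolding TT using less.prems(8) False unfolding T_def[symmetric] by simp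
        fix a b assume ab: "(a, b) \<in> addp h y M"
        have hX: "fst h \<in> X" using h by (auto simp: hes_def)
        consider "a = h" "b = y" | "a = y" "b = h" | "(a, b) \<in> M" using ab by (auto simp: addp_def)
        then show "\<rho>' (fst a) \<le> \<rho>' (fst b) + 1"
        proof cases
          case 3
          then have "(b, a) \<in> M" using partial_matching_sym[OF less.prems(1)] by simp
          then have "fst a \<in> X" "fst b \<in> X" using 3 less.prems(4) by (auto simp: hes_def)
          then show ?thesis using less.prems(5)[OF 3] ZD[OF zZ] by (auto simp: \<rho>'_def)
        qed (use r hX ZD[OF zZ] in \<open>auto simp: \<rho>'_def z_def\<close>)
      qed
      then show ?thesis unfolding TT .
    qed
    define m where "m = card ?Y"
    have cY: "card (?H - Domain M) - 1 = m" using hS by (simp add: m_def)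
    have mH: "m \<le> card ?H" unfolding m_def by (intro card_mono) auto
    have "card ?H > 0" using hS by (auto simp: card_gt_0_iff)
    then have "card (hes d Z) > 0" using cH c by (smt (verit) mult_pos_pos of_nat_0_less_iff)
    moreover have "card (hes d Z) \<le> m" unfolding m_def using ZY by (intro card_mono) auto
    ultimately have m0: "m > 0" by simp
    have "c * c ^ (T - 1) \<le> real (card (hes d Z)) / real m * c ^ (T - 1)"
    proof (rule mult_right_mono)
      have "c * real m \<le> c * real (card ?H)" using mH c by simp
      then show "c \<le> real (card (hes d Z)) / real m" using cH m0 by (simp add: pos_le_divide_eq)
    qed (use c in simp)
    also have "\<dots> = (\<Sum>y\<in>hes d Z. c ^ (T - 1)) / real m" by simp
    also have "\<dots> \<le> (\<Sum>y\<in>hes d Z. match_prob ?H (addp h y M) ?E) / real m"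
      by (intro divide_right_mono sum_mono step) auto
    also have "\<dots> \<le> (\<Sum>y\<in>?Y. match_prob ?H (addp h y M) ?E) / real m"
      using ZY by (intro divide_right_mono sum_mono2) auto
    also have "\<dots> = match_prob ?H M ?E" using match_prob_step[OF _ less.prems(1) hS, of ?E] unfolding cY by simp
    finally show ?thesis using False unfolding T_def[symmetric] by (cases T) auto
  qed
qed

lemma prob_min_degree_ball:
  fixes c :: real
  assumes D: "1 \<le> D" and c: "0 < c" "c \<le> 1"
    and cN: "c * real (card (half_edges n d)) \<le> real D * (real (card {i. i < n \<and> d i = D}) - real Nx)"
    and ev: "even (card (half_edges n d))" and v: "v < n" "d v = D" and Nx: "1 + D * tree_edges D k \<le> Nx"
  shows "c ^ (D * tree_edges D k) \<le> match_prob (half_edges n d) {} (min_degree_ball n d D k v)"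
  using explore_min_degree[OF D c cN ev, of "{}" "{v}" "\<lambda>_. k" v k] v Nx
  by (simp add: card_hes)

section \<open>The revealed neighbourhood of a vertex as a partial matching\<close>

definition local_matching :: "nat \<Rightarrow> (nat \<Rightarrow> nat) \<Rightarrow> nat \<Rightarrow> nat \<Rightarrow> ((nat \<times> nat) \<Rightarrow> (nat \<times> nat)) \<Rightarrow> ((nat \<times> nat) \<times> (nat \<times> nat)) set" where
  "local_matching n d k v \<sigma> = (\<lambda>a. (a, \<sigma> a)) ` {a \<in> half_edges n d.
     fst a \<in> ball_at (cm_adj n d \<sigma>) v k \<or> fst (\<sigma> a) \<in> ball_at (cm_adj n d \<sigma>) v k}"

lemma local_matching_iff:
  "(a, b) \<in> local_matching n d k v \<sigma> \<longleftrightarrow> b = \<sigma> a \<and> a \<in> half_edges n d \<and>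
     (fst a \<in> ball_at (cm_adj n d \<sigma>) v k \<or> fst (\<sigma> a) \<in> ball_at (cm_adj n d \<sigma>) v k)"
  unfolding local_matching_def by blast

lemma Domain_local_matching:
  "Domain (local_matching n d k v \<sigma>) = {a \<in> half_edges n d. fst a \<in> ball_at (cm_adj n d \<sigma>) v k \<or> fst (\<sigma> a) \<in> ball_at (cm_adj n d \<sigma>) v k}"
  unfolding local_matching_def Domain_fst image_image by simp

context
  fixes n :: nat and d :: "nat \<Rightarrow> nat" and v k :: nat and \<sigma> :: "(nat \<times> nat) \<Rightarrow> (nat \<times> nat)"
  assumes v: "v < n" and s: "\<sigma> \<in> matchings (half_edges n d)"
begin

lemma local_matching_ext: "\<sigma> \<in> ext (half_edges n d) (local_matching n d k v \<sigma>)"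
  using s unfolding ext_def by (auto simp: local_matching_iff simp del: split_paired_All split_paired_Ex)

lemma local_matching_partial_matching: "partial_matching (half_edges n d) (local_matching n d k v \<sigma>)"
proof -
  have m: "\<sigma> a \<in> half_edges n d" "\<sigma> a \<noteq> a" "\<sigma> (\<sigma> a) = a" if "a \<in> half_edges n d" for a
    using s that by (auto simp: matchings_def)
  show ?thesis unfolding partial_matching_def
  proof (intro conjI)
    show "sym (local_matching n d k v \<sigma>)"
    proof (rule symI)
      fix a b assume "(a, b) \<in> local_matching n d k v \<sigma>"
      then show "(b, a) \<in> local_matching n d k v \<sigma>" using m[of a] unfolding local_matching_iff by auto
    qed
    show "irrefl (local_matching n d k v \<sigma>)"
    proof (rule irreflI)
      fix a show "(a, a) \<notin> local_matching n d k v \<sigma>" using m(2)[of a] unfolding local_matching_iff by metis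
    qed
    show "single_valued (local_matching n d k v \<sigma>)"
    proof (rule single_valuedI)
      fix a b c assume "(a, b) \<in> local_matching n d k v \<sigma>" "(a, c) \<in> local_matching n d k v \<sigma>"
      then show "b = c" unfolding local_matching_iff by simp
    qed
    show "Domain (local_matching n d k v \<sigma>) \<subseteq> half_edges n d" unfolding Domain_local_matching by blast
  qed
qed

lemma Domain_local_matching_subset:
  "Domain (local_matching n d k v \<sigma>) \<subseteq> hes d (ball_at (cm_adj n d \<sigma>) v (Suc k))"
proof
  fix a assume a: "a \<in> Domain (local_matching n d k v \<sigma>)"
  then have aH: "a \<in> half_edges n d" by (auto simp: Domain_local_matching)
  then have e: "(fst a, fst (\<sigma> a)) \<in> cm_adj n d \<sigma>" using cm_adjI_ext[OF s] by blast
  then have "(fst (\<sigma> a), fst a) \<in> cm_adj n d \<sigma>" using sym_cm_adj[OF s] by (auto simp: sym_def)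
  then have "fst a \<in> ball_at (cm_adj n d \<sigma>) v (Suc k)" using a by (auto simp: Domain_local_matching)
  then show "a \<in> hes d (ball_at (cm_adj n d \<sigma>) v (Suc k))" using aH by (cases a) (auto simp: half_edges_def)
qed

text \<open>The ball of radius \<open>Suc k\<close> can be read off from the recorded pairs alone.
  Its outer vertices are ends of recorded pairs; the inner ones need a half-edge of their own, hence
  the positive degrees.\<close>

lemma fst_Domain_local_matching:
  assumes "\<And>x. x < n \<Longrightarrow> 1 \<le> d x"
  shows "fst ` Domain (local_matching n d k v \<sigma>) = ball_at (cm_adj n d \<sigma>) v (Suc k)"
proof
  show "fst ` Domain (local_matching n d k v \<sigma>) \<subseteq> ball_at (cm_adj n d \<sigma>) v (Suc k)"
  proof
    fix x assume "x \<in> fst ` Domain (local_matching n d k v \<sigma>)"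
    then obtain a where "a \<in> Domain (local_matching n d k v \<sigma>)" "x = fst a" by blast
    then show "x \<in> ball_at (cm_adj n d \<sigma>) v (Suc k)"
      using subsetD[OF Domain_local_matching_subset, of a] unfolding hes_def by auto
  qed
  show "ball_at (cm_adj n d \<sigma>) v (Suc k) \<subseteq> fst ` Domain (local_matching n d k v \<sigma>)"
  proof
    fix x assume "x \<in> ball_at (cm_adj n d \<sigma>) v (Suc k)"
    then consider "x \<in> ball_at (cm_adj n d \<sigma>) v k" | w where "w \<in> ball_at (cm_adj n d \<sigma>) v k" "(w, x) \<in> cm_adj n d \<sigma>" by auto
    then show "x \<in> fst ` Domain (local_matching n d k v \<sigma>)"
    proof cases
      case 1
      then have "x < n" using ball_at_lt[OF v] by blast
      then have "(x, 0) \<in> Domain (local_matching n d k v \<sigma>)" using 1 assms[of x] by (auto simp: Domain_local_matching half_edges_def)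
      then show ?thesis by (metis fst_conv image_eqI)
    next
      case 2
      obtain h where h: "h \<in> half_edges n d" "fst h = w" "fst (\<sigma> h) = x" using cm_adjE[OF 2(2)] .
      have "\<sigma> h \<in> half_edges n d" "\<sigma> (\<sigma> h) = h" using s h(1) by (auto simp: matchings_def)
      then have "\<sigma> h \<in> Domain (local_matching n d k v \<sigma>)" using h 2 by (auto simp: Domain_local_matching)
      then show ?thesis using h by (metis image_eqI)
    qed
  qed
qed

text \<open>The recorded pairs have at least one end in the ball of radius \<open>k\<close>. They
  fix every step out of that ball, hence the vertices up to radius \<open>Suc k\<close>, for every
  completion \<open>\<tau>\<close>.\<close>

lemma ball_at_local:
  assumes t: "\<tau> \<in> ext (half_edges n d) (local_matching n d k v \<sigma>)" and r: "r \<le> Suc k"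
  shows "ball_at (cm_adj n d \<tau>) v r = ball_at (cm_adj n d \<sigma>) v r"
  using r
proof (induction r)
  case (Suc r)
  have IH: "ball_at (cm_adj n d \<tau>) v r = ball_at (cm_adj n d \<sigma>) v r" using Suc by simp
  have eq: "\<tau> h = \<sigma> h" if "h \<in> half_edges n d" "fst h \<in> ball_at (cm_adj n d \<sigma>) v r" for h
  proof -
    have "fst h \<in> ball_at (cm_adj n d \<sigma>) v k" using that(2) ball_at_mono[of r k] Suc.prems by auto
    then have "h \<in> Domain (local_matching n d k v \<sigma>)" using that by (simp add: Domain_local_matching)
    then have "(h, \<sigma> h) \<in> local_matching n d k v \<sigma>" unfolding Domain_local_matching local_matching_iff by simp
    then show ?thesis using extD[OF t] by blast
  qed
  have "cm_adj n d \<tau> `` ball_at (cm_adj n d \<sigma>) v r = cm_adj n d \<sigma> `` ball_at (cm_adj n d \<sigma>) v r"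
  proof (intro equalityI subsetI)
    fix w assume "w \<in> cm_adj n d \<tau> `` ball_at (cm_adj n d \<sigma>) v r"
    then obtain x where x: "x \<in> ball_at (cm_adj n d \<sigma>) v r" "(x, w) \<in> cm_adj n d \<tau>" by blast
    obtain h where h: "h \<in> half_edges n d" "fst h = x" "fst (\<tau> h) = w" using cm_adjE[OF x(2)] .
    have "(fst h, fst (\<sigma> h)) \<in> cm_adj n d \<sigma>" using cm_adjI_ext[OF s h(1)] .
    then show "w \<in> cm_adj n d \<sigma> `` ball_at (cm_adj n d \<sigma>) v r" using h x eq[of h] by auto
  next
    fix w assume "w \<in> cm_adj n d \<sigma> `` ball_at (cm_adj n d \<sigma>) v r"
    then obtain x where x: "x \<in> ball_at (cm_adj n d \<sigma>) v r" "(x, w) \<in> cm_adj n d \<sigma>" by blast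
    obtain h where h: "h \<in> half_edges n d" "fst h = x" "fst (\<sigma> h) = w" using cm_adjE[OF x(2)] .
    have "(fst h, fst (\<tau> h)) \<in> cm_adj n d \<tau>" using cm_adjI_ext[OF ext_matchings[OF t] h(1)] .
    then show "w \<in> cm_adj n d \<tau> `` ball_at (cm_adj n d \<sigma>) v r" using h x eq[of h] by auto
  qed
  then show ?case using IH by simp
qed simp

text \<open>Each completion records the same pairs again, so different values of
  \<open>local_matching\<close> at \<open>v\<close> have disjoint sets of completions. A half-edge
  whose partner under \<open>\<tau>\<close> lies in the ball is handled by applying the
  involution.\<close>

lemma local_matching_local:
  assumes t: "\<tau> \<in> ext (half_edges n d) (local_matching n d k v \<sigma>)"
  shows "local_matching n d k v \<tau> = local_matching n d k v \<sigma>"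
proof -
  let ?B = "ball_at (cm_adj n d \<sigma>) v k"
  have B: "ball_at (cm_adj n d \<tau>) v k = ?B" using ball_at_local[OF t] by simp
  have inv: "\<sigma> a \<in> half_edges n d \<and> \<sigma> (\<sigma> a) = a \<and> \<tau> a \<in> half_edges n d \<and> \<tau> (\<tau> a) = a" if "a \<in> half_edges n d" for a
    using s ext_matchings[OF t] that by (auto simp: matchings_def)
  have eq: "\<tau> h = \<sigma> h" if "h \<in> half_edges n d" "fst h \<in> ?B" for h
  proof -
    have "h \<in> Domain (local_matching n d k v \<sigma>)" using that by (simp add: Domain_local_matching)
    then have "(h, \<sigma> h) \<in> local_matching n d k v \<sigma>" unfolding Domain_local_matching local_matching_iff by simp
    then show ?thesis using extD[OF t] by blast
  qed
  have eq2: "\<tau> h = \<sigma> h" if h: "h \<in> half_edges n d" and or: "fst h \<in> ?B \<or> fst (\<sigma> h) \<in> ?B \<or> fst (\<tau> h) \<in> ?B" for h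
    using or
  proof (elim disjE)
    assume "fst (\<sigma> h) \<in> ?B"
    then have "\<tau> (\<sigma> h) = \<sigma> (\<sigma> h)" using eq inv h by blast
    then show ?thesis using inv h by metis
  next
    assume "fst (\<tau> h) \<in> ?B"
    then have "\<tau> (\<tau> h) = \<sigma> (\<tau> h)" using eq inv h by blast
    then show ?thesis using inv h by metis
  qed (use eq h in blast)
  have "(a, b) \<in> local_matching n d k v \<tau> \<longleftrightarrow> (a, b) \<in> local_matching n d k v \<sigma>" for a b
    unfolding local_matching_iff B using eq2[of a] by metis
  then show ?thesis by auto
qed

end

section \<open>Sizes of balls of minimal degree\<close>

lemma card_adj_le:
  assumes "finite X" "\<And>x. x \<in> X \<Longrightarrow> d x = D"
  shows "card (cm_adj n d \<sigma> `` X) \<le> D * card X"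
proof -
  have "cm_adj n d \<sigma> `` X \<subseteq> (\<lambda>h. fst (\<sigma> h)) ` hes d X"
  proof
    fix w assume "w \<in> cm_adj n d \<sigma> `` X"
    then obtain x where x: "x \<in> X" "(x, w) \<in> cm_adj n d \<sigma>" by blast
    obtain h where h: "h \<in> half_edges n d" "fst h = x" "fst (\<sigma> h) = w" using cm_adjE[OF x(2)] .
    have "h \<in> hes d X" using h x by (cases h) (auto simp: half_edges_def)
    then show "w \<in> (\<lambda>h. fst (\<sigma> h)) ` hes d X" using h by blast
  qed
  then have "card (cm_adj n d \<sigma> `` X) \<le> card ((\<lambda>h. fst (\<sigma> h)) ` hes d X)" using assms by (intro card_mono) auto
  also have "\<dots> \<le> card (hes d X)" using assms by (intro card_image_le) auto
  also have "\<dots> = D * card X" using assms by (simp add: card_hes)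
  finally show ?thesis .
qed

lemma card_ball_at:
  assumes "v < n" "\<sigma> \<in> min_degree_ball n d D k v"
  shows "card (ball_at (cm_adj n d \<sigma>) v k) \<le> (D + 1) ^ k"
proof -
  have "r \<le> k \<Longrightarrow> card (ball_at (cm_adj n d \<sigma>) v r) \<le> (D + 1) ^ r" for r
  proof (induction r)
    case (Suc r)
    let ?B = "ball_at (cm_adj n d \<sigma>) v r"
    have fin: "finite ?B" by (rule finite_subset[OF ball_at_lt[OF assms(1)] finite_lessThan])
    have rk: "r \<le> k" using Suc.prems by simp
    have "d x = D" if "x \<in> ?B" for x
      using subsetD[OF ball_at_mono[OF rk] that] assms(2) unfolding min_degree_ball_def by blast
    then have "card (cm_adj n d \<sigma> `` ?B) \<le> D * card ?B" using fin by (intro card_adj_le) auto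
    then have "card (?B \<union> cm_adj n d \<sigma> `` ?B) \<le> card ?B + D * card ?B"
      using card_Un_le[of ?B "cm_adj n d \<sigma> `` ?B"] by linarith
    also have "\<dots> = (D + 1) * card ?B" by simp
    also have "\<dots> \<le> (D + 1) * (D + 1) ^ r" using Suc by (intro mult_le_mono2) simp
    finally show ?case by simp
  qed auto
  then show ?thesis by simp
qed

text \<open>A path of length at most \<open>2 k + 1\<close> between two such vertices only visits vertices of degree \<open>D\<close>.\<close>
lemma card_near:
  assumes u: "u < n" and s: "\<sigma> \<in> matchings (half_edges n d)" "\<sigma> \<in> min_degree_ball n d D k u"
  shows "card {v. v < n \<and> \<sigma> \<in> min_degree_ball n d D k v \<and> v \<in> ball_at (cm_adj n d \<sigma>) u (2 * k + 1)} \<le> (D + 1) ^ (2 * k + 1)"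
proof -
  let ?E = "cm_adj n d \<sigma>"
  \<comment> \<open>Only steps out of vertices of degree \<open>D\<close> are kept. This bounds the
    out-degree by \<open>D\<close>, whereas degrees in the full graph are unbounded.\<close>
  define R where "R = {(x, y) \<in> ?E. d x = D}"
  have Rim: "R `` X = ?E `` {x \<in> X. d x = D}" for X by (auto simp: R_def)
  have "{v. v < n \<and> \<sigma> \<in> min_degree_ball n d D k v \<and> v \<in> ball_at ?E u (2 * k + 1)} \<subseteq> ball_at R u (2 * k + 1)"
  proof
    fix v assume "v \<in> {v. v < n \<and> \<sigma> \<in> min_degree_ball n d D k v \<and> v \<in> ball_at ?E u (2 * k + 1)}"
    then have v: "v < n" "\<sigma> \<in> min_degree_ball n d D k v" "v \<in> ball_at ?E u (2 * k + 1)" by auto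
    obtain t where t: "t \<le> 2 * k + 1" "(u, v) \<in> ?E ^^ t" using v(3) ball_at_relpow by blast
    obtain f where f: "f 0 = u" "f t = v" "\<And>i. i < t \<Longrightarrow> (f i, f (Suc i)) \<in> ?E"
      using t(2) unfolding relpow_fun_conv by blast
    have fi: "(f i, f j) \<in> ?E ^^ (j - i)" if "i \<le> j" "j \<le> t" for i j
      unfolding relpow_fun_conv by (rule exI[of _ "\<lambda>l. f (i + l)"]) (use f(3) that in auto)
    have dD: "d (f i) = D" if i: "i \<le> t" for i
    \<comment> \<open>A position beyond \<open>k\<close> is within distance \<open>k\<close> of the
      other end, since the path has length at most \<open>2 * k + 1\<close>.\<close>
    proof (cases "i \<le> k")
      case True
      have "(u, f i) \<in> ?E ^^ i" using fi[of 0 i] i f(1) by simp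
      then have "f i \<in> ball_at ?E u k" using True ball_at_relpow by blast
      then show ?thesis using s(2) by (auto simp: min_degree_ball_def)
    next
      case False
      have "(f i, v) \<in> ?E ^^ (t - i)" using fi[of i t] i f(2) by simp
      then have "(v, f i) \<in> ?E ^^ (t - i)" using relpow_sym[OF sym_cm_adj[OF s(1)]] by blast
      moreover have "t - i \<le> k" using False t(1) by simp
      ultimately have "f i \<in> ball_at ?E v k" using ball_at_relpow by blast
      then show ?thesis using v(2) by (auto simp: min_degree_ball_def)
    qed
    have "(u, v) \<in> R ^^ t" unfolding relpow_fun_conv
      by (rule exI[of _ f]) (use f dD in \<open>auto simp: R_def\<close>)
    then show "v \<in> ball_at R u (2 * k + 1)" using t(1) ball_at_relpow by blast
  qed
  moreover have fin: "ball_at R u r \<subseteq> {..<n}" for r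
    by (induction r) (use u in \<open>auto simp: R_def dest: cm_adj_lt\<close>)
  moreover have "card (ball_at R u r) \<le> (D + 1) ^ r" for r
  proof (induction r)
    case (Suc r)
    let ?B = "ball_at R u r"
    have fB: "finite ?B" by (rule finite_subset[OF fin finite_lessThan])
    have "card (R `` ?B) \<le> D * card {x \<in> ?B. d x = D}" unfolding Rim using fB by (intro card_adj_le) auto
    also have "\<dots> \<le> D * card ?B" using fB by (intro mult_le_mono2 card_mono) auto
    finally have "card (?B \<union> R `` ?B) \<le> card ?B + D * card ?B"
      using card_Un_le[of ?B "R `` ?B"] by linarith
    also have "\<dots> = (D + 1) * card ?B" by simp
    also have "\<dots> \<le> (D + 1) * (D + 1) ^ r" using Suc by (intro mult_le_mono2) simp
    finally show ?case by simp
  qed auto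
  ultimately show ?thesis by (meson card_mono finite_lessThan finite_subset order_trans)
qed

section \<open>Counting truncated paths\<close>

text \<open>A path starting with the half-edge \<open>h\<close> of an explored vertex. Each list
  entry bounds the degree of one intermediate vertex, which must be new and is left by a half-edge
  other than that of arrival; the last partner lies in \<open>T\<close>. Newness guarantees that
  each step reveals a free half-edge.\<close>

fun chain :: "(nat \<Rightarrow> nat) \<Rightarrow> ((nat \<times> nat) \<Rightarrow> (nat \<times> nat)) \<Rightarrow> real list \<Rightarrow> nat set \<Rightarrow> nat \<times> nat \<Rightarrow> (nat \<times> nat) set \<Rightarrow> bool" where
  "chain d \<sigma> [] W h T = (\<sigma> h \<in> T)"
| "chain d \<sigma> (b # bs) W h T = (fst (\<sigma> h) \<notin> W \<and> real (d (fst (\<sigma> h))) \<le> b \<and>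
     (\<exists>g\<in>hes d {fst (\<sigma> h)} - {\<sigma> h}. chain d \<sigma> bs (insert (fst (\<sigma> h)) W) g T))"

text \<open>Truncated second moment: a vertex of degree \<open>k\<close> offers \<open>k\<close>
  half-edges for arrival and at most \<open>k\<close> for departure.\<close>

definition sqsum :: "nat \<Rightarrow> (nat \<Rightarrow> nat) \<Rightarrow> real \<Rightarrow> real" where
  "sqsum n d b = (\<Sum>i\<in>{i. i < n \<and> real (d i) \<le> b}. real (d i) ^ 2)"

lemma sqsum_nonneg: "sqsum n d b \<ge> 0" by (simp add: sqsum_def sum_nonneg)

lemma vol_nonneg: "vol n d b \<ge> 0" by (simp add: vol_def sum_nonneg)

text \<open>First moment over paths: an intermediate vertex contributes \<open>sqsum n d b\<close>,
  the last step \<open>card T\<close>, each divided by the number of candidates. Every intermediate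
  step uses two half-edges and no half-edge is its own partner, so
  \<open>card (half_edges n d) - U\<close> bounds that number from below throughout.\<close>

lemma match_prob_chain:
  fixes U :: nat
  assumes "partial_matching (half_edges n d) M" "Domain M \<subseteq> hes d W" "fst h \<in> W" "h \<in> half_edges n d - Domain M"
    and "card (Domain M) + 2 * length bs + 1 \<le> U" "U < card (half_edges n d)" "T \<subseteq> half_edges n d"
  shows "match_prob (half_edges n d) M {\<sigma>. chain d \<sigma> bs W h T}
    \<le> prod_list (map (\<lambda>b. sqsum n d b / (real (card (half_edges n d)) - real U)) bs) * (real (card T) / (real (card (half_edges n d)) - real U))"
  using assms(1-5)
proof (induction bs arbitrary: M W h)
  case Nil
  let ?H = "half_edges n d" and ?Y = "half_edges n d - Domain M - {h}"
  define m where "m = real (card (?H - Domain M) - 1)"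
  have mU: "real (card ?H) - real U \<le> m" "real (card ?H) - real U > 0"
    using card_free[OF _ Nil(1)] Nil(5) assms(6) by (auto simp: m_def)
  have finT: "finite T" by (rule finite_subset[OF assms(7)]) simp
  have "match_prob ?H M {\<sigma>. \<sigma> h \<in> T} = (\<Sum>y\<in>?Y. match_prob ?H (addp h y M) {\<sigma>. \<sigma> h \<in> T}) / m"
    unfolding m_def by (rule match_prob_step[OF _ Nil(1,4)]) simp
  also have "\<dots> \<le> (\<Sum>y\<in>?Y. if y \<in> T then 1 else 0) / m"
  proof (intro divide_right_mono sum_mono)
    fix y assume "y \<in> ?Y"
    show "match_prob ?H (addp h y M) {\<sigma>. \<sigma> h \<in> T} \<le> (if y \<in> T then 1 else 0)"
    proof (cases "y \<in> T")
      case False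
      then have "ext ?H (addp h y M) \<inter> {\<sigma>. \<sigma> h \<in> T} = {}" by (auto dest: ext_addpD)
      then show ?thesis by (simp add: match_prob_eq0)
    qed (simp add: match_prob_le1)
  qed (simp add: m_def)
  also have "(\<Sum>y\<in>?Y. if y \<in> T then 1 else 0) = real (card (?Y \<inter> T))" by (simp add: sum.If_cases)
  also have "real (card (?Y \<inter> T)) / m \<le> real (card T) / (real (card ?H) - real U)"
    using mU finT by (intro frac_le) (auto intro: card_mono)
  finally show ?case by simp
next
  case (Cons b bs)
  let ?H = "half_edges n d" and ?Y = "half_edges n d - Domain M - {h}"
  define l where "l = real (card ?H) - real U"
  define m where "m = real (card (?H - Domain M) - 1)"
  have mU: "l \<le> m" "l > 0"
    using card_free[OF _ Cons.prems(1)] Cons.prems(5) assms(6) by (auto simp: m_def l_def)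
  define p where "p = prod_list (map (\<lambda>b. sqsum n d b / l) bs) * (real (card T) / l)"
  have p0: "p \<ge> 0" unfolding p_def using mU by (intro mult_nonneg_nonneg prod_list_nonneg) (auto simp: sqsum_nonneg)
  let ?V = "{i. i < n \<and> real (d i) \<le> b}"
  let ?Ev = "{\<sigma>. chain d \<sigma> (b # bs) W h T}"
  have step: "match_prob ?H (addp h y M) ?Ev \<le> (if y \<in> hes d ?V then real (d (fst y)) * p else 0)" if y: "y \<in> ?Y" for y
  proof (cases "fst y \<notin> W \<and> real (d (fst y)) \<le> b")
    case False
    have "ext ?H (addp h y M) \<inter> ?Ev = {}"
    proof (rule ccontr)
      assume "ext ?H (addp h y M) \<inter> ?Ev \<noteq> {}"
      then obtain \<sigma> where "\<sigma> \<in> ext ?H (addp h y M)" "\<sigma> \<in> ?Ev" by blast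
      then show False using False ext_addpD[of \<sigma> ?H h y M] by simp
    qed
    then show ?thesis using p0 by (simp add: match_prob_eq0)
  next
    case True
    define z where "z = fst y"
    have yH: "y \<in> ?H" using y by auto
    have zn: "z < n" "snd y < d z" using yH by (auto simp: z_def half_edges_def)
    have zW: "z \<notin> W" "real (d z) \<le> b" using True by (auto simp: z_def)
    have yz: "y \<in> hes d {z}" using zn by (cases y) (auto simp: z_def)
    have pm: "partial_matching ?H (addp h y M)" using y Cons.prems by (intro partial_matching_addp) auto
    have "match_prob ?H (addp h y M) ?Ev \<le> (\<Sum>g\<in>hes d {z} - {y}. match_prob ?H (addp h y M) {\<sigma>. chain d \<sigma> bs (insert z W) g T})"
    proof (rule match_prob_UN_subset)
      show "ext ?H (addp h y M) \<inter> ?Ev \<subseteq> (\<Union>g\<in>hes d {z} - {y}. {\<sigma>. chain d \<sigma> bs (insert z W) g T})"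
      proof
        fix \<sigma> assume "\<sigma> \<in> ext ?H (addp h y M) \<inter> ?Ev"
        then have "\<sigma> h = y" "chain d \<sigma> (b # bs) W h T" using ext_addpD[of \<sigma> ?H h y M] by auto
        then show "\<sigma> \<in> (\<Union>g\<in>hes d {z} - {y}. {\<sigma>. chain d \<sigma> bs (insert z W) g T})" by (simp add: z_def)
      qed
    qed auto
    also have "\<dots> \<le> (\<Sum>g\<in>hes d {z} - {y}. p)"
    proof (rule sum_mono)
      fix g assume g: "g \<in> hes d {z} - {y}"
      have gz: "fst g = z" "snd g < d z" using g by (auto simp: hes_def)
      show "match_prob ?H (addp h y M) {\<sigma>. chain d \<sigma> bs (insert z W) g T} \<le> p"
        unfolding p_def l_def
      proof (rule Cons.IH)
        show "partial_matching ?H (addp h y M)" by fact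
        have "h \<in> hes d W" using Cons.prems(3,4) by (cases h) (auto simp: half_edges_def)
        then have "insert h (insert y (Domain M)) \<subseteq> hes d (insert z W)"
          using yz Cons.prems(2) hes_mono[of W "insert z W" d] hes_mono[of "{z}" "insert z W" d] by auto
        then show "Domain (addp h y M) \<subseteq> hes d (insert z W)" by simp
        show "fst g \<in> insert z W" using gz by simp
        have "g \<notin> hes d W" using gz zW by (auto simp: hes_def)
        moreover have "g \<in> ?H" using gz zn by (cases g) (auto simp: half_edges_def)
        moreover have "g \<noteq> y" using g by simp
        ultimately show "g \<in> ?H - Domain (addp h y M)" using Cons.prems(2) \<open>h \<in> hes d W\<close> by auto
        have "finite (Domain M)" by (rule finite_subset[of _ ?H]) (use Cons.prems(1) in \<open>auto simp: partial_matching_def\<close>)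
        moreover have "h \<noteq> y" "h \<notin> Domain M" "y \<notin> Domain M" using y Cons.prems(4) by auto
        ultimately show "card (Domain (addp h y M)) + 2 * length bs + 1 \<le> U" using Cons.prems(5) by simp
      qed
    qed
    also have "\<dots> = real (card (hes d {z} - {y})) * p" by simp
    also have "\<dots> \<le> real (d z) * p"
      using p0 card_Diff1_le[of "hes d {z}" y] by (intro mult_right_mono) (auto simp: card_hes)
    moreover have "y \<in> hes d ?V" using yz zn zW by (cases y) (auto simp: z_def)
    ultimately show ?thesis by (simp add: z_def)
  qed
  have "match_prob ?H M ?Ev = (\<Sum>y\<in>?Y. match_prob ?H (addp h y M) ?Ev) / m"
    unfolding m_def by (rule match_prob_step[OF _ Cons.prems(1,4)]) simp
  also have "\<dots> \<le> (\<Sum>y\<in>?Y. if y \<in> hes d ?V then real (d (fst y)) * p else 0) / m"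
    by (intro divide_right_mono sum_mono step) (auto simp: m_def)
  also have "(\<Sum>y\<in>?Y. if y \<in> hes d ?V then real (d (fst y)) * p else 0) = (\<Sum>y\<in>?Y \<inter> hes d ?V. real (d (fst y)) * p)"
    by (simp add: sum.If_cases Int_def)
  also have "\<dots> \<le> (\<Sum>y\<in>hes d ?V. real (d (fst y)) * p)"
    using p0 by (intro sum_mono2) auto
  also have "\<dots> = sqsum n d b * p"
    by (subst sum_half_edges) (auto simp: sqsum_def sum_distrib_left power2_eq_square mult_ac)
  finally have "match_prob ?H M ?Ev \<le> sqsum n d b * p / m"
    using order_trans[OF less_imp_le[OF mU(2)] mU(1)] by (simp add: divide_right_mono)
  also have "\<dots> \<le> sqsum n d b * p / l"
    using mU p0 sqsum_nonneg[of n d b] by (intro divide_left_mono) auto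
  finally show ?case by (simp add: p_def l_def)
qed

text \<open>Injectivity of the path yields both requirements of \<open>chain\<close>: intermediate
  vertices are new, and the outgoing half-edge differs from the incoming one, since otherwise the
  path would turn back.\<close>

lemma chain_along_path:
  assumes inv: "\<sigma> \<in> matchings (half_edges n d)"
    and h: "\<And>i. i < J \<Longrightarrow> hh i \<in> half_edges n d \<and> fst (hh i) = f i \<and> fst (\<sigma> (hh i)) = f (Suc i)"
    and inj: "inj_on f {..J}"
    and "p + length bs < J" "\<And>i. i < length bs \<Longrightarrow> real (d (f (p + 1 + i))) \<le> bs ! i \<and> f (p + 1 + i) \<notin> W"
    and "\<sigma> (hh (p + length bs)) \<in> T"
  shows "chain d \<sigma> bs W (hh p) T"
  using assms(4-)
proof (induction bs arbitrary: p W)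
  case (Cons b bs)
  have pJ: "p < J" "p + 1 < J" using Cons.prems(1) by auto
  have f1: "fst (\<sigma> (hh p)) = f (Suc p)" using h[OF pJ(1)] by simp
  have hp: "hh (Suc p) \<in> half_edges n d" "fst (hh (Suc p)) = f (Suc p)" "fst (\<sigma> (hh (Suc p))) = f (Suc (Suc p))"
    using h[of "Suc p"] pJ by auto
  have g1: "hh (Suc p) \<in> hes d {f (Suc p)}" using hp by (cases "hh (Suc p)") (auto simp: half_edges_def)
  have g2: "hh (Suc p) \<noteq> \<sigma> (hh p)"
  proof
    assume "hh (Suc p) = \<sigma> (hh p)"
    then have "\<sigma> (hh (Suc p)) = hh p" using inv h[OF pJ(1)] by (auto simp: matchings_def)
    then have "f (Suc (Suc p)) = f p" using hp h[OF pJ(1)] by simp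
    then show False using inj_onD[OF inj, of "Suc (Suc p)" p] pJ by simp
  qed
  have "chain d \<sigma> bs (insert (f (Suc p)) W) (hh (Suc p)) T"
  proof (rule Cons.IH)
    show "Suc p + length bs < J" "\<sigma> (hh (Suc p + length bs)) \<in> T" using Cons.prems by auto
    fix i assume i: "i < length bs"
    have "real (d (f (p + 1 + Suc i))) \<le> (b # bs) ! Suc i \<and> f (p + 1 + Suc i) \<notin> W" using Cons.prems(2)[of "Suc i"] i by simp
    moreover have "f (Suc p + 1 + i) \<noteq> f (Suc p)"
      using inj_onD[OF inj, of "Suc p + 1 + i" "Suc p"] Cons.prems(1) i by auto
    ultimately show "real (d (f (Suc p + 1 + i))) \<le> bs ! i \<and> f (Suc p + 1 + i) \<notin> insert (f (Suc p)) W" by simp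
  qed
  then show ?case using Cons.prems(2)[of 0] f1 g1 g2 by auto
qed simp

text \<open>A geodesic between two balls either stays below the degree bound \<open>b Q\<close>, or, seen from one of its
  ends, has a first vertex \<open>i\<close> whose degree exceeds the truncation \<open>b i\<close>.\<close>
definition path_event :: "nat \<Rightarrow> (nat \<Rightarrow> nat) \<Rightarrow> nat set \<Rightarrow> (nat \<times> nat) set \<Rightarrow> (nat \<Rightarrow> real) \<Rightarrow> nat \<Rightarrow> nat \<Rightarrow> ((nat \<times> nat) \<Rightarrow> (nat \<times> nat)) set" where
  "path_event n d W S b Q m = (\<Union>h\<in>hes d W - S.
      (\<Union>i\<in>{..Q}. {\<sigma>. chain d \<sigma> (map b [0..<i]) W h {y \<in> half_edges n d. b i < real (d (fst y))}})
      \<union> (\<Union>l\<in>{..<m}. {\<sigma>. chain d \<sigma> (replicate l (b Q)) W h (hes d W)}))"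

text \<open>The least \<open>q\<close> at which the degree exceeds \<open>b q\<close> is taken: all
  earlier vertices obey their bounds and form the chain, and the exceeding vertex is its
  target.\<close>

lemma exceed_left:
  assumes inv: "\<sigma> \<in> matchings (half_edges n d)"
    and h: "\<And>i. i < J \<Longrightarrow> hh i \<in> half_edges n d \<and> fst (hh i) = f i \<and> fst (\<sigma> (hh i)) = f (Suc i)"
    and inj: "inj_on f {..J}"
    and W: "\<And>i. p < i \<Longrightarrow> i < J - p \<Longrightarrow> f i \<notin> W"
    and ex: "p < i" "i < J - p" "i - p - 1 \<le> Q" "b (i - p - 1) < real (d (f i))"
  shows "\<exists>i\<le>Q. chain d \<sigma> (map b [0..<i]) W (hh p) {y \<in> half_edges n d. b i < real (d (fst y))}"
proof -
  define P where "P = (\<lambda>q. p + 1 + q < J - p \<and> b q < real (d (f (p + 1 + q))))"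
  have "P (i - p - 1)" using ex by (simp add: P_def)
  define q where "q = (LEAST q. P q)"
  have q: "P q" "q \<le> i - p - 1" unfolding q_def using \<open>P (i - p - 1)\<close> by (auto intro: LeastI Least_le)
  have less: "\<not> P r" if "r < q" for r using that not_less_Least unfolding q_def by blast
  have "chain d \<sigma> (map b [0..<q]) W (hh p) {y \<in> half_edges n d. b q < real (d (fst y))}"
  proof (rule chain_along_path[OF inv h inj])
    show "p + length (map b [0..<q]) < J" using q(1) by (auto simp: P_def)
    fix r assume r: "r < length (map b [0..<q])"
    then show "real (d (f (p + 1 + r))) \<le> map b [0..<q] ! r \<and> f (p + 1 + r) \<notin> W"
      using less[of r] q(1) W[of "p + 1 + r"] by (auto simp: P_def)
  next
    have pq: "p + q < J" using q(1) by (auto simp: P_def)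
    have "\<sigma> (hh (p + q)) \<in> half_edges n d" using inv h[OF pq] by (auto simp: matchings_def)
    then show "\<sigma> (hh (p + length (map b [0..<q]))) \<in> {y \<in> half_edges n d. b q < real (d (fst y))}"
      using q(1) h[OF pq] by (simp add: P_def)
  qed auto
  then show ?thesis using q(2) ex(3) by (meson le_trans)
qed

text \<open>A shortest path is cut at distance \<open>Suc k\<close> from both ends. Minimality makes
  it injective and keeps its inner part outside both balls, so the first half-edge after the cut is
  not among the recorded pairs. The bound on \<open>m\<close> puts every inner vertex within
  \<open>Q\<close> levels of one end.\<close>

lemma path_event_mem:
  assumes s: "\<sigma> \<in> matchings (half_edges n d)" and uv: "u < n" "v < n"
    and far: "v \<notin> ball_at (cm_adj n d \<sigma>) u (2 * Suc k + 1)"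
    and near: "v \<in> ball_at (cm_adj n d \<sigma>) u (2 * Suc k + m)"
    and b: "\<And>i. i \<le> Q \<Longrightarrow> b i \<le> b Q" and m: "m \<le> 2 * Q + 2"
  shows "\<sigma> \<in> path_event n d (ball_at (cm_adj n d \<sigma>) u (Suc k) \<union> ball_at (cm_adj n d \<sigma>) v (Suc k))
     (Domain (local_matching n d k u \<sigma>) \<union> Domain (local_matching n d k v \<sigma>)) b Q m"
proof -
  let ?H = "half_edges n d" and ?E = "cm_adj n d \<sigma>"
  let ?p = "Suc k"
  define W where "W = ball_at ?E u ?p \<union> ball_at ?E v ?p"
  define S where "S = Domain (local_matching n d k u \<sigma>) \<union> Domain (local_matching n d k v \<sigma>)"
  have symE: "sym ?E" by (rule sym_cm_adj[OF s])
  define J where "J = (LEAST t. (u, v) \<in> ?E ^^ t)"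
  obtain t0 where t0: "t0 \<le> 2 * ?p + m" "(u, v) \<in> ?E ^^ t0" using near unfolding ball_at_relpow by blast
  have J: "(u, v) \<in> ?E ^^ J" unfolding J_def using t0(2) by (rule LeastI)
  have Jmin: "J \<le> t" if "(u, v) \<in> ?E ^^ t" for t unfolding J_def using that by (rule Least_le)
  have Jm: "J \<le> 2 * ?p + m" using Jmin[OF t0(2)] t0(1) by simp
  have Jl: "2 * ?p + 2 \<le> J"
  proof (rule ccontr)
    assume "\<not> 2 * ?p + 2 \<le> J"
    then have "J \<le> 2 * ?p + 1" by simp
    then show False using far J unfolding ball_at_relpow by blast
  qed
  obtain f where f: "f 0 = u" "f J = v" "\<And>i. i < J \<Longrightarrow> (f i, f (Suc i)) \<in> ?E"
    using J unfolding relpow_fun_conv by blast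
  have fi: "(f i, f j) \<in> ?E ^^ (j - i)" if "i \<le> j" "j \<le> J" for i j
    unfolding relpow_fun_conv by (rule exI[of _ "\<lambda>l. f (i + l)"]) (use f(3) that in auto)
  have du: "i \<le> t" if "(u, f i) \<in> ?E ^^ t" "i \<le> J" for i t
  proof -
    have "(f i, v) \<in> ?E ^^ (J - i)" using fi[of i J] that f(2) by simp
    then have "(u, v) \<in> ?E ^^ (t + (J - i))" using that(1) unfolding relpow_add by blast
    then show ?thesis using Jmin[of "t + (J - i)"] that(2) by simp
  qed
  have dv: "J - i \<le> t" if "(v, f i) \<in> ?E ^^ t" "i \<le> J" for i t
  proof -
    have "(u, f i) \<in> ?E ^^ i" using fi[of 0 i] that f(1) by simp
    moreover have "(f i, v) \<in> ?E ^^ t" using relpow_sym[OF symE that(1)] .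
    ultimately have "(u, v) \<in> ?E ^^ (i + t)" unfolding relpow_add by blast
    then show ?thesis using Jmin[of "i + t"] by simp
  qed
  have bu: "f i \<in> ball_at ?E u r \<Longrightarrow> i \<le> r" if "i \<le> J" for i r
    unfolding ball_at_relpow using du that by (meson le_trans)
  have bv: "f i \<in> ball_at ?E v r \<Longrightarrow> J - i \<le> r" if "i \<le> J" for i r
    unfolding ball_at_relpow using dv that by (meson le_trans)
  have inj: "inj_on f {..J}"
  proof (rule inj_onI)
    fix i j assume ij: "i \<in> {..J}" "j \<in> {..J}" "f i = f j"
    have "(u, f i) \<in> ?E ^^ i" "(u, f j) \<in> ?E ^^ j" using fi[of 0] ij f(1) by force+
    then show "i = j" using du[of i j] du[of j i] ij by auto
  qed
  have "\<exists>h. i < J \<longrightarrow> h \<in> ?H \<and> fst h = f i \<and> fst (\<sigma> h) = f (Suc i)" for i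
    using f(3)[of i] cm_adjE by metis
  then obtain hh where hh: "\<And>i. i < J \<Longrightarrow> hh i \<in> ?H \<and> fst (hh i) = f i \<and> fst (\<sigma> (hh i)) = f (Suc i)" by metis
  \<comment> \<open>The reversed path with the partner half-edges; the end at \<open>v\<close> is
    then covered by the same argument.\<close>
  define f' where "f' = (\<lambda>i. f (J - i))"
  define hh' where "hh' = (\<lambda>i. \<sigma> (hh (J - 1 - i)))"
  have inv: "\<sigma> a \<in> ?H" "\<sigma> (\<sigma> a) = a" if "a \<in> ?H" for a using s that by (auto simp: matchings_def)
  have hh': "hh' i \<in> ?H \<and> fst (hh' i) = f' i \<and> fst (\<sigma> (hh' i)) = f' (Suc i)" if "i < J" for i
  proof -
    have *: "J - 1 - i < J" "Suc (J - 1 - i) = J - i" "J - 1 - i = J - Suc i" using that by auto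
    have "hh (J - 1 - i) \<in> ?H \<and> fst (hh (J - 1 - i)) = f (J - Suc i) \<and> fst (\<sigma> (hh (J - 1 - i))) = f (J - i)"
      using hh[OF *(1)] * by simp
    then show ?thesis unfolding hh'_def f'_def using inv by simp
  qed
  have inj': "inj_on f' {..J}"
    unfolding f'_def by (rule inj_onI) (use inj_onD[OF inj] in \<open>force\<close>)
  have fW: "f i \<notin> W" if "?p < i" "i < J - ?p" for i
  proof -
    have *: "i \<le> J" "?p < J - i" using that by auto
    have "f i \<notin> ball_at ?E u ?p" using bu[OF *(1)] that(1) leD by blast
    moreover have "f i \<notin> ball_at ?E v ?p" using bv[OF *(1)] *(2) leD by blast
    ultimately show ?thesis unfolding W_def by blast
  qed
  have fW': "f' i \<notin> W" if "?p < i" "i < J - ?p" for i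
    unfolding f'_def using that by (intro fW) auto
  have inW: "f ?p \<in> W" "f (J - ?p) \<in> W"
  proof -
    have "(u, f ?p) \<in> ?E ^^ ?p" using fi[of 0 ?p] Jl f(1) by simp
    then show "f ?p \<in> W" unfolding W_def Un_iff ball_at_relpow by blast
    have "(f (J - ?p), v) \<in> ?E ^^ ?p" using fi[of "J - ?p" J] Jl f(2) by simp
    then have "(v, f (J - ?p)) \<in> ?E ^^ ?p" by (rule relpow_sym[OF symE])
    then show "f (J - ?p) \<in> W" unfolding W_def Un_iff ball_at_relpow by blast
  qed
  have notB: "f i \<notin> ball_at ?E u k \<and> f i \<notin> ball_at ?E v k" if "?p \<le> i" "i \<le> J - ?p" for i
  proof -
    have *: "i \<le> J" "k < J - i" "k < i" using that Jl by auto
    show ?thesis using bu[OF *(1)] bv[OF *(1)] *(2,3) leD by blast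
  qed
  have start: "hh ?p \<in> hes d W - S" "hh' ?p \<in> hes d W - S"
  proof -
    have 1: "a \<in> hes d W - S" if "a \<in> ?H" "fst a \<in> W" "fst a \<notin> ball_at ?E u k \<and> fst a \<notin> ball_at ?E v k"
        "fst (\<sigma> a) \<notin> ball_at ?E u k \<and> fst (\<sigma> a) \<notin> ball_at ?E v k" for a
      using that unfolding S_def Domain_local_matching by (cases a) (auto simp: half_edges_def)
    have pJ: "?p < J" using Jl by simp
    show "hh ?p \<in> hes d W - S" by (rule 1) (use hh[OF pJ] inW(1) notB[of ?p] notB[of "Suc ?p"] Jl in auto)
    show "hh' ?p \<in> hes d W - S" by (rule 1) (use hh'[OF pJ] inW(2) notB[of "J - ?p"] notB[of "J - Suc ?p"] Jl in \<open>auto simp: f'_def\<close>)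
  qed
  have "\<sigma> \<in> path_event n d W S b Q m"
  proof (cases "(\<exists>i. ?p < i \<and> i < J - ?p \<and> i - ?p - 1 \<le> Q \<and> b (i - ?p - 1) < real (d (f i))) \<or>
      (\<exists>i. ?p < i \<and> i < J - ?p \<and> i - ?p - 1 \<le> Q \<and> b (i - ?p - 1) < real (d (f' i)))")
    case True
    then obtain h where h: "h \<in> hes d W - S"
      "\<exists>i\<le>Q. chain d \<sigma> (map b [0..<i]) W h {y \<in> half_edges n d. b i < real (d (fst y))}"
    proof (elim disjE exE conjE)
      fix i assume "?p < i" "i < J - ?p" "i - ?p - 1 \<le> Q" "b (i - ?p - 1) < real (d (f i))"
      then have "\<exists>i\<le>Q. chain d \<sigma> (map b [0..<i]) W (hh ?p) {y \<in> half_edges n d. b i < real (d (fst y))}"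
        using fW by (intro exceed_left[OF s hh inj, of ?p W i]) auto
      then show thesis using that start by blast
    next
      fix i assume "?p < i" "i < J - ?p" "i - ?p - 1 \<le> Q" "b (i - ?p - 1) < real (d (f' i))"
      then have "\<exists>i\<le>Q. chain d \<sigma> (map b [0..<i]) W (hh' ?p) {y \<in> half_edges n d. b i < real (d (fst y))}"
        using fW' by (intro exceed_left[OF s hh' inj', of ?p W i]) auto
      then show thesis using that start by blast
    qed
    then show ?thesis unfolding path_event_def by blast
  next
    case False
    have bd: "real (d (f i)) \<le> b Q" if i: "?p < i" "i < J - ?p" for i
    proof (cases "i - ?p - 1 \<le> Q")
      case True
      then have "real (d (f i)) \<le> b (i - ?p - 1)" using False i by force
      then show ?thesis using b[OF True] by linarith
    next
      \<comment> \<open>Beyond level \<open>Q\<close> from the left means within level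
        \<open>Q\<close> from the right, because \<open>m \<le> 2 * Q + 2\<close>.\<close>
      case nQ: False
      define i' where "i' = J - i"
      have i': "?p < i'" "i' < J - ?p" "i' - ?p - 1 \<le> Q" "f' i' = f i"
        using i nQ Jm m by (auto simp: i'_def f'_def)
      then have "real (d (f' i')) \<le> b (i' - ?p - 1)" using False by force
      then show ?thesis using b[OF i'(3)] i'(4) by simp
    qed
    define l where "l = J - 2 * ?p - 1"
    have l: "l < m" "?p + l < J" "Suc (?p + l) = J - ?p" using Jl Jm by (auto simp: l_def)
    have "chain d \<sigma> (replicate l (b Q)) W (hh ?p) (hes d W)"
    proof (rule chain_along_path[OF s hh inj])
      show "?p + length (replicate l (b Q)) < J" using l by simp
      show "real (d (f (?p + 1 + i))) \<le> replicate l (b Q) ! i \<and> f (?p + 1 + i) \<notin> W" if "i < length (replicate l (b Q))" for i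
        using that bd[of "?p + 1 + i"] fW[of "?p + 1 + i"] l by auto
      have "\<sigma> (hh (?p + l)) \<in> ?H" "fst (\<sigma> (hh (?p + l))) \<in> W" using hh[OF l(2)] inv inW(2) l(3) by auto
      then show "\<sigma> (hh (?p + length (replicate l (b Q)))) \<in> hes d W"
        by (cases "\<sigma> (hh (?p + l))") (auto simp: half_edges_def)
    qed auto
    then show ?thesis unfolding path_event_def using start(1) l(1) by blast
  qed
  then show ?thesis unfolding W_def S_def .
qed

text \<open>Union bound over at most \<open>\<omega>\<close> starting half-edges, then over the
  index of the first excess, or over the length of a path that stays below \<open>b Q\<close> and
  ends in \<open>W\<close>.\<close>

lemma match_prob_path_event:
  assumes pm: "partial_matching (half_edges n d) M" and W: "Domain M \<subseteq> hes d W" "W \<subseteq> {..<n}"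
    and w: "real (card (hes d W)) \<le> \<omega>"
    and U: "card (Domain M) + 2 * max Q m + 1 \<le> U" "U < card (half_edges n d)"
    and l: "l = real (card (half_edges n d)) - real U"
  shows "match_prob (half_edges n d) M (path_event n d W (Domain M) b Q m) \<le>
    \<omega> * ((\<Sum>i\<le>Q. (\<Prod>j<i. sqsum n d (b j) / l) * (vol n d (b i) / l)) + (\<Sum>i<m. (sqsum n d (b Q) / l) ^ i * (\<omega> / l)))"
proof -
  let ?H = "half_edges n d"
  have l0: "l > 0" using U l by simp
  have finW: "finite W" using W(2) finite_subset by blast
  define B where "B = (\<Sum>i\<le>Q. (\<Prod>j<i. sqsum n d (b j) / l) * (vol n d (b i) / l)) + (\<Sum>i<m. (sqsum n d (b Q) / l) ^ i * (\<omega> / l))"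
  have w0: "\<omega> \<ge> 0" using w by linarith
  have B0: "B \<ge> 0" unfolding B_def using l0 w0
    by (intro add_nonneg_nonneg sum_nonneg mult_nonneg_nonneg prod_nonneg zero_le_power) (auto simp: sqsum_nonneg vol_nonneg)
  have h: "match_prob ?H M ((\<Union>i\<in>{..Q}. {\<sigma>. chain d \<sigma> (map b [0..<i]) W h {y \<in> ?H. b i < real (d (fst y))}})
      \<union> (\<Union>i\<in>{..<m}. {\<sigma>. chain d \<sigma> (replicate i (b Q)) W h (hes d W)})) \<le> B" if h: "h \<in> hes d W - Domain M" for h
  proof -
    have hW: "fst h \<in> W" using h by (auto simp: hes_def)
    have hH: "h \<in> ?H - Domain M" using h hes_subset[OF W(2)] by auto
    have 1: "match_prob ?H M {\<sigma>. chain d \<sigma> (map b [0..<i]) W h {y \<in> ?H. b i < real (d (fst y))}} \<le> (\<Prod>j<i. sqsum n d (b j) / l) * (vol n d (b i) / l)" if "i \<le> Q" for i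
    proof -
      have "{y \<in> ?H. b i < real (d (fst y))} = hes d {j. j < n \<and> b i < real (d j)}" by (auto simp: half_edges_def hes_def)
      then have c: "real (card {y \<in> ?H. b i < real (d (fst y))}) = vol n d (b i)" by (simp only: card_hes_vol)
      have "match_prob ?H M {\<sigma>. chain d \<sigma> (map b [0..<i]) W h {y \<in> ?H. b i < real (d (fst y))}} \<le>
         prod_list (map (\<lambda>b. sqsum n d b / l) (map b [0..<i])) * (real (card {y \<in> ?H. b i < real (d (fst y))}) / l)"
        unfolding l using that U by (intro match_prob_chain pm W hW hH) auto
      also have "prod_list (map (\<lambda>b. sqsum n d b / l) (map b [0..<i])) = (\<Prod>j<i. sqsum n d (b j) / l)"
        by (simp add: prod.list_conv_set_nth atLeast0LessThan)
      finally show ?thesis unfolding c .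
    qed
    have 2: "match_prob ?H M {\<sigma>. chain d \<sigma> (replicate i (b Q)) W h (hes d W)} \<le> (sqsum n d (b Q) / l) ^ i * (\<omega> / l)" if "i < m" for i
    proof -
      have "match_prob ?H M {\<sigma>. chain d \<sigma> (replicate i (b Q)) W h (hes d W)} \<le>
         prod_list (map (\<lambda>b. sqsum n d b / l) (replicate i (b Q))) * (real (card (hes d W)) / l)"
        unfolding l using that U hes_subset[OF W(2)] by (intro match_prob_chain pm W hW hH) auto
      also have "prod_list (map (\<lambda>b. sqsum n d b / l) (replicate i (b Q))) = (sqsum n d (b Q) / l) ^ i" by simp
      also have "(sqsum n d (b Q) / l) ^ i * (real (card (hes d W)) / l) \<le> (sqsum n d (b Q) / l) ^ i * (\<omega> / l)"
        using l0 w sqsum_nonneg[of n d "b Q"] by (intro mult_left_mono divide_right_mono zero_le_power) auto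
      finally show ?thesis .
    qed
    have "match_prob ?H M (\<Union>i\<in>{..Q}. {\<sigma>. chain d \<sigma> (map b [0..<i]) W h {y \<in> ?H. b i < real (d (fst y))}})
        \<le> (\<Sum>i\<le>Q. (\<Prod>j<i. sqsum n d (b j) / l) * (vol n d (b i) / l))"
      by (rule order_trans[OF match_prob_UN sum_mono]) (use 1 in auto)
    moreover have "match_prob ?H M (\<Union>i\<in>{..<m}. {\<sigma>. chain d \<sigma> (replicate i (b Q)) W h (hes d W)}) \<le> (\<Sum>i<m. (sqsum n d (b Q) / l) ^ i * (\<omega> / l))"
      by (rule order_trans[OF match_prob_UN sum_mono]) (use 2 in auto)
    ultimately show ?thesis unfolding B_def
      by (intro order_trans[OF match_prob_Un add_mono]) auto
  qed
  have "match_prob ?H M (path_event n d W (Domain M) b Q m) \<le> (\<Sum>h\<in>hes d W - Domain M. B)"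
    unfolding path_event_def using finW by (intro order_trans[OF match_prob_UN sum_mono] h) auto
  also have "\<dots> = real (card (hes d W - Domain M)) * B" by simp
  also have "\<dots> \<le> \<omega> * B"
  proof (rule mult_right_mono)
    have "card (hes d W - Domain M) \<le> card (hes d W)" using finW by (intro card_mono) auto
    then show "real (card (hes d W - Domain M)) \<le> \<omega>" using w by linarith
  qed (rule B0)
  finally show ?thesis by (simp add: B_def)
qed

section \<open>The second moment\<close>

lemma num_matchings_prod: "2 * j \<le> m \<Longrightarrow> real (num_matchings m) = (\<Prod>i<j. real m - 1 - 2 * real i) * real (num_matchings (m - 2 * j))"
proof (induction j)
  case (Suc j)
  define r where "r = m - 2 * Suc j"
  have r: "m - 2 * j = Suc (Suc r)" using Suc.prems by (simp add: r_def)
  have "real m = real r + 2 * real j + 2" using Suc.prems by (simp add: r_def of_nat_diff)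
  then have "real (num_matchings (m - 2 * j)) = (real m - 1 - 2 * real j) * real (num_matchings r)" unfolding r by (simp add: distrib_right)
  then show ?case using Suc by (simp add: r_def)
qed simp

text \<open>Compares fixing \<open>u\<close> and \<open>2 * j\<close> half-edges jointly with fixing
  them independently. The quotient is a product of \<open>j\<close> factors
  \<open>(l - 1 - 2 * i) / (l - u - 1 - 2 * i)\<close>, each at most
  \<open>l / (l - 2 * U)\<close>.\<close>

lemma num_matchings_ratio:
  fixes u j l U :: nat
  assumes "u \<le> U" "2 * j \<le> U" "2 * U < l"
  shows "real (num_matchings (l - u - 2 * j)) * real (num_matchings l) \<le> (real l / (real l - 2 * real U)) ^ U * (real (num_matchings (l - u)) * real (num_matchings (l - 2 * j)))"
proof -
  define \<rho> where "\<rho> = real l / (real l - 2 * real U)"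
  have \<rho>1: "\<rho> \<ge> 1" using assms by (simp add: \<rho>_def)
  let ?P = "\<lambda>m. \<Prod>i<j. real m - 1 - 2 * real i"
  have "?P l \<le> (\<Prod>i<j. \<rho> * (real (l - u) - 1 - 2 * real i))"
  proof (rule prod_mono)
    fix i assume i: "i \<in> {..<j}"
    define a where "a = real l - 1 - 2 * real i"
    have "1 + 2 * i \<le> U" using i assms by auto
    then have iU: "1 + 2 * real i \<le> real U" by linarith
    have uU: "real u \<le> real U" "2 * real U < real l" using assms by linarith+
    have a: "a \<ge> real l - real U" "a \<le> real l" using iU by (auto simp: a_def)
    have "a * (real l - 2 * real U) \<le> real l * (a - real u)"
    proof -
      have "real l * real u \<le> real l * real U" using uU by (intro mult_left_mono) auto
      moreover have "real l * real U \<le> 2 * a * real U"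
      proof -
        have "real l \<le> 2 * a" using a uU by linarith
        then show ?thesis by (intro mult_right_mono) auto
      qed
      ultimately show ?thesis by (simp add: algebra_simps)
    qed
    then have "a \<le> \<rho> * (a - real u)" using assms by (simp add: \<rho>_def field_simps)
    then show "0 \<le> real l - 1 - 2 * real i \<and> real l - 1 - 2 * real i \<le> \<rho> * (real (l - u) - 1 - 2 * real i)"
      using a uU assms by (auto simp: a_def of_nat_diff algebra_simps)
  qed
  also have "\<dots> = \<rho> ^ j * ?P (l - u)" by (simp add: prod.distrib)
  also have "\<dots> \<le> \<rho> ^ U * ?P (l - u)"
  proof (rule mult_right_mono)
    show "\<rho> ^ j \<le> \<rho> ^ U" using \<rho>1 assms by (intro power_increasing) auto
    have "2 * i + 1 + u \<le> l" if "i < j" for i using that assms by linarith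
    then show "0 \<le> ?P (l - u)" by (intro prod_nonneg) (force simp: of_nat_diff)
  qed
  finally have P: "?P l \<le> \<rho> ^ U * ?P (l - u)" .
  have 1: "real (num_matchings l) = ?P l * real (num_matchings (l - 2 * j))" using assms by (intro num_matchings_prod) auto
  have 2: "real (num_matchings (l - u)) = ?P (l - u) * real (num_matchings (l - u - 2 * j))" using assms by (intro num_matchings_prod) auto
  have "real (num_matchings (l - u - 2 * j)) * real (num_matchings (l - 2 * j)) * ?P l \<le> real (num_matchings (l - u - 2 * j)) * real (num_matchings (l - 2 * j)) * (\<rho> ^ U * ?P (l - u))"
    using P by (intro mult_left_mono) auto
  then show ?thesis unfolding 1 2 \<rho>_def[symmetric] by (simp add: mult_ac)
qed

text \<open>The possible values of the recorded pairs on the ball event, which is the disjoint union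
  of their sets of completions.\<close>

definition local_matchings :: "nat \<Rightarrow> (nat \<Rightarrow> nat) \<Rightarrow> nat \<Rightarrow> nat \<Rightarrow> nat \<Rightarrow> ((nat \<times> nat) \<times> (nat \<times> nat)) set set" where
  "local_matchings n d D k v = local_matching n d k v ` (matchings (half_edges n d) \<inter> min_degree_ball n d D (Suc k) v)"

lemma local_matchings_cover:
  assumes v: "v < n"
  shows "matchings (half_edges n d) \<inter> min_degree_ball n d D (Suc k) v = (\<Union>M\<in>local_matchings n d D k v. ext (half_edges n d) M)"
proof (intro equalityI subsetI)
  fix \<sigma> assume s: "\<sigma> \<in> matchings (half_edges n d) \<inter> min_degree_ball n d D (Suc k) v"
  then have "\<sigma> \<in> ext (half_edges n d) (local_matching n d k v \<sigma>)" by (intro local_matching_ext[OF v]) auto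
  then show "\<sigma> \<in> (\<Union>M\<in>local_matchings n d D k v. ext (half_edges n d) M)" using s unfolding local_matchings_def by blast
next
  fix \<tau> assume "\<tau> \<in> (\<Union>M\<in>local_matchings n d D k v. ext (half_edges n d) M)"
  then obtain \<sigma> where s: "\<sigma> \<in> matchings (half_edges n d)" "\<sigma> \<in> min_degree_ball n d D (Suc k) v"
    "\<tau> \<in> ext (half_edges n d) (local_matching n d k v \<sigma>)" unfolding local_matchings_def by blast
  have "ball_at (cm_adj n d \<tau>) v (Suc k) = ball_at (cm_adj n d \<sigma>) v (Suc k)"
    by (rule ball_at_local[OF v s(1) s(3)]) simp
  then have "\<tau> \<in> min_degree_ball n d D (Suc k) v" using s(2) unfolding min_degree_ball_def by simp
  then show "\<tau> \<in> matchings (half_edges n d) \<inter> min_degree_ball n d D (Suc k) v" using ext_matchings[OF s(3)] by simp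
qed

lemma finite_local_matchings: "finite (local_matchings n d D k v)"
  unfolding local_matchings_def by (intro finite_imageI) (simp add: finite_matchings)

lemma card_min_degree_ball:
  assumes v: "v < n"
  shows "card (matchings (half_edges n d) \<inter> min_degree_ball n d D (Suc k) v) = (\<Sum>M\<in>local_matchings n d D k v. card (ext (half_edges n d) M))"
  unfolding local_matchings_cover[OF v]
proof (rule card_UN_disjoint)
  show "\<forall>M\<in>local_matchings n d D k v. \<forall>M'\<in>local_matchings n d D k v. M \<noteq> M' \<longrightarrow> ext (half_edges n d) M \<inter> ext (half_edges n d) M' = {}"
  proof (intro ballI impI, rule ccontr)
    fix M M' assume M: "M \<in> local_matchings n d D k v" "M' \<in> local_matchings n d D k v" "M \<noteq> M'"
      "ext (half_edges n d) M \<inter> ext (half_edges n d) M' \<noteq> {}"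
    obtain \<tau> where t: "\<tau> \<in> ext (half_edges n d) M" "\<tau> \<in> ext (half_edges n d) M'" using M(4) by blast
    obtain \<sigma> \<sigma>' where s: "M = local_matching n d k v \<sigma>" "\<sigma> \<in> matchings (half_edges n d)"
      "M' = local_matching n d k v \<sigma>'" "\<sigma>' \<in> matchings (half_edges n d)" using M(1,2) unfolding local_matchings_def by blast
    have "local_matching n d k v \<tau> = M" "local_matching n d k v \<tau> = M'"
      using local_matching_local[OF v s(2) t(1)[unfolded s(1)]] local_matching_local[OF v s(4) t(2)[unfolded s(3)]] s by auto
    then show False using M(3) by simp
  qed
qed (auto simp: finite_local_matchings finite_ext)

lemma partial_matching_Un:
  assumes "partial_matching S M" "partial_matching S M'" "Domain M \<inter> Domain M' = {}"
  shows "partial_matching S (M \<union> M')"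
proof -
  have "sym (M \<union> M')" using assms unfolding partial_matching_def by (intro sym_Un) auto
  moreover have "irrefl (M \<union> M')" using assms unfolding partial_matching_def irrefl_def by blast
  moreover have "single_valued (M \<union> M')"
  proof (rule single_valuedI)
    fix a b c assume "(a, b) \<in> M \<union> M'" "(a, c) \<in> M \<union> M'"
    then show "b = c" using assms unfolding partial_matching_def single_valued_def by blast
  qed
  moreover have "Domain (M \<union> M') \<subseteq> S" using assms unfolding partial_matching_def by blast
  ultimately show ?thesis unfolding partial_matching_def by blast
qed

lemma card_ext_match_prob: "finite S \<Longrightarrow> real (card (ext S M \<inter> E)) = match_prob S M E * real (card (ext S M))"
  using card_mono[OF finite_ext[of S M], of "ext S M \<inter> E"] by (cases "card (ext S M) = 0") (auto simp: match_prob_def)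

lemma ext_Un: "ext S (M \<union> M') = ext S M \<inter> ext S M'"
  unfolding ext_def ball_Un Collect_conj_eq by auto

text \<open>Both ball events are split by their recorded pairs \<open>M\<close> and
  \<open>M'\<close>. On \<open>Ev\<close> the domains are disjoint, so the joint completions are
  those of \<open>M \<union> M'\<close>, whose number almost factorises; \<open>pb\<close> bounds
  the conditional probability of the connecting event \<open>PE\<close>. Summation over
  \<open>M\<close> and \<open>M'\<close> restores the product of the two probabilities.\<close>

lemma pair_bound:
  fixes pb :: real
  assumes u: "u < n" and v: "v < n" and ev: "even (card (half_edges n d))"
    and U: "\<And>M. M \<in> local_matchings n d D k u \<union> local_matchings n d D k v \<Longrightarrow> card (Domain M) \<le> U" "2 * U < card (half_edges n d)"
    and Ev: "\<And>\<sigma>. \<sigma> \<in> matchings (half_edges n d) \<Longrightarrow> \<sigma> \<in> min_degree_ball n d D (Suc k) u \<Longrightarrow> \<sigma> \<in> min_degree_ball n d D (Suc k) v \<Longrightarrow> \<sigma> \<in> Ev \<Longrightarrow>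
       Domain (local_matching n d k u \<sigma>) \<inter> Domain (local_matching n d k v \<sigma>) = {} \<and>
       \<sigma> \<in> PE (local_matching n d k u \<sigma>) (local_matching n d k v \<sigma>)"
    and pb: "\<And>M M'. M \<in> local_matchings n d D k u \<Longrightarrow> M' \<in> local_matchings n d D k v \<Longrightarrow> Domain M \<inter> Domain M' = {} \<Longrightarrow>
       partial_matching (half_edges n d) (M \<union> M') \<Longrightarrow> match_prob (half_edges n d) (M \<union> M') (PE M M') \<le> pb" "0 \<le> pb"
  shows "match_prob (half_edges n d) {} (min_degree_ball n d D (Suc k) u \<inter> min_degree_ball n d D (Suc k) v \<inter> Ev) \<le>
    pb * (real (card (half_edges n d)) / (real (card (half_edges n d)) - 2 * real U)) ^ U *
    (match_prob (half_edges n d) {} (min_degree_ball n d D (Suc k) u) * match_prob (half_edges n d) {} (min_degree_ball n d D (Suc k) v))"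
proof -
  let ?H = "half_edges n d" and ?Au = "min_degree_ball n d D (Suc k) u" and ?Av = "min_degree_ball n d D (Suc k) v"
  let ?Cu = "local_matchings n d D k u" and ?Cv = "local_matchings n d D k v"
  define l where "l = card ?H"
  define E where "E = (real l / (real l - 2 * real U)) ^ U"
  have E0: "E \<ge> 0" using U(2) by (simp add: E_def l_def)
  have pmu: "partial_matching ?H M" if "M \<in> ?Cu" for M using that local_matching_partial_matching[OF u] unfolding local_matchings_def by blast
  have pmv: "partial_matching ?H M" if "M \<in> ?Cv" for M using that local_matching_partial_matching[OF v] unfolding local_matchings_def by blast
  have fin: "finite ?Cu" "finite ?Cv" by (rule finite_local_matchings)+
  define G where "G = (\<lambda>M M'. if Domain M \<inter> Domain M' = {} then ext ?H (M \<union> M') \<inter> PE M M' else {})"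
  have sub: "matchings ?H \<inter> (?Au \<inter> ?Av \<inter> Ev) \<subseteq> (\<Union>MM\<in>?Cu \<times> ?Cv. G (fst MM) (snd MM))"
  proof
    fix \<sigma> assume s: "\<sigma> \<in> matchings ?H \<inter> (?Au \<inter> ?Av \<inter> Ev)"
    let ?M = "local_matching n d k u \<sigma>" and ?M' = "local_matching n d k v \<sigma>"
    have "?M \<in> ?Cu" "?M' \<in> ?Cv" using s unfolding local_matchings_def by blast+
    moreover have "\<sigma> \<in> ext ?H ?M" "\<sigma> \<in> ext ?H ?M'" using s local_matching_ext[OF u] local_matching_ext[OF v] by auto
    then have "\<sigma> \<in> ext ?H (?M \<union> ?M')" unfolding ext_Un by simp
    moreover have "Domain ?M \<inter> Domain ?M' = {} \<and> \<sigma> \<in> PE ?M ?M'" using Ev[of \<sigma>] s by blast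
    ultimately show "\<sigma> \<in> (\<Union>MM\<in>?Cu \<times> ?Cv. G (fst MM) (snd MM))"
      by (intro UN_I[of "(?M, ?M')"]) (auto simp: G_def)
  qed
  have G: "real (card (G M M')) * real (num_matchings l) \<le> pb * E * (real (card (ext ?H M)) * real (card (ext ?H M')))" if M: "M \<in> ?Cu" and M': "M' \<in> ?Cv" for M M'
  proof (cases "Domain M \<inter> Domain M' = {}")
    case False then show ?thesis using pb(2) E0 by (simp add: G_def)
  next
    case True
    have pm: "partial_matching ?H (M \<union> M')" by (rule partial_matching_Un[OF pmu[OF M] pmv[OF M'] True])
    have finD: "finite (Domain M)" "finite (Domain M')"
      using pmu[OF M] pmv[OF M'] finite_subset[of _ ?H] unfolding partial_matching_def by auto
    have cD: "card (Domain (M \<union> M')) = card (Domain M) + card (Domain M')"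
      unfolding Domain_Un_eq using finD True by (rule card_Un_disjoint)
    \<comment> \<open>\<open>Domain M'\<close> has even size because \<open>M'\<close> has a
      completion: an odd number of free half-edges would admit none.\<close>
    have "\<exists>\<sigma>. \<sigma> \<in> ext ?H M'" using M' local_matching_ext[OF v] unfolding local_matchings_def by blast
    then have "card (ext ?H M') \<noteq> 0" using finite_ext[of ?H M'] by auto
    then have "even (card ?H - card (Domain M'))" using card_ext[OF finite_half_edges pmv[OF M']] num_matchings_odd by metis
    moreover have "card (Domain M') \<le> card ?H" using card_free[OF _ pmv[OF M']] by simp
    ultimately have "even (card (Domain M'))" using ev by simp
    then obtain j where j: "card (Domain M') = 2 * j" by (elim evenE)
    have "real (card (G M M')) = match_prob ?H (M \<union> M') (PE M M') * real (num_matchings (l - card (Domain M) - 2 * j))"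
      using True card_ext_match_prob[of ?H "M \<union> M'" "PE M M'"] card_ext[OF _ pm] unfolding cD j by (simp add: G_def l_def)
    also have "\<dots> \<le> pb * real (num_matchings (l - card (Domain M) - 2 * j))"
      using pb(1)[OF M M' True pm] by (intro mult_right_mono) auto
    finally have "real (card (G M M')) * real (num_matchings l) \<le> pb * real (num_matchings (l - card (Domain M) - 2 * j)) * real (num_matchings l)"
      by (intro mult_right_mono) auto
    also have "\<dots> = pb * (real (num_matchings (l - card (Domain M) - 2 * j)) * real (num_matchings l))" by simp
    also have "\<dots> \<le> pb * (E * (real (num_matchings (l - card (Domain M))) * real (num_matchings (l - 2 * j))))"
      unfolding E_def using U(1)[of M] U(1)[of M'] M M' U(2) pb(2) j
      by (intro mult_left_mono num_matchings_ratio) (auto simp: l_def)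
    also have "\<dots> = pb * E * (real (card (ext ?H M)) * real (card (ext ?H M')))"
      using card_ext[OF _ pmu[OF M]] card_ext[OF _ pmv[OF M']] j by (simp add: l_def)
    finally show ?thesis .
  qed
  have mat: "card (matchings ?H) = num_matchings l" using card_ext[of ?H "{}"] by (simp add: l_def)
  have df0: "real (num_matchings l) > 0" using num_matchings_even_pos[OF ev] by (simp add: l_def)
  define N where "N = real (card (matchings ?H \<inter> (?Au \<inter> ?Av \<inter> Ev)))"
  have "card (matchings ?H \<inter> (?Au \<inter> ?Av \<inter> Ev)) \<le> card (\<Union>MM\<in>?Cu \<times> ?Cv. G (fst MM) (snd MM))"
    using sub fin by (intro card_mono finite_UN_I) (auto simp: G_def finite_ext)
  also have "\<dots> \<le> (\<Sum>MM\<in>?Cu \<times> ?Cv. card (G (fst MM) (snd MM)))" by (rule card_UN_le) (use fin in auto)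
  finally have "N \<le> real (\<Sum>MM\<in>?Cu \<times> ?Cv. card (G (fst MM) (snd MM)))" unfolding N_def by (simp only: of_nat_le_iff)
  then have "N * real (num_matchings l) \<le> (\<Sum>MM\<in>?Cu \<times> ?Cv. real (card (G (fst MM) (snd MM)))) * real (num_matchings l)"
    by (intro mult_right_mono) (simp_all only: of_nat_sum of_nat_0_le_iff)
  also have "\<dots> = (\<Sum>MM\<in>?Cu \<times> ?Cv. real (card (G (fst MM) (snd MM))) * real (num_matchings l))" by (rule sum_distrib_right)
  also have "\<dots> \<le> (\<Sum>MM\<in>?Cu \<times> ?Cv. pb * E * (real (card (ext ?H (fst MM))) * real (card (ext ?H (snd MM)))))"
    by (intro sum_mono G) auto
  also have "\<dots> = pb * E * ((\<Sum>M\<in>?Cu. real (card (ext ?H M))) * (\<Sum>M\<in>?Cv. real (card (ext ?H M))))"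
  proof -
    have "(\<Sum>MM\<in>?Cu \<times> ?Cv. real (card (ext ?H (fst MM))) * real (card (ext ?H (snd MM)))) =
        (\<Sum>M\<in>?Cu. real (card (ext ?H M))) * (\<Sum>M\<in>?Cv. real (card (ext ?H M)))"
      unfolding sum_product sum.cartesian_product by (simp add: case_prod_unfold)
    then show ?thesis by (simp only: sum_distrib_left[symmetric])
  qed
  also have "(\<Sum>M\<in>?Cu. real (card (ext ?H M))) = real (card (matchings ?H \<inter> ?Au))" by (simp add: card_min_degree_ball[OF u])
  also have "(\<Sum>M\<in>?Cv. real (card (ext ?H M))) = real (card (matchings ?H \<inter> ?Av))" by (simp add: card_min_degree_ball[OF v])
  finally have "N * real (num_matchings l) \<le> pb * E * (real (card (matchings ?H \<inter> ?Au)) * real (card (matchings ?H \<inter> ?Av)))" .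
  then have "N * real (num_matchings l) / (real (num_matchings l) * real (num_matchings l)) \<le> pb * E * (real (card (matchings ?H \<inter> ?Au)) * real (card (matchings ?H \<inter> ?Av))) / (real (num_matchings l) * real (num_matchings l))"
    using df0 by (intro divide_right_mono) auto
  then have "N / real (num_matchings l) \<le> pb * E * (real (card (matchings ?H \<inter> ?Au)) / real (num_matchings l) * (real (card (matchings ?H \<inter> ?Av)) / real (num_matchings l)))"
    using df0 by simp
  then show ?thesis unfolding match_prob_def ext_empty mat N_def E_def l_def .
qed

text \<open>Chebyshev and Markov in one: \<open>Y\<close> counts the events that occur,
  \<open>Z\<close> the pairs of them that satisfy \<open>Zt\<close>. On \<open>Bad\<close> one has
  \<open>Z = Y^2\<close>, and \<open>(Y - S)^2 + Y^2 \<ge> S^2 / 2\<close>, so either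
  \<open>Y\<close> is far from its mean or \<open>Z\<close> is of order \<open>S^2\<close>.\<close>

lemma second_moment:
  fixes A :: "nat \<Rightarrow> ('a \<Rightarrow> 'a) set"
  assumes fin: "finite X" and ne: "ext X M \<noteq> {}"
    and S: "S = (\<Sum>v<n. match_prob X M (A v))" "0 \<le> S"
    and bad: "\<And>\<sigma> u v. \<sigma> \<in> Bad \<Longrightarrow> u < n \<Longrightarrow> v < n \<Longrightarrow> \<sigma> \<in> A u \<Longrightarrow> \<sigma> \<in> A v \<Longrightarrow> \<sigma> \<in> Zt u v"
  shows "S^2 / 4 * match_prob X M Bad \<le> (\<Sum>u<n. \<Sum>v<n. match_prob X M (A u \<inter> A v)) - S^2 + (\<Sum>u<n. \<Sum>v<n. match_prob X M (A u \<inter> A v \<inter> Zt u v))"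
proof -
  let ?O = "ext X M"
  define N where "N = real (card ?O)"
  have finO: "finite ?O" by (rule finite_ext[OF fin])
  have N0: "N > 0" using ne finO by (simp add: N_def card_gt_0_iff)
  define I :: "('a \<Rightarrow> 'a) set \<Rightarrow> ('a \<Rightarrow> 'a) \<Rightarrow> real" where "I = (\<lambda>B \<sigma>. if \<sigma> \<in> B then 1 else 0)"
  have sumI: "(\<Sum>\<sigma>\<in>?O. I B \<sigma>) = N * match_prob X M B" for B
    using finO N0 by (simp add: I_def sum.If_cases match_prob_def N_def)
  define Y where "Y = (\<lambda>\<sigma>. \<Sum>v<n. I (A v) \<sigma>)"
  define Z where "Z = (\<lambda>\<sigma>. \<Sum>u<n. \<Sum>v<n. I (A u \<inter> A v \<inter> Zt u v) \<sigma>)"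
  have Y2: "Y \<sigma> ^ 2 = (\<Sum>u<n. \<Sum>v<n. I (A u \<inter> A v) \<sigma>)" for \<sigma>
  proof -
    have "I (A u) \<sigma> * I (A v) \<sigma> = I (A u \<inter> A v) \<sigma>" for u v by (simp add: I_def)
    then show ?thesis by (simp add: Y_def power2_eq_square sum_product)
  qed
  have point: "S^2 / 4 * I Bad \<sigma> \<le> (Y \<sigma> - S)^2 + Z \<sigma>" for \<sigma>
  proof -
    have Z0: "Z \<sigma> \<ge> 0" unfolding Z_def by (intro sum_nonneg) (simp add: I_def)
    show ?thesis
    proof (cases "\<sigma> \<in> Bad")
      case False then show ?thesis using Z0 by (simp add: I_def)
    next
      case True
      have "I (A u \<inter> A v \<inter> Zt u v) \<sigma> = I (A u \<inter> A v) \<sigma>" if "u < n" "v < n" for u v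
        using bad[OF True that] by (auto simp: I_def)
      then have ZY: "Z \<sigma> = Y \<sigma> ^ 2" unfolding Z_def Y2 by (intro sum.cong refl) auto
      have "S^2 / 4 \<le> (Y \<sigma> - S)^2 + Y \<sigma> ^ 2"
      proof -
        have "(Y \<sigma> - S)^2 + Y \<sigma> ^ 2 - S^2 / 2 = 2 * (Y \<sigma> - S / 2)^2" by (simp add: power2_eq_square algebra_simps)
        moreover have "0 \<le> 2 * (Y \<sigma> - S / 2)^2" "0 \<le> S^2" by simp_all
        ultimately show ?thesis by linarith
      qed
      then show ?thesis using True ZY by (simp add: I_def)
    qed
  qed
  have "N * (S^2 / 4 * match_prob X M Bad) = (\<Sum>\<sigma>\<in>?O. S^2 / 4 * I Bad \<sigma>)"
    unfolding sum_distrib_left[symmetric] sumI by simp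
  also have "\<dots> \<le> (\<Sum>\<sigma>\<in>?O. (Y \<sigma> - S)^2 + Z \<sigma>)" by (rule sum_mono) (rule point)
  also have "\<dots> = (\<Sum>\<sigma>\<in>?O. Y \<sigma> ^ 2) - 2 * S * (\<Sum>\<sigma>\<in>?O. Y \<sigma>) + N * S^2 + (\<Sum>\<sigma>\<in>?O. Z \<sigma>)"
    by (simp add: power2_diff sum.distrib sum_subtractf sum_distrib_left N_def mult_ac)
  also have "(\<Sum>\<sigma>\<in>?O. Y \<sigma>) = N * S"
    unfolding Y_def S(1) by (subst sum.swap) (simp add: sumI sum_distrib_left)
  also have "(\<Sum>\<sigma>\<in>?O. Y \<sigma> ^ 2) = N * (\<Sum>u<n. \<Sum>v<n. match_prob X M (A u \<inter> A v))"
    unfolding Y2 by (subst sum.swap, subst sum.swap[of _ _ ?O]) (simp add: sumI sum_distrib_left)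
  also have "(\<Sum>\<sigma>\<in>?O. Z \<sigma>) = N * (\<Sum>u<n. \<Sum>v<n. match_prob X M (A u \<inter> A v \<inter> Zt u v))"
    unfolding Z_def by (subst sum.swap, subst sum.swap[of _ _ ?O]) (simp add: sumI sum_distrib_left)
  finally have "N * (S^2 / 4 * match_prob X M Bad) \<le> N * ((\<Sum>u<n. \<Sum>v<n. match_prob X M (A u \<inter> A v)) - S^2 + (\<Sum>u<n. \<Sum>v<n. match_prob X M (A u \<inter> A v \<inter> Zt u v)))"
    by (simp add: algebra_simps power2_eq_square)
  then show ?thesis using N0 by simp
qed

lemma sum_card_swap:
  assumes "finite X"
  shows "(\<Sum>v<n. card (X \<inter> B v)) = (\<Sum>\<sigma>\<in>X. card {v. v < (n::nat) \<and> \<sigma> \<in> B v})"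
proof -
  have "card (X \<inter> B v) = (\<Sum>\<sigma>\<in>X. if \<sigma> \<in> B v then 1 else 0)" for v using assms by (simp add: sum.If_cases)
  moreover have "card {v. v < n \<and> \<sigma> \<in> B v} = (\<Sum>v<n. if \<sigma> \<in> B v then 1 else 0)" for \<sigma>
    by (simp add: sum.If_cases Int_def)
  ultimately show ?thesis using sum.swap[of "\<lambda>v \<sigma>. if \<sigma> \<in> B v then 1 else (0::nat)" X "{..<n}"] by simp
qed

lemma local_matchings_size:
  assumes v: "v < n" and M: "M \<in> local_matchings n d D k v" and pos: "\<forall>x<n. 1 \<le> d x"
  shows "card (Domain M) \<le> D * (D + 1) ^ Suc k" "card (hes d (fst ` Domain M)) \<le> D * (D + 1) ^ Suc k"
    "fst ` Domain M \<subseteq> {..<n}" "Domain M \<subseteq> hes d (fst ` Domain M)"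
proof -
  obtain \<sigma> where s: "\<sigma> \<in> matchings (half_edges n d)" "\<sigma> \<in> min_degree_ball n d D (Suc k) v" "M = local_matching n d k v \<sigma>"
    using M unfolding local_matchings_def by blast
  let ?B = "ball_at (cm_adj n d \<sigma>) v (Suc k)"
  have f: "fst ` Domain M = ?B" unfolding s(3) by (rule fst_Domain_local_matching[OF v s(1)]) (use pos in blast)
  have B: "?B \<subseteq> {..<n}" by (rule ball_at_lt[OF v])
  have finB: "finite ?B" by (rule finite_subset[OF B finite_lessThan])
  have D: "d x = D" if "x \<in> ?B" for x using s(2) that unfolding min_degree_ball_def by blast
  have "card (hes d ?B) = (\<Sum>i\<in>?B. D)" using finB D by (simp add: card_hes del: ball_at.simps)
  then have c: "card (hes d ?B) \<le> D * (D + 1) ^ Suc k"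
    using mult_le_mono2[OF card_ball_at[OF v s(2)], of D] by (simp del: ball_at.simps add: mult.commute)
  show "card (hes d (fst ` Domain M)) \<le> D * (D + 1) ^ Suc k" unfolding f by (rule c)
  show "fst ` Domain M \<subseteq> {..<n}" unfolding f by (rule B)
  have sub: "Domain M \<subseteq> hes d ?B" unfolding s(3) by (rule Domain_local_matching_subset[OF v s(1)])
  then show "Domain M \<subseteq> hes d (fst ` Domain M)" unfolding f .
  show "card (Domain M) \<le> D * (D + 1) ^ Suc k" using card_mono[OF finite_hes[OF finB] sub] c by (rule order_trans)
qed

text \<open>Pairs of good vertices are split by distance. Those within \<open>2 * Suc k + 1\<close>
  are few by \<open>card_near\<close>; the others have disjoint recorded pairs. Then
  \<open>E - 1\<close> controls the variance and \<open>pb * E\<close> the pairs joined by a path of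
  length at most \<open>2 * Suc k + m\<close>. Near pairs enter both sums, hence the factor
  \<open>8\<close>.\<close>

lemma no_distant_pair_bound:
  fixes n D k m Q U0 U :: nat and d :: "nat \<Rightarrow> nat" and b :: "nat \<Rightarrow> real"
  assumes pos: "\<And>x. x < n \<Longrightarrow> 1 \<le> d x" and ev: "even (card (half_edges n d))"
    and U0: "U0 = D * (D + 1) ^ Suc k" and U: "U = 2 * U0 + 2 * max Q m + 1" "U < card (half_edges n d)"
    and b: "\<And>i. i \<le> Q \<Longrightarrow> b i \<le> b Q" and m: "m \<le> 2 * Q + 2"
    and l: "l = real (card (half_edges n d)) - real U"
    and w: "\<omega> = 2 * real U0"
    and pb: "pb = \<omega> * ((\<Sum>i\<le>Q. (\<Prod>j<i. sqsum n d (b j) / l) * (vol n d (b i) / l)) + (\<Sum>i<m. (sqsum n d (b Q) / l) ^ i * (\<omega> / l)))"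
    and E: "E = (real (card (half_edges n d)) / (real (card (half_edges n d)) - 2 * real U0)) ^ U0"
    and S: "S = (\<Sum>v<n. match_prob (half_edges n d) {} (min_degree_ball n d D (Suc k) v))" "0 < S"
  shows "match_prob (half_edges n d) {} {\<sigma>. \<forall>u<n. \<forall>v<n. \<sigma> \<in> min_degree_ball n d D (Suc k) u \<longrightarrow> \<sigma> \<in> min_degree_ball n d D (Suc k) v
      \<longrightarrow> v \<in> ball_at (cm_adj n d \<sigma>) u (2 * Suc k + m)}
    \<le> 4 * (E - 1 + pb * E) + 8 * real ((D + 1) ^ (2 * Suc k + 1)) / S"
proof -
  let ?H = "half_edges n d" and ?k = "Suc k"
  define A where "A = min_degree_ball n d D ?k"
  define Nr where "Nr = (\<lambda>u v. {\<sigma>. v \<in> ball_at (cm_adj n d \<sigma>) u (2 * ?k + 1)})"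
  define Zt where "Zt = (\<lambda>u v. {\<sigma>. v \<in> ball_at (cm_adj n d \<sigma>) u (2 * ?k + m)})"
  define a where "a = (\<lambda>v. match_prob ?H {} (A v))"
  define Bn where "Bn = (D + 1) ^ (2 * ?k + 1)"
  have Sa: "S = (\<Sum>v<n. a v)" by (simp add: S(1) a_def A_def)
  have pos': "\<forall>x<n. 1 \<le> d x" using pos by blast
  have l0: "l > 0" using U l by simp
  have pb0: "pb \<ge> 0" unfolding pb w using l0
    by (intro mult_nonneg_nonneg add_nonneg_nonneg sum_nonneg prod_nonneg zero_le_power) (auto simp: sqsum_nonneg vol_nonneg)
  have U2: "2 * U0 < card ?H" using U by simp
  have disj: "Domain (local_matching n d k u \<sigma>) \<inter> Domain (local_matching n d k v \<sigma>) = {}"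
    if "u < n" "v < n" "\<sigma> \<in> matchings ?H" "\<sigma> \<notin> Nr u v" for u v \<sigma>
  proof (rule ccontr)
    assume "Domain (local_matching n d k u \<sigma>) \<inter> Domain (local_matching n d k v \<sigma>) \<noteq> {}"
    then obtain x where x: "x \<in> Domain (local_matching n d k u \<sigma>)" "x \<in> Domain (local_matching n d k v \<sigma>)" by blast
    have "fst x \<in> ball_at (cm_adj n d \<sigma>) u ?k" "fst x \<in> ball_at (cm_adj n d \<sigma>) v ?k"
      using subsetD[OF Domain_local_matching_subset[OF that(1,3)] x(1)] subsetD[OF Domain_local_matching_subset[OF that(2,3)] x(2)]
      unfolding hes_def by (auto simp del: ball_at.simps)
    then obtain t t' where t: "t \<le> ?k" "(u, fst x) \<in> cm_adj n d \<sigma> ^^ t" "t' \<le> ?k" "(v, fst x) \<in> cm_adj n d \<sigma> ^^ t'"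
      unfolding ball_at_relpow by blast
    have "(fst x, v) \<in> cm_adj n d \<sigma> ^^ t'" using relpow_sym[OF sym_cm_adj[OF that(3)] t(4)] .
    then have "(u, v) \<in> cm_adj n d \<sigma> ^^ (t + t')" using t(2) unfolding relpow_add by blast
    moreover have "t + t' \<le> 2 * ?k + 1" using t by simp
    ultimately have "v \<in> ball_at (cm_adj n d \<sigma>) u (2 * ?k + 1)" unfolding ball_at_relpow by blast
    then show False using that(4) by (simp add: Nr_def)
  qed
  have sz: "card (Domain M) \<le> U0" if "u < n" "v < n" "M \<in> local_matchings n d D k u \<union> local_matchings n d D k v" for u v M
    using that(3) local_matchings_size(1)[OF that(1) _ pos', of M D k] local_matchings_size(1)[OF that(2) _ pos', of M D k]
    unfolding U0 by (elim UnE)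
  have far: "match_prob ?H {} (A u \<inter> A v \<inter> - Nr u v) \<le> E * (a u * a v)" if uv: "u < n" "v < n" for u v
  proof -
    have "match_prob ?H {} (min_degree_ball n d D ?k u \<inter> min_degree_ball n d D ?k v \<inter> - Nr u v) \<le>
      1 * (real (card ?H) / (real (card ?H) - 2 * real U0)) ^ U0 * (match_prob ?H {} (min_degree_ball n d D ?k u) * match_prob ?H {} (min_degree_ball n d D ?k v))"
      by (rule pair_bound[where PE = "\<lambda>_ _. UNIV", OF uv ev sz[OF uv] U2]) (use disj[OF uv] in \<open>auto simp: match_prob_le1\<close>)
    then show ?thesis by (simp add: A_def a_def E)
  qed
  have farZ: "match_prob ?H {} (A u \<inter> A v \<inter> (Zt u v - Nr u v)) \<le> pb * E * (a u * a v)" if uv: "u < n" "v < n" for u v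
  proof -
    \<comment> \<open>The balls are recovered from \<open>M\<close> and \<open>M'\<close> as the
      vertices of their domains, since \<open>PE\<close> may not depend on
      \<open>\<sigma>\<close>.\<close>
    define PE where "PE = (\<lambda>M M' :: ((nat \<times> nat) \<times> (nat \<times> nat)) set. path_event n d (fst ` Domain M \<union> fst ` Domain M') (Domain (M \<union> M')) b Q m)"
    have "match_prob ?H {} (min_degree_ball n d D ?k u \<inter> min_degree_ball n d D ?k v \<inter> (Zt u v - Nr u v)) \<le>
      pb * (real (card ?H) / (real (card ?H) - 2 * real U0)) ^ U0 * (match_prob ?H {} (min_degree_ball n d D ?k u) * match_prob ?H {} (min_degree_ball n d D ?k v))"
    proof (rule pair_bound[where PE = PE, OF uv ev sz[OF uv] U2])
      fix \<sigma> assume s: "\<sigma> \<in> matchings ?H" "\<sigma> \<in> Zt u v - Nr u v"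
      have "\<sigma> \<in> path_event n d (ball_at (cm_adj n d \<sigma>) u (Suc k) \<union> ball_at (cm_adj n d \<sigma>) v (Suc k))
         (Domain (local_matching n d k u \<sigma>) \<union> Domain (local_matching n d k v \<sigma>)) b Q m"
        using s(2) b m unfolding Zt_def Nr_def by (intro path_event_mem[OF s(1) uv]) (auto simp del: ball_at.simps)
      moreover have fu: "fst ` Domain (local_matching n d k u \<sigma>) = ball_at (cm_adj n d \<sigma>) u (Suc k)"
        by (rule fst_Domain_local_matching[OF uv(1) s(1)]) (rule pos)
      moreover have fv: "fst ` Domain (local_matching n d k v \<sigma>) = ball_at (cm_adj n d \<sigma>) v (Suc k)"
        by (rule fst_Domain_local_matching[OF uv(2) s(1)]) (rule pos)
      ultimately have "\<sigma> \<in> PE (local_matching n d k u \<sigma>) (local_matching n d k v \<sigma>)"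
        unfolding PE_def Domain_Un_eq by (simp only:)
      moreover have "\<sigma> \<notin> Nr u v" using s(2) by blast
      ultimately show "Domain (local_matching n d k u \<sigma>) \<inter> Domain (local_matching n d k v \<sigma>) = {} \<and>
          \<sigma> \<in> PE (local_matching n d k u \<sigma>) (local_matching n d k v \<sigma>)" using disj[OF uv s(1)] by simp
    next
      fix M M' assume M: "M \<in> local_matchings n d D k u" "M' \<in> local_matchings n d D k v" "partial_matching ?H (M \<union> M')"
      note sM = local_matchings_size[OF uv(1) M(1) pos'] and sM' = local_matchings_size[OF uv(2) M(2) pos']
      let ?W = "fst ` Domain M \<union> fst ` Domain M'"
      have hW: "hes d ?W = hes d (fst ` Domain M) \<union> hes d (fst ` Domain M')" unfolding hes_def by blast
      show "match_prob ?H (M \<union> M') (PE M M') \<le> pb"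
        unfolding PE_def pb
      proof (rule match_prob_path_event[OF M(3) _ _ _ _ U(2) l])
        show "Domain (M \<union> M') \<subseteq> hes d ?W" unfolding hW Domain_Un_eq using sM(4) sM'(4) by blast
        show "?W \<subseteq> {..<n}" using sM(3) sM'(3) by blast
        have "card (hes d ?W) \<le> U0 + U0" unfolding hW U0
          using card_Un_le[of "hes d (fst ` Domain M)" "hes d (fst ` Domain M')"] sM(2) sM'(2) by linarith
        then show "real (card (hes d ?W)) \<le> \<omega>" unfolding w by simp
        have "card (Domain (M \<union> M')) \<le> U0 + U0" unfolding Domain_Un_eq U0
          using card_Un_le[of "Domain M" "Domain M'"] sM(1) sM'(1) by linarith
        then show "card (Domain (M \<union> M')) + 2 * max Q m + 1 \<le> U" using U(1) by simp
      qed
    qed (use pb0 in auto)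
    then show ?thesis by (simp add: A_def a_def E)
  qed
  have near: "(\<Sum>u<n. \<Sum>v<n. match_prob ?H {} (A u \<inter> A v \<inter> Nr u v)) \<le> real Bn * S"
  proof -
    have "(\<Sum>v<n. match_prob ?H {} (A u \<inter> A v \<inter> Nr u v)) \<le> real Bn * a u" if u: "u < n" for u
    proof -
      let ?X = "matchings ?H \<inter> A u"
      have fX: "finite ?X" by (simp add: finite_matchings)
      have "(\<Sum>v<n. card (?X \<inter> (A v \<inter> Nr u v))) = (\<Sum>\<sigma>\<in>?X. card {v. v < n \<and> \<sigma> \<in> A v \<inter> Nr u v})"
        by (rule sum_card_swap[OF fX])
      also have "\<dots> \<le> (\<Sum>\<sigma>\<in>?X. Bn)"
      proof (rule sum_mono)
        fix \<sigma> assume s: "\<sigma> \<in> ?X"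
        have "{v. v < n \<and> \<sigma> \<in> A v \<inter> Nr u v} = {v. v < n \<and> \<sigma> \<in> min_degree_ball n d D ?k v \<and> v \<in> ball_at (cm_adj n d \<sigma>) u (2 * ?k + 1)}"
          unfolding A_def Nr_def by blast
        then show "card {v. v < n \<and> \<sigma> \<in> A v \<inter> Nr u v} \<le> Bn"
          using card_near[OF u, of \<sigma> d D ?k] s unfolding Bn_def A_def by simp
      qed
      finally have c: "(\<Sum>v<n. card (?X \<inter> (A v \<inter> Nr u v))) \<le> Bn * card ?X" by (simp add: mult.commute)
      have "(\<Sum>v<n. match_prob ?H {} (A u \<inter> A v \<inter> Nr u v)) = real (\<Sum>v<n. card (?X \<inter> (A v \<inter> Nr u v))) / real (card (matchings ?H))"
        unfolding match_prob_def ext_empty of_nat_sum sum_divide_distrib by (simp only: Int_assoc)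
      also have "\<dots> \<le> real (Bn * card ?X) / real (card (matchings ?H))"
        using c by (intro divide_right_mono) (simp_all only: of_nat_le_iff of_nat_0_le_iff)
      also have "\<dots> = real Bn * a u" by (simp add: a_def match_prob_def)
      finally show ?thesis .
    qed
    then have "(\<Sum>u<n. \<Sum>v<n. match_prob ?H {} (A u \<inter> A v \<inter> Nr u v)) \<le> (\<Sum>u<n. real Bn * a u)" by (intro sum_mono) auto
    then show ?thesis by (simp add: Sa sum_distrib_left)
  qed
  have SS: "(\<Sum>u<n. \<Sum>v<n. c * (a u * a v)) = c * S^2" for c
    unfolding Sa power2_eq_square sum_product by (simp add: sum_distrib_left)
  have ne: "ext ?H {} \<noteq> {}"
    using card_ext[of ?H "{}"] num_matchings_even_pos[OF ev] by (metis card.empty card_ext finite_half_edges less_irrefl Domain_empty diff_zero partial_matching_empty)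
  let ?Bad = "{\<sigma>. \<forall>u<n. \<forall>v<n. \<sigma> \<in> min_degree_ball n d D ?k u \<longrightarrow> \<sigma> \<in> min_degree_ball n d D ?k v
      \<longrightarrow> v \<in> ball_at (cm_adj n d \<sigma>) u (2 * ?k + m)}"
  have s0: "0 \<le> S" using S(2) by simp
  have "S^2 / 4 * match_prob ?H {} ?Bad \<le> (\<Sum>u<n. \<Sum>v<n. match_prob ?H {} (A u \<inter> A v)) - S^2 + (\<Sum>u<n. \<Sum>v<n. match_prob ?H {} (A u \<inter> A v \<inter> Zt u v))"
    by (rule second_moment[OF _ ne Sa[unfolded a_def] s0]) (auto simp: A_def Zt_def simp del: ball_at.simps)
  also have "(\<Sum>u<n. \<Sum>v<n. match_prob ?H {} (A u \<inter> A v)) \<le> (\<Sum>u<n. \<Sum>v<n. E * (a u * a v) + match_prob ?H {} (A u \<inter> A v \<inter> Nr u v))"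
  proof (intro sum_mono)
    fix u v assume uv: "u \<in> {..<n}" "v \<in> {..<n}"
    have "match_prob ?H {} (A u \<inter> A v) \<le> match_prob ?H {} ((A u \<inter> A v \<inter> - Nr u v) \<union> (A u \<inter> A v \<inter> Nr u v))" by (intro match_prob_mono) auto
    also have "\<dots> \<le> match_prob ?H {} (A u \<inter> A v \<inter> - Nr u v) + match_prob ?H {} (A u \<inter> A v \<inter> Nr u v)" by (rule match_prob_Un) simp
    finally show "match_prob ?H {} (A u \<inter> A v) \<le> E * (a u * a v) + match_prob ?H {} (A u \<inter> A v \<inter> Nr u v)" using far[of u v] uv by simp
  qed
  also have "(\<Sum>u<n. \<Sum>v<n. match_prob ?H {} (A u \<inter> A v \<inter> Zt u v)) \<le> (\<Sum>u<n. \<Sum>v<n. pb * E * (a u * a v) + match_prob ?H {} (A u \<inter> A v \<inter> Nr u v))"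
  proof (intro sum_mono)
    fix u v assume uv: "u \<in> {..<n}" "v \<in> {..<n}"
    have "match_prob ?H {} (A u \<inter> A v \<inter> Zt u v) \<le> match_prob ?H {} ((A u \<inter> A v \<inter> (Zt u v - Nr u v)) \<union> (A u \<inter> A v \<inter> Nr u v))" by (intro match_prob_mono) auto
    also have "\<dots> \<le> match_prob ?H {} (A u \<inter> A v \<inter> (Zt u v - Nr u v)) + match_prob ?H {} (A u \<inter> A v \<inter> Nr u v)" by (rule match_prob_Un) simp
    finally show "match_prob ?H {} (A u \<inter> A v \<inter> Zt u v) \<le> pb * E * (a u * a v) + match_prob ?H {} (A u \<inter> A v \<inter> Nr u v)" using farZ[of u v] uv by simp
  qed
  finally have "S^2 / 4 * match_prob ?H {} ?Bad \<le> (E * S^2 + real Bn * S) - S^2 + (pb * E * S^2 + real Bn * S)"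
    using near unfolding sum.distrib SS by linarith
  also have "\<dots> = S^2 / 4 * (4 * (E - 1 + pb * E) + 8 * real Bn / S)" using S(2) by (simp add: field_simps power2_eq_square)
  finally have "match_prob ?H {} ?Bad \<le> 4 * (E - 1 + pb * E) + 8 * real Bn / S"
    by (rule mult_left_le_imp_le) (use S(2) in simp)
  then show ?thesis by (simp only: Bn_def)
qed

section \<open>The lower bound\<close>

text \<open>Splits the square as \<open>d powr (1 - s) * d powr (1 + s)\<close> and bounds the first
  factor by the truncation. One moment bound thus serves both for this quantity and for
  \<open>vol\<close>.\<close>

lemma sqsum_le_moment:
  assumes mom: "(\<Sum>i<n. real (d i) powr (1 + s)) \<le> C * real n" and b: "b > 0" and s: "0 < s" "s < 1"
  shows "sqsum n d b \<le> b powr (1 - s) * (C * real n)"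
proof -
  have "sqsum n d b \<le> (\<Sum>i\<in>{i. i < n \<and> real (d i) \<le> b}. b powr (1 - s) * real (d i) powr (1 + s))"
    unfolding sqsum_def
  proof (rule sum_mono)
    fix i assume i: "i \<in> {i. i < n \<and> real (d i) \<le> b}"
    show "real (d i) ^ 2 \<le> b powr (1 - s) * real (d i) powr (1 + s)"
    proof (cases "d i = 0")
      case False
      then have p: "real (d i) > 0" by simp
      have "real (d i) ^ 2 = real (d i) powr (1 - s) * real (d i) powr (1 + s)"
        using p by (simp add: powr_add[symmetric])
      also have "\<dots> \<le> b powr (1 - s) * real (d i) powr (1 + s)"
        using i p s by (intro mult_right_mono powr_mono2) auto
      finally show ?thesis .
    qed simp
  qed
  also have "\<dots> = b powr (1 - s) * (\<Sum>i\<in>{i. i < n \<and> real (d i) \<le> b}. real (d i) powr (1 + s))" by (simp add: sum_distrib_left)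
  also have "\<dots> \<le> b powr (1 - s) * (\<Sum>i<n. real (d i) powr (1 + s))"
    by (intro mult_left_mono sum_mono2) auto
  also have "\<dots> \<le> b powr (1 - s) * (C * real n)" using mom by (intro mult_left_mono) auto
  finally show ?thesis .
qed

lemma vol_le_moment:
  assumes mom: "(\<Sum>i<n. real (d i) powr (1 + s)) \<le> C * real n" and b: "b > 0" and s: "0 < s"
  shows "vol n d b \<le> b powr (- s) * (C * real n)"
proof -
  have "vol n d b \<le> (\<Sum>i\<in>{i. i < n \<and> b < real (d i)}. b powr (- s) * real (d i) powr (1 + s))"
    unfolding vol_def
  proof (rule sum_mono)
    fix i assume i: "i \<in> {i. i < n \<and> b < real (d i)}"
    then have p: "real (d i) > 0" using b by auto
    have "real (d i) = real (d i) powr (- s) * real (d i) powr (1 + s)" using p by (simp add: powr_add[symmetric])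
    also have "\<dots> \<le> b powr (- s) * real (d i) powr (1 + s)"
      using i b s by (intro mult_right_mono powr_mono2') auto
    finally show "real (d i) \<le> b powr (- s) * real (d i) powr (1 + s)" .
  qed
  also have "\<dots> = b powr (- s) * (\<Sum>i\<in>{i. i < n \<and> b < real (d i)}. real (d i) powr (1 + s))" by (simp add: sum_distrib_left)
  also have "\<dots> \<le> b powr (- s) * (\<Sum>i<n. real (d i) powr (1 + s))"
    by (intro mult_left_mono sum_mono2) auto
  also have "\<dots> \<le> b powr (- s) * (C * real n)" using mom by (intro mult_left_mono) auto
  finally show ?thesis .
qed

text \<open>With \<open>b j = exp (a * lm ^ j)\<close> and \<open>lm > 1 / s\<close>, the expected number of paths with degrees below
  \<open>b 0, \<dots>, b (i - 1)\<close> is too small to meet a vertex of degree above \<open>b i\<close>.\<close>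
lemma truncated_path_weight:
  fixes b :: "nat \<Rightarrow> real"
  assumes s: "0 < s" "s < 1" and lam: "1 / s < lm" and a: "0 \<le> a" and C2: "0 \<le> C2"
    and b: "b = (\<lambda>j. exp (a * lm ^ j))"
  shows "(\<Prod>j<i. C2 * b j powr (1 - s)) * (C2 * b i powr (- s)) \<le> C2 ^ Suc i * exp (- (s - (1 - s) / (lm - 1)) * a)"
proof -
  have l1: "lm > 1" using lam s by (smt (verit) less_divide_eq_1_pos)
  \<comment> \<open>Positive precisely because \<open>lm > 1 / s\<close>: the rate by which the gain
    \<open>b i powr (- s)\<close> outweighs the product of the earlier
    \<open>b j powr (1 - s)\<close>.\<close>
  define c0 where "c0 = s - (1 - s) / (lm - 1)"
  have c00: "c0 > 0"
  proof -
    have "1 < lm * s" using lam s by (simp add: field_simps)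
    then have "1 - s < s * (lm - 1)" by (simp add: algebra_simps)
    then show ?thesis using l1 by (simp add: c0_def field_simps)
  qed
  have geo: "(\<Sum>j<i. lm ^ j) = (lm ^ i - 1) / (lm - 1)" using l1 by (simp add: geometric_sum)
  have "(\<Prod>j<i. C2 * b j powr (1 - s)) = C2 ^ i * (\<Prod>j<i. exp ((1 - s) * (a * lm ^ j)))"
    by (simp add: prod.distrib b powr_def)
  also have "(\<Prod>j<i. exp ((1 - s) * (a * lm ^ j))) = exp ((1 - s) * a * (\<Sum>j<i. lm ^ j))"
    by (simp add: exp_sum[symmetric] sum_distrib_left mult_ac)
  finally have 1: "(\<Prod>j<i. C2 * b j powr (1 - s)) * (C2 * b i powr (- s)) = C2 ^ Suc i * exp ((1 - s) * a * ((lm ^ i - 1) / (lm - 1)) - s * (a * lm ^ i))"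
    unfolding geo by (simp add: b powr_def exp_diff exp_minus field_simps)
  have "(1 - s) * a * ((lm ^ i - 1) / (lm - 1)) - s * (a * lm ^ i) = - (c0 * a * lm ^ i) - (1 - s) * a / (lm - 1)"
    unfolding c0_def divide_inverse by (simp add: algebra_simps)
  also have "\<dots> \<le> - (c0 * a * lm ^ i)" using s a l1 by simp
  also have "\<dots> \<le> - (c0 * a * 1)"
  proof -
    have "1 \<le> lm ^ i" using l1 by (simp add: one_le_power)
    then have "c0 * a * 1 \<le> c0 * a * lm ^ i" using c00 a by (intro mult_left_mono) auto
    then show ?thesis by simp
  qed
  finally have "exp ((1 - s) * a * ((lm ^ i - 1) / (lm - 1)) - s * (a * lm ^ i)) \<le> exp (- c0 * a)" by simp
  then show ?thesis unfolding 1 c0_def using C2 by (intro mult_left_mono) auto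
qed

definition all_close :: "nat \<Rightarrow> (nat \<Rightarrow> nat) \<Rightarrow> real \<Rightarrow> ((nat \<times> nat) \<Rightarrow> (nat \<times> nat)) set" where
  "all_close n d T = {\<sigma>. \<forall>u<n. \<forall>v<n. \<exists>t. real t < T \<and> (u, v) \<in> cm_adj n d \<sigma> ^^ t}"

text \<open>To be applied with \<open>s\<close> slightly below \<open>\<tau> - 2\<close> and
  \<open>lm\<close> slightly above \<open>1 / s\<close>. A minimal-degree ball of radius
  \<open>Suc k\<close> has probability at least \<open>exp (- lk * x powr (1 - \<eta>))\<close>,
  that is \<open>n powr (- o(1))\<close>, so the expected number of such balls beats every power of
  \<open>x\<close>.\<close>

lemma lower_tail_whp:
  fixes d :: "nat \<Rightarrow> nat \<Rightarrow> nat" and s C lm \<eta> p0 :: real and D :: nat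
  assumes mom: "\<And>n. (\<Sum>i<n. real (d n i) powr (1 + s)) \<le> C * real n" and s: "0 < s" "s < 1" and lam: "1 / s < lm"
    and D: "\<And>n i. i < n \<Longrightarrow> D \<le> d n i" "3 \<le> D" and evn: "\<And>n. even (\<Sum>i<n. d n i)"
    and p0: "0 < p0" "eventually (\<lambda>n. p0 * real n \<le> real (card {i. i < n \<and> d n i = D})) sequentially"
    and \<eta>: "0 < \<eta>" "\<eta> < 1"
  shows "(\<lambda>n. match_prob (half_edges n (d n)) {} (all_close n (d n) ((1 - \<eta>) * (2 / ln (real D - 1) + 2 / ln lm) * ln (ln (real n))))) \<longlonglongrightarrow> 0"
proof -
  define B where "B = ln (real D - 1)"
  define A where "A = ln lm"
  have l1: "lm > 1" using lam s by (smt (verit) less_divide_eq_1_pos)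
  have A0: "A > 0" using l1 by (simp add: A_def)
  have B0: "B > 0" using D(2) by (simp add: B_def)
  have DD: "real (D - 1) = exp B" using D(2) by (simp add: B_def of_nat_diff)
  have d1: "1 \<le> d n i" if "i < n" for n i using D that by (meson le_trans one_le_numeral)
  have len: "real (card (half_edges n (d n))) \<le> C * real n" for n
  proof -
    have "real (d n i) \<le> real (d n i) powr (1 + s)" if "i < n" for i
    proof -
      have "real (d n i) powr 1 \<le> real (d n i) powr (1 + s)" using d1[OF that] s by (intro powr_mono) auto
      then show ?thesis using d1[OF that] by simp
    qed
    then have "(\<Sum>i<n. real (d n i)) \<le> (\<Sum>i<n. real (d n i) powr (1 + s))" by (intro sum_mono) auto
    then show ?thesis using mom[of n] by (simp add: card_half_edges)
  qed
  have nl: "n \<le> card (half_edges n (d n))" for n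
  proof -
    have "(\<Sum>i<n. 1) \<le> (\<Sum>i<n. d n i)" using d1 by (intro sum_mono) auto
    then show ?thesis by (simp add: card_half_edges)
  qed
  have C1: "C \<ge> 1" using len[of 1] nl[of 1] by simp
  define C2 where "C2 = 2 * C"
  define lc where "lc = ln C2"
  have C20: "C2 > 1" "lc > 0" using C1 by (auto simp: C2_def lc_def)
  define cU where "cU = real (D * (D + 1))"
  define z where "z = ln (real D + 1) / B"
  have cU0: "cU > 0" "z > 0" 
  proof -
    have "D * (D + 1) > 0" using D(2) by simp
    then show "cU > 0" by (simp only: cU_def of_nat_0_less_iff)
    show "z > 0" using D(2) B0 by (simp add: z_def)
  qed
  define cT where "cT = real (D * (D - 1))"
  have cT0: "cT > 0"
  proof -
    have "D * (D - 1) > 0" using D(2) by simp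
    then show ?thesis by (simp only: cT_def of_nat_0_less_iff)
  qed
  \<comment> \<open>At least half of the \<open>p0 * n\<close> vertices of degree \<open>D\<close>
    stay unexplored, among at most \<open>C * n\<close> half-edges. The cap \<open>1/2\<close> keeps
    \<open>ln c\<close> negative.\<close>
  define c where "c = min (1/2) (p0 / (2 * C))"
  have c0: "0 < c" "c \<le> 1" "c < 1" "c * C \<le> p0 / 2"
  proof -
    show "0 < c" "c \<le> 1" "c < 1" using p0 C1 by (auto simp: c_def)
    have "c * C \<le> p0 / (2 * C) * C" using C1 by (intro mult_right_mono) (auto simp: c_def)
    then show "c * C \<le> p0 / 2" using C1 by simp
  qed
  define lk where "lk = - ln c * cT"
  have lk0: "lk > 0" using c0 cT0 by (simp add: lk_def mult_neg_pos ln_less_zero)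
  define e' where "e' = 1 - \<eta>"
  have e': "0 < e'" "e' < 1" using \<eta> by (auto simp: e'_def)
  define e2 where "e2 = 1 - \<eta> / 2"
  have e2: "0 < e2" "e2 < 1" using \<eta> by (auto simp: e2_def)
  define k0 where "k0 = s - (1 - s) / (lm - 1)"
  have k00: "k0 > 0"
  proof -
    have "1 < lm * s" using lam s by (simp add: field_simps)
    then have "1 - s < s * (lm - 1)" by (simp add: algebra_simps)
    then show ?thesis using l1 by (simp add: k0_def field_simps)
  qed
  \<comment> \<open>With \<open>x = ln n\<close>, \<open>w x\<close> bounds the number
    \<open>U0\<close> of half-edges of a ball, \<open>E1 x\<close> bounds \<open>ln E\<close>,
    \<open>P1 x\<close> and \<open>P2 x\<close> bound the two parts of \<open>pb\<close>, and
    \<open>P3 x\<close> the near-pair term.\<close>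
  define w where "w = (\<lambda>x. cU * exp (z * ln x))"
  define E1 where "E1 = (\<lambda>x. 4 * (w x)^2 / exp x)"
  define P1 where "P1 = (\<lambda>x. 2 * w x * (ln x / A + 1) * exp (lc * (ln x / A + 1)) * exp (- k0 * exp (\<eta> / 2 * ln x)))"
  define P2 where "P2 = (\<lambda>x. (2 * w x)^2 * (2 * ln x / A + 2) * exp ((lc + exp (e2 * ln x)) * (2 * ln x / A + 2)) * 2 / exp x)"
  define cB where "cB = real ((D + 1) ^ 3)"
  have cB0: "cB > 0"
  proof -
    have "(D + 1) ^ 3 > 0" by simp
    then show ?thesis by (simp only: cB_def of_nat_0_less_iff)
  qed
  define P3 where "P3 = (\<lambda>x. cB * exp (2 * z * ln x) / (p0 * exp x * exp (- lk * exp (e' * ln x))))"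
  have lim: "(E1 \<longlongrightarrow> 0) at_top" "(P1 \<longlongrightarrow> 0) at_top" "(P2 \<longlongrightarrow> 0) at_top" "(P3 \<longlongrightarrow> 0) at_top"
  proof -
    show "(E1 \<longlongrightarrow> 0) at_top" unfolding E1_def w_def using cU0 by real_asymp
    show "(P1 \<longlongrightarrow> 0) at_top" unfolding P1_def w_def using cU0 A0 C20(2) k00 \<eta>(1) by real_asymp
    show "(P2 \<longlongrightarrow> 0) at_top" unfolding P2_def w_def using cU0 A0 C20(2) e2 by real_asymp
    show "(P3 \<longlongrightarrow> 0) at_top" unfolding P3_def using cU0 cB0 p0(1) lk0 e' by real_asymp
  qed
  let ?bd = "\<lambda>x. 4 * (exp (E1 x) - 1 + (P1 x + P2 x) * exp (E1 x)) + 8 * P3 x"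
  have limbd: "(?bd \<longlongrightarrow> 0) at_top"
    by (rule tendsto_eq_intros lim refl | simp)+
  have ev: "eventually (\<lambda>n. P (ln (real n))) sequentially" if "eventually P at_top" for P
    using that filterlim_ln_real by (rule eventually_compose_filterlim)
  have f1: "eventually (\<lambda>x. 2 * w x + 2 * (2 * ln x / A + 2) + 1 \<le> exp x / 2) at_top"
    unfolding w_def using cU0 A0 by real_asymp
  have f2: "eventually (\<lambda>x. 1 + cT * exp (e' * ln x) \<le> p0 * exp x / 2) at_top"
    using cT0 p0(1) e' by real_asymp
  have f3: "eventually (\<lambda>x::real. 1 \<le> ln x \<and> 1 \<le> x) at_top" by (intro eventually_conj) real_asymp+
  let ?T = "\<lambda>n. (1 - \<eta>) * (2 / B + 2 / A) * ln (ln (real n))"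
  have main: "eventually (\<lambda>n. match_prob (half_edges n (d n)) {} (all_close n (d n) (?T n)) \<le> ?bd (ln (real n))) sequentially"
    using ev[OF f1] ev[OF f2] ev[OF f3] p0(2) eventually_gt_at_top[of 0]
  proof eventually_elim
    case (elim n)
    let ?H = "half_edges n (d n)"
    define x where "x = ln (real n)"
    define L where "L = ln x"
    note el = elim[folded x_def, folded L_def]
    have nx: "real n = exp x" using el(5) by (simp add: x_def)
    have x1: "x \<ge> 1" and L1: "L \<ge> 1" using el by auto
    \<comment> \<open>Rounding down loses at most one in \<open>k\<close> and in \<open>Q\<close>;
      the radius \<open>Suc k\<close> and the \<open>+ 2\<close> in \<open>m\<close> recover it, so
      \<open>2 * Suc k + m\<close> is at least the target distance.\<close>
    define k where "k = nat \<lfloor>(1 - \<eta>) * L / B\<rfloor>"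
    define Q where "Q = nat \<lfloor>(1 - \<eta>) * L / A\<rfloor>"
    define m where "m = 2 * Q + 2"
    have kb: "real k \<le> (1 - \<eta>) * L / B" "(1 - \<eta>) * L / B \<le> real k + 1"
    proof -
      have "0 \<le> (1 - \<eta>) * L / B" using L1 B0 \<eta> by (intro divide_nonneg_pos mult_nonneg_nonneg) auto
      then show "real k \<le> (1 - \<eta>) * L / B" "(1 - \<eta>) * L / B \<le> real k + 1" unfolding k_def by linarith+
    qed
    have Qb: "real Q \<le> (1 - \<eta>) * L / A" "(1 - \<eta>) * L / A \<le> real Q + 1"
    proof -
      have "0 \<le> (1 - \<eta>) * L / A" using L1 A0 \<eta> by (intro divide_nonneg_pos mult_nonneg_nonneg) auto
      then show "real Q \<le> (1 - \<eta>) * L / A" "(1 - \<eta>) * L / A \<le> real Q + 1" unfolding Q_def by linarith+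
    qed
    have QL: "real Q \<le> L / A"
    proof -
      have "(1 - \<eta>) * L / A \<le> 1 * L / A" using \<eta> L1 A0 by (intro divide_right_mono mult_right_mono) auto
      then show ?thesis using Qb(1) by simp
    qed
    have mL: "real m \<le> 2 * L / A + 2" using QL by (simp add: m_def)
    have kL: "real k \<le> L / B"
    proof -
      have "(1 - \<eta>) * L / B \<le> 1 * L / B" using \<eta> L1 B0 by (intro divide_right_mono mult_right_mono) auto
      then show ?thesis using kb(1) by simp
    qed
    define U0 where "U0 = D * (D + 1) ^ Suc k"
    define U where "U = 2 * U0 + 2 * max Q m + 1"
    have Dp: "real (D + 1) ^ k \<le> exp (z * L)"
    proof -
      have "real (D + 1) ^ k = exp (real k * ln (real D + 1))" by (simp add: exp_of_nat_mult add.commute)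
      also have "\<dots> \<le> exp (L / B * ln (real D + 1))" unfolding exp_le_cancel_iff using kL by (intro mult_right_mono) auto
      finally show ?thesis by (simp add: z_def mult.commute)
    qed
    have U0w: "real U0 \<le> w x"
    proof -
      have "real U0 = cU * real (D + 1) ^ k" unfolding U0_def cU_def by (simp only: of_nat_mult of_nat_power power_Suc mult.assoc)
      also have "\<dots> \<le> cU * exp (z * L)" using Dp cU0 by (intro mult_left_mono) auto
      finally show ?thesis by (simp add: w_def L_def)
    qed
    have Un: "real U \<le> exp x / 2"
    proof -
      have "max Q m = m" by (simp add: m_def)
      then have "real U = 2 * real U0 + 2 * real m + 1" by (simp add: U_def)
      also have "\<dots> \<le> 2 * w x + 2 * (2 * L / A + 2) + 1" using U0w mL by (intro add_mono mult_left_mono) auto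
      finally show ?thesis using el(1) by (simp add: L_def)
    qed
    have nlx: "exp x \<le> real (card ?H)" using nl[of n] nx by simp
    have x0: "exp x > 0" by simp
    have UH: "U < card ?H"
    proof -
      have "real U < real (card ?H)" using Un nlx x0 by linarith
      then show ?thesis by simp
    qed
    define l where "l = real (card ?H) - real U"
    have l2: "exp x / 2 \<le> l" using Un nlx by (simp add: l_def)
    have l0: "l > 0" using l2 x0 by linarith
    \<comment> \<open>Large enough for \<open>exp (- k0 * a)\<close> to beat all powers of
      \<open>x\<close>, small enough for \<open>a * lm ^ Q \<le> x powr (1 - \<eta>/2)\<close>,
      which keeps the largest truncation \<open>b Q\<close> at \<open>n powr o(1)\<close>.\<close>
    define a where "a = exp (\<eta> / 2 * L)"
    have a0: "a \<ge> 0" by (simp add: a_def)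
    define b where "b = (\<lambda>i. exp (a * lm ^ i))"
    have b0: "b i > 0" for i by (simp add: b_def)
    have bm: "b i \<le> b Q" if "i \<le> Q" for i
      using that a0 l1 by (auto simp: b_def intro!: mult_left_mono power_increasing)
    define \<omega> where "\<omega> = 2 * real U0"
    have w0: "\<omega> \<ge> 0" "\<omega> \<le> 2 * w x" using U0w by (auto simp: \<omega>_def)
    define pb where "pb = \<omega> * ((\<Sum>i\<le>Q. (\<Prod>j<i. sqsum n (d n) (b j) / l) * (vol n (d n) (b i) / l)) + (\<Sum>i<m. (sqsum n (d n) (b Q) / l) ^ i * (\<omega> / l)))"
    define E where "E = (real (card ?H) / (real (card ?H) - 2 * real U0)) ^ U0"
    define S where "S = (\<Sum>v<n. match_prob ?H {} (min_degree_ball n (d n) D (Suc k) v))"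
    have ratio: "y / l \<le> C2 * t" if "y \<le> t * (C * real n)" "0 \<le> t" "0 \<le> y" for y t
    proof -
      have "y / l \<le> t * (C * real n) / (exp x / 2)" using that l2 C1 by (intro frac_le) auto
      then show ?thesis by (simp add: nx C2_def mult_ac)
    qed
    have sq: "sqsum n (d n) (b i) / l \<le> C2 * b i powr (1 - s)" for i
      by (rule ratio[OF sqsum_le_moment[OF mom b0 s]]) (auto simp: sqsum_nonneg)
    have vo: "vol n (d n) (b i) / l \<le> C2 * b i powr (- s)" for i
      by (rule ratio[OF vol_le_moment[OF mom b0 s(1)]]) (auto simp: vol_nonneg)
    have sq0: "0 \<le> sqsum n (d n) (b i) / l" "0 \<le> vol n (d n) (b i) / l" for i
      using l0 by (auto simp: sqsum_nonneg vol_nonneg)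
    have part1: "\<omega> * (\<Sum>i\<le>Q. (\<Prod>j<i. sqsum n (d n) (b j) / l) * (vol n (d n) (b i) / l)) \<le> P1 x"
    proof -
      have "(\<Prod>j<i. sqsum n (d n) (b j) / l) * (vol n (d n) (b i) / l) \<le> exp (lc * (L / A + 1)) * exp (- k0 * a)" if "i \<le> Q" for i
      proof -
        have "(\<Prod>j<i. sqsum n (d n) (b j) / l) * (vol n (d n) (b i) / l) \<le> (\<Prod>j<i. C2 * b j powr (1 - s)) * (C2 * b i powr (- s))"
          using sq vo sq0 C20 by (intro mult_mono prod_mono prod_nonneg) auto
        also have "\<dots> \<le> C2 ^ Suc i * exp (- (s - (1 - s) / (lm - 1)) * a)"
          by (rule truncated_path_weight[OF s lam a0 _ b_def]) (use C20 in simp)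
        also have "\<dots> \<le> exp (lc * (L / A + 1)) * exp (- k0 * a)"
        proof (rule mult_mono)
          have "C2 ^ Suc i = exp (real (Suc i) * lc)" using C20 by (simp only: exp_of_nat_mult) (simp add: lc_def)
          also have "\<dots> \<le> exp ((L / A + 1) * lc)" unfolding exp_le_cancel_iff using that QL C20 by (intro mult_right_mono) auto
          finally show "C2 ^ Suc i \<le> exp (lc * (L / A + 1))" by (simp add: mult.commute)
        qed (auto simp: k0_def)
        finally show ?thesis .
      qed
      then have "(\<Sum>i\<le>Q. (\<Prod>j<i. sqsum n (d n) (b j) / l) * (vol n (d n) (b i) / l)) \<le> (\<Sum>i\<le>Q. exp (lc * (L / A + 1)) * exp (- k0 * a))"
        by (intro sum_mono) auto
      also have "\<dots> = (real Q + 1) * (exp (lc * (L / A + 1)) * exp (- k0 * a))" by simp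
      also have "\<dots> \<le> (L / A + 1) * (exp (lc * (L / A + 1)) * exp (- k0 * a))"
        using QL by (intro mult_right_mono) auto
      finally have "\<omega> * (\<Sum>i\<le>Q. (\<Prod>j<i. sqsum n (d n) (b j) / l) * (vol n (d n) (b i) / l)) \<le> 2 * w x * ((L / A + 1) * (exp (lc * (L / A + 1)) * exp (- k0 * a)))"
      proof (rule mult_mono[OF w0(2)])
        show "0 \<le> (\<Sum>i\<le>Q. (\<Prod>j<i. sqsum n (d n) (b j) / l) * (vol n (d n) (b i) / l))"
          by (intro sum_nonneg mult_nonneg_nonneg prod_nonneg sq0)
        show "0 \<le> 2 * w x" using w0 by linarith
      qed
      then show ?thesis unfolding P1_def L_def a_def by (simp only: mult.assoc)
    qed
    \<comment> \<open>Only \<open>O(L)\<close> lengths occur and the path factors are at most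
      \<open>G ^ m = n powr o(1)\<close>, so the factor \<open>1 / n\<close> of hitting
      \<open>W\<close> again prevails.\<close>
    have part2: "\<omega> * (\<Sum>i<m. (sqsum n (d n) (b Q) / l) ^ i * (\<omega> / l)) \<le> P2 x"
    proof -
      define G where "G = exp (lc + exp (e2 * L))"
      have bQ: "C2 * b Q powr (1 - s) \<le> G"
      proof -
        have "lm ^ Q \<le> exp ((1 - \<eta>) * L)"
        proof -
          have "lm ^ Q = exp (real Q * A)" using l1 by (simp add: exp_of_nat_mult A_def)
          also have "real Q * A \<le> (1 - \<eta>) * L" using Qb(1) A0 by (simp add: field_simps)
          finally show ?thesis by simp
        qed
        then have "a * lm ^ Q \<le> a * exp ((1 - \<eta>) * L)" using a0 by (intro mult_left_mono)
        also have "\<dots> = exp (e2 * L)" by (simp add: a_def e2_def exp_add[symmetric] algebra_simps)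
        finally have q: "a * lm ^ Q \<le> exp (e2 * L)" .
        have "1 \<le> b Q" using a0 l1 by (simp add: b_def)
        then have "b Q powr (1 - s) \<le> b Q powr 1" using s by (intro powr_mono) auto
        also have "\<dots> \<le> exp (exp (e2 * L))" using q b0[of Q] by (simp add: b_def)
        finally have "C2 * b Q powr (1 - s) \<le> C2 * exp (exp (e2 * L))" using C20 by simp
        then show ?thesis using C20 by (simp add: G_def exp_add lc_def)
      qed
      have G1: "G \<ge> 1" using C20 by (simp add: G_def add_nonneg_nonneg)
      have "(sqsum n (d n) (b Q) / l) ^ i * (\<omega> / l) \<le> G ^ m * (2 * w x * 2 / exp x)" if "i < m" for i
      proof (rule mult_mono)
        have "(sqsum n (d n) (b Q) / l) ^ i \<le> G ^ i" using sq[of Q] bQ sq0 by (intro power_mono) auto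
        also have "\<dots> \<le> G ^ m" using G1 that by (intro power_increasing) auto
        finally show "(sqsum n (d n) (b Q) / l) ^ i \<le> G ^ m" .
        have "\<omega> / l \<le> 2 * w x / (exp x / 2)" using w0 l2 by (intro frac_le) auto
        then show "\<omega> / l \<le> 2 * w x * 2 / exp x" by simp
      qed (use G1 w0 l0 in auto)
      then have "(\<Sum>i<m. (sqsum n (d n) (b Q) / l) ^ i * (\<omega> / l)) \<le> (\<Sum>i<m. G ^ m * (2 * w x * 2 / exp x))"
        by (intro sum_mono) auto
      also have "\<dots> = real m * (G ^ m * (2 * w x * 2 / exp x))" by simp
      also have "\<dots> \<le> (2 * L / A + 2) * (exp ((lc + exp (e2 * L)) * (2 * L / A + 2)) * (2 * w x * 2 / exp x))"
      proof (intro mult_mono mult_right_mono mL)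
        have "G ^ m = exp (real m * (lc + exp (e2 * L)))" by (simp add: G_def exp_of_nat_mult)
        also have "\<dots> \<le> exp ((2 * L / A + 2) * (lc + exp (e2 * L)))" unfolding exp_le_cancel_iff using mL C20 by (intro mult_right_mono) (auto intro!: add_nonneg_nonneg)
        finally show "G ^ m \<le> exp ((lc + exp (e2 * L)) * (2 * L / A + 2))" by (simp add: mult.commute)
      qed (use L1 A0 w0 G1 in auto)
      finally have "\<omega> * (\<Sum>i<m. (sqsum n (d n) (b Q) / l) ^ i * (\<omega> / l)) \<le> 2 * w x * ((2 * L / A + 2) * (exp ((lc + exp (e2 * L)) * (2 * L / A + 2)) * (2 * w x * 2 / exp x)))"
        using w0 sq0 l0 by (intro mult_mono) (auto intro!: sum_nonneg mult_nonneg_nonneg)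
      moreover have "2 * w x * (c1 * (c2 * (2 * w x * 2 / exp x))) = (2 * w x)^2 * c1 * c2 * 2 / exp x" for c1 c2 :: real
        by (simp add: power2_eq_square)
      ultimately show ?thesis unfolding P2_def L_def by (simp only:)
    qed
    have pbP: "pb \<le> P1 x + P2 x" using part1 part2 by (simp add: pb_def distrib_left)
    have EE: "E \<le> exp (E1 x)"
    proof -
      have h2: "exp x / 2 \<le> real (card ?H) - 2 * real U0"
      proof -
        have "2 * real U0 \<le> real U" by (simp add: U_def)
        then show ?thesis using l2 l_def by linarith
      qed
      have pos: "0 < real (card ?H) - 2 * real U0" using h2 x0 by linarith
      have "real (card ?H) / (real (card ?H) - 2 * real U0) = 1 + 2 * real U0 / (real (card ?H) - 2 * real U0)"
        using pos by (simp add: field_simps)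
      also have "\<dots> \<le> 1 + 2 * real U0 / (exp x / 2)" using h2 x0 by (intro add_left_mono frac_le) auto
      also have "\<dots> \<le> exp (4 * real U0 / exp x)" using exp_ge_add_one_self[of "4 * real U0 / exp x"] by simp
      finally have "E \<le> exp (4 * real U0 / exp x) ^ U0" unfolding E_def using pos by (intro power_mono) auto
      also have "\<dots> = exp (4 * real U0 * real U0 / exp x)" by (simp add: exp_of_nat_mult[symmetric])
      also have "4 * real U0 * real U0 / exp x \<le> E1 x"
      proof -
        have "real U0 * real U0 \<le> w x * w x" using U0w by (intro mult_mono) auto
        then show ?thesis unfolding E1_def by (intro divide_right_mono) (auto simp: power2_eq_square)
      qed
      finally show ?thesis by simp
    qed
    have Dk: "real ((D - 1) ^ Suc k) \<le> real (D - 1) * exp (e' * L)"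
    proof -
      have "real ((D - 1) ^ k) = exp (real k * B)" by (simp only: of_nat_power DD exp_of_nat_mult)
      also have "real k * B \<le> e' * L" using kb(1) B0 by (simp add: e'_def field_simps)
      finally have "real ((D - 1) ^ k) \<le> exp (e' * L)" by simp
      then have "real (D - 1) * real ((D - 1) ^ k) \<le> real (D - 1) * exp (e' * L)" by (intro mult_left_mono) auto
      then show ?thesis by (simp only: power_Suc of_nat_mult)
    qed
    define T0 where "T0 = D * tree_edges D (Suc k)"
    have T0b: "real T0 \<le> cT * exp (e' * L)"
    proof -
      have "tree_edges D (Suc k) \<le> (D - 1) ^ Suc k" using tree_edges_le[OF D(2), of "Suc k"] by linarith
      then have "real (tree_edges D (Suc k)) \<le> real (D - 1) * exp (e' * L)" using Dk by (meson of_nat_le_iff order_trans)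
      then have "real D * real (tree_edges D (Suc k)) \<le> real D * (real (D - 1) * exp (e' * L))" by (rule mult_left_mono) simp
      then show ?thesis unfolding T0_def cT_def by (simp only: of_nat_mult mult.assoc)
    qed
    have Sb: "p0 * exp x * exp (- lk * exp (e' * L)) \<le> S"
    proof -
      define V where "V = {i. i < n \<and> d n i = D}"
      have Vn: "p0 * exp x \<le> real (card V)" using el(4) by (simp add: V_def nx)
      have cN: "c * real (card ?H) \<le> real D * (real (card V) - real (1 + T0))"
      proof -
        have "real (1 + T0) \<le> p0 * exp x / 2" using T0b el(2) by (simp add: L_def)
        then have h: "p0 * exp x / 2 \<le> real (card V) - real (1 + T0)" using Vn by linarith
        have "c * real (card ?H) \<le> c * (C * exp x)" using len[of n] nx c0 by (intro mult_left_mono) auto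
        also have "\<dots> \<le> p0 / 2 * exp x" using c0(4) mult_right_mono[of "c * C" "p0 / 2" "exp x"] by (simp add: mult.assoc)
        also have "\<dots> \<le> real (card V) - real (1 + T0)" using h by simp
        also have "\<dots> \<le> real D * (real (card V) - real (1 + T0))"
        proof -
          have "0 \<le> real (card V) - real (1 + T0)" using h p0(1) x0 by (smt (verit) divide_nonneg_pos mult_nonneg_nonneg)
          then have "1 * (real (card V) - real (1 + T0)) \<le> real D * (real (card V) - real (1 + T0))" using D(2) by (intro mult_right_mono) auto
          then show ?thesis by simp
        qed
        finally show ?thesis .
      qed
      have D1: "1 \<le> D" using D(2) by simp
      have evH: "even (card ?H)" using evn[of n] by (simp add: card_half_edges)
      have each: "c ^ T0 \<le> match_prob ?H {} (min_degree_ball n (d n) D (Suc k) v)" if "v \<in> V" for v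
        unfolding T0_def
        by (rule prob_min_degree_ball[OF D1 c0(1,2) _ evH]) (use cN[unfolded V_def] that in \<open>auto simp: V_def T0_def simp del: tree_edges.simps\<close>)
      have "exp (- lk * exp (e' * L)) \<le> c ^ T0"
      proof -
        have "c ^ T0 = exp (real T0 * ln c)" using c0 by (simp add: exp_of_nat_mult)
        moreover have "- lk * exp (e' * L) \<le> real T0 * ln c"
        proof -
          have "real T0 * (- ln c) \<le> cT * exp (e' * L) * (- ln c)" using T0b c0 by (intro mult_right_mono) auto
          then show ?thesis by (simp add: lk_def mult_ac)
        qed
        ultimately show ?thesis by simp
      qed
      then have "p0 * exp x * exp (- lk * exp (e' * L)) \<le> real (card V) * c ^ T0"
        using Vn p0(1) by (intro mult_mono) auto
      also have "\<dots> = (\<Sum>v\<in>V. c ^ T0)" by simp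
      also have "\<dots> \<le> (\<Sum>v\<in>V. match_prob ?H {} (min_degree_ball n (d n) D (Suc k) v))" by (intro sum_mono each)
      also have "\<dots> \<le> S" unfolding S_def by (intro sum_mono2) (auto simp: V_def)
      finally show ?thesis .
    qed
    have S0: "0 < S" by (rule less_le_trans[OF _ Sb]) (use p0(1) in simp)
    have P3b: "real ((D + 1) ^ (2 * Suc k + 1)) / S \<le> P3 x"
    proof -
      have "real ((D + 1) ^ (2 * Suc k + 1)) = cB * (real (D + 1) ^ k)^2"
      proof -
        have "2 * Suc k + 1 = 3 + k * 2" by simp
        then show ?thesis by (simp only: cB_def of_nat_power of_nat_mult power_add power_mult)
      qed
      also have "\<dots> \<le> cB * (exp (z * L))^2" using Dp cB0 by (intro mult_left_mono power_mono) auto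
      also have "\<dots> = cB * exp (2 * z * L)" by (simp add: power2_eq_square exp_add[symmetric])
      finally have "real ((D + 1) ^ (2 * Suc k + 1)) / S \<le> cB * exp (2 * z * L) / (p0 * exp x * exp (- lk * exp (e' * L)))"
        using Sb p0(1) cB0 by (intro frac_le) auto
      then show ?thesis by (simp add: P3_def L_def)
    qed
    have P0: "0 \<le> pb" "0 \<le> P1 x + P2 x"
    proof -
      show "0 \<le> pb" unfolding pb_def using w0 sq0 l0
        by (intro mult_nonneg_nonneg add_nonneg_nonneg sum_nonneg prod_nonneg zero_le_power) auto
      then show "0 \<le> P1 x + P2 x" using pbP by linarith
    qed
    have E0: "0 \<le> E" unfolding E_def using UH by (intro zero_le_power divide_nonneg_nonneg) (auto simp: U_def)
    have "match_prob ?H {} (all_close n (d n) (?T n)) \<le> match_prob ?H {} {\<sigma>. \<forall>u<n. \<forall>v<n. \<sigma> \<in> min_degree_ball n (d n) D (Suc k) u \<longrightarrow> \<sigma> \<in> min_degree_ball n (d n) D (Suc k) v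
      \<longrightarrow> v \<in> ball_at (cm_adj n (d n) \<sigma>) u (2 * Suc k + m)}"
    proof (rule match_prob_mono)
      have T: "?T n \<le> real (2 * Suc k + m)"
      proof -
        have "?T n = 2 * ((1 - \<eta>) * L / B) + 2 * ((1 - \<eta>) * L / A)"
          using A0 B0 by (simp add: L_def x_def field_simps)
        then show ?thesis using kb(2) Qb(2) by (simp add: m_def)
      qed
      show "ext ?H {} \<inter> all_close n (d n) (?T n) \<subseteq> {\<sigma>. \<forall>u<n. \<forall>v<n. \<sigma> \<in> min_degree_ball n (d n) D (Suc k) u \<longrightarrow> \<sigma> \<in> min_degree_ball n (d n) D (Suc k) v
      \<longrightarrow> v \<in> ball_at (cm_adj n (d n) \<sigma>) u (2 * Suc k + m)}"
      proof (intro subsetI CollectI allI impI)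
        fix \<sigma> u v assume "\<sigma> \<in> ext ?H {} \<inter> all_close n (d n) (?T n)" "u < n" "v < n"
        then obtain t where t: "real t < ?T n" "(u, v) \<in> cm_adj n (d n) \<sigma> ^^ t" unfolding all_close_def by blast
        have "real t \<le> real (2 * Suc k + m)" using t(1) T by linarith
        then have "t \<le> 2 * Suc k + m" by (simp only: of_nat_le_iff)
        then show "v \<in> ball_at (cm_adj n (d n) \<sigma>) u (2 * Suc k + m)" using t(2) unfolding ball_at_relpow by blast
      qed
    qed simp
    also have "\<dots> \<le> 4 * (E - 1 + pb * E) + 8 * real ((D + 1) ^ (2 * Suc k + 1)) / S"
      by (rule no_distant_pair_bound[OF _ _ U0_def U_def UH bm _ l_def \<omega>_def pb_def E_def S_def S0])
        (use d1 evn[of n] in \<open>auto simp: card_half_edges m_def\<close>)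
    also have "\<dots> \<le> ?bd x"
    proof -
      have 1: "pb * E \<le> (P1 x + P2 x) * exp (E1 x)" using pbP EE P0 E0 by (intro mult_mono) auto
      have 2: "4 * (E - 1 + pb * E) \<le> 4 * (exp (E1 x) - 1 + (P1 x + P2 x) * exp (E1 x))"
        by (intro mult_left_mono add_mono diff_right_mono EE 1) simp
      have 3: "8 * real ((D + 1) ^ (2 * Suc k + 1)) / S \<le> 8 * P3 x"
        unfolding times_divide_eq_right[symmetric] by (rule mult_left_mono[OF P3b]) simp
      show ?thesis by (rule add_mono[OF 2 3])
    qed
    finally show ?case by (simp add: x_def)
  qed
  have "((\<lambda>n. ?bd (ln (real n))) \<longlongrightarrow> 0) sequentially"
    using limbd filterlim_ln_real by (rule filterlim_compose)
  then have "(\<lambda>n. match_prob (half_edges n (d n)) {} (all_close n (d n) (?T n))) \<longlonglongrightarrow> 0"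
    by (rule tendsto_sandwich[OF always_eventually main tendsto_const, rotated]) simp
  then show ?thesis by (simp add: A_def B_def)
qed

section \<open>Convergence in probability\<close>

text \<open>Discrete form of integrating \<open>x powr s\<close>: at least \<open>d / 4\<close>
  integers lie between \<open>d / 2\<close> and \<open>d\<close>, each with term at least
  \<open>d powr s / 2\<close>, hence the \<open>8\<close>. The summand \<open>1\<close> covers
  \<open>d = 1\<close>.\<close>

lemma powr_le_sum:
  fixes s :: real
  assumes s: "0 < s" "s < 1"
  shows "real d powr (1 + s) \<le> 1 + 8 * (\<Sum>x=1..<d. real x powr s)"
proof (cases "d \<le> 1")
  case True
  then have "d = 0 \<or> d = 1" by linarith
  then show ?thesis by auto
next
  case False
  let ?J = "{(d + 1) div 2..<d}"
  have "real d / 4 \<le> real (card ?J)"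
  proof -
    have "d \<le> 4 * (d - (d + 1) div 2)" using False by linarith
    then have "real d \<le> real (4 * (d - (d + 1) div 2))" by (simp only: of_nat_le_iff)
    then show ?thesis by simp
  qed
  moreover have "real d powr s / 2 \<le> real x powr s" if "x \<in> ?J" for x
  proof -
    have "d \<le> 2 * x" using that by auto
    then have "real d / 2 \<le> real x" by linarith
    then have "(real d / 2) powr s \<le> real x powr s" using s by (intro powr_mono2) auto
    moreover have "(real d / 2) powr s = real d powr s / 2 powr s" by (simp add: powr_divide)
    moreover have "real d powr s / 2 \<le> real d powr s / 2 powr s"
    proof (rule divide_left_mono)
      have "(2::real) powr s \<le> 2 powr 1" using s by (intro powr_mono) auto
      then show "(2::real) powr s \<le> 2" by simp
    qed auto
    ultimately show ?thesis by linarith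
  qed
  then have "(\<Sum>x\<in>?J. real d powr s / 2) \<le> (\<Sum>x\<in>?J. real x powr s)" by (intro sum_mono)
  moreover have "(\<Sum>x\<in>?J. real x powr s) \<le> (\<Sum>x=1..<d. real x powr s)"
    using False by (intro sum_mono2) auto
  ultimately have "real d / 4 * (real d powr s / 2) \<le> (\<Sum>x=1..<d. real x powr s)"
    using mult_right_mono[of "real d / 4" "real (card ?J)" "real d powr s / 2"] by simp
  moreover have "real d powr (1 + s) = real d * real d powr s" using False by (simp add: powr_add)
  ultimately show ?thesis by simp
qed

text \<open>Exchanging the two sums turns the moment into a sum of \<open>x powr s\<close> times the
  tail count, which converges because \<open>s - e < -1\<close>. \<open>M\<close> only makes the
  range of \<open>x\<close> independent of \<open>i\<close>.\<close>

lemma moment_bound: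
  fixes d :: "nat \<Rightarrow> nat" and s c2 e :: real
  assumes s: "0 < s" "s < 1" and e: "s + 1 < e"
    and tail: "\<And>x. 1 \<le> x \<Longrightarrow> real (card {i. i < n \<and> real x < real (d i)}) \<le> c2 * real n * real x powr (- e)"
    and c2: "0 \<le> c2"
  shows "(\<Sum>i<n. real (d i) powr (1 + s)) \<le> (1 + 8 * c2 * (\<Sum>x. real x powr (s - e))) * real n"
proof -
  have summ: "summable (\<lambda>x. real x powr (s - e))" using e by (simp add: summable_real_powr_iff)
  define M where "M = (\<Sum>i<n. d i) + 1"
  have dM: "d i < M" if "i < n" for i
    using member_le_sum[of i "{..<n}" d] that by (simp add: M_def)
  have "(\<Sum>i<n. \<Sum>x=1..<d i. real x powr s) = (\<Sum>i<n. \<Sum>x=1..<M. if x < d i then real x powr s else 0)"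
  proof (rule sum.cong[OF refl])
    fix i assume "i \<in> {..<n}"
    then have "d i < M" using dM by simp
    then show "(\<Sum>x=1..<d i. real x powr s) = (\<Sum>x=1..<M. if x < d i then real x powr s else 0)"
      by (intro sum.mono_neutral_cong_left) auto
  qed
  also have "\<dots> = (\<Sum>x=1..<M. \<Sum>i<n. if x < d i then real x powr s else 0)" by (rule sum.swap)
  also have "\<dots> = (\<Sum>x=1..<M. real (card {i. i < n \<and> real x < real (d i)}) * real x powr s)"
    by (intro sum.cong refl) (simp add: sum.If_cases Int_def)
  also have "\<dots> \<le> (\<Sum>x=1..<M. c2 * real n * real x powr (s - e))"
  proof (rule sum_mono)
    fix x assume "x \<in> {1..<M}"
    then have x: "1 \<le> x" by simp
    have "real (card {i. i < n \<and> real x < real (d i)}) * real x powr s \<le> c2 * real n * real x powr (- e) * real x powr s"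
      using tail[OF x] by (intro mult_right_mono) auto
    also have "\<dots> = c2 * real n * real x powr (s - e)" by (simp add: powr_add[symmetric] mult.assoc)
    finally show "real (card {i. i < n \<and> real x < real (d i)}) * real x powr s \<le> c2 * real n * real x powr (s - e)" .
  qed
  also have "\<dots> = c2 * real n * (\<Sum>x=1..<M. real x powr (s - e))" by (simp add: sum_distrib_left)
  also have "\<dots> \<le> c2 * real n * (\<Sum>x. real x powr (s - e))"
    using c2 summ by (intro mult_left_mono sum_le_suminf) auto
  finally have *: "(\<Sum>i<n. \<Sum>x=1..<d i. real x powr s) \<le> c2 * real n * (\<Sum>x. real x powr (s - e))" .
  have "(\<Sum>i<n. real (d i) powr (1 + s)) \<le> (\<Sum>i<n. 1 + 8 * (\<Sum>x=1..<d i. real x powr s))"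
    by (intro sum_mono powr_le_sum s)
  also have "\<dots> = real n + 8 * (\<Sum>i<n. \<Sum>x=1..<d i. real x powr s)" by (simp add: sum.distrib sum_distrib_left)
  also have "\<dots> \<le> real n + 8 * (c2 * real n * (\<Sum>x. real x powr (s - e)))" using * by simp
  finally show ?thesis by (simp add: algebra_simps)
qed

lemma one_minus_emp_F:
  assumes "n \<ge> 1"
  shows "1 - emp_F n d x = real (card {i. i < n \<and> x < real (d i)}) / real n"
proof -
  have "{..<n} = {i. i < n \<and> real (d i) \<le> x} \<union> {i. i < n \<and> x < real (d i)}" by auto
  moreover have "card ({i. i < n \<and> real (d i) \<le> x} \<union> {i. i < n \<and> x < real (d i)}) =
      card {i. i < n \<and> real (d i) \<le> x} + card {i. i < n \<and> x < real (d i)}"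
    by (intro card_Un_disjoint) auto
  ultimately have "n = card {i. i < n \<and> real (d i) \<le> x} + card {i. i < n \<and> x < real (d i)}" by (metis card_lessThan)
  then have "real n = real (card {i. i < n \<and> real (d i) \<le> x}) + real (card {i. i < n \<and> x < real (d i)})"
    by (metis of_nat_add)
  then show ?thesis using assms by (simp add: emp_F_def field_simps)
qed

lemma vol_ge_card:
  assumes "0 \<le> x" shows "x * real (card {i. i < n \<and> x < real (d i)}) \<le> vol n d x"
proof -
  have "(\<Sum>i\<in>{i. i < n \<and> x < real (d i)}. x) \<le> vol n d x" unfolding vol_def by (intro sum_mono) auto
  then show ?thesis by (simp add: mult.commute)
qed

section \<open>From distances to the diameter\<close>

lemma finite_cm_dists:
  "finite {graph_dist (cm_adj n d \<sigma>) u v | u v. u < n \<and> v < n \<and> (u, v) \<in> (cm_adj n d \<sigma>)\<^sup>*}"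
proof (rule finite_subset)
  show "{graph_dist (cm_adj n d \<sigma>) u v | u v. u < n \<and> v < n \<and> (u, v) \<in> (cm_adj n d \<sigma>)\<^sup>*}
    \<subseteq> (\<lambda>(u, v). graph_dist (cm_adj n d \<sigma>) u v) ` ({..<n} \<times> {..<n})" by auto
qed simp

text \<open>The pair of vertex \<open>0\<close> with itself makes the set of distances nonempty, so
  \<open>Max\<close> is attained by some pair, and outside \<open>distant\<close> every pair has a
  path of length at most \<open>T\<close>.\<close>

lemma cm_diam_le:
  assumes "n \<ge> 1" "\<sigma> \<notin> distant n d T"
  shows "real (cm_diam n d \<sigma>) \<le> T"
proof -
  let ?X = "{graph_dist (cm_adj n d \<sigma>) u v | u v. u < n \<and> v < n \<and> (u, v) \<in> (cm_adj n d \<sigma>)\<^sup>*}"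
  have "graph_dist (cm_adj n d \<sigma>) 0 0 \<in> ?X" using assms(1) by (intro CollectI exI[of _ 0]) auto
  then have ne: "?X \<noteq> {}" by blast
  have "cm_diam n d \<sigma> \<in> ?X" unfolding cm_diam_def by (rule Max_in[OF finite_cm_dists ne])
  then obtain u v where uv: "cm_diam n d \<sigma> = graph_dist (cm_adj n d \<sigma>) u v" "u < n" "v < n" by blast
  obtain t where t: "real t \<le> T" "(u, v) \<in> cm_adj n d \<sigma> ^^ t" using assms(2) uv unfolding distant_def by blast
  have "graph_dist (cm_adj n d \<sigma>) u v \<le> t" unfolding graph_dist_def by (rule Least_le[of _ t]) (rule t(2))
  then show ?thesis using t(1) uv(1) by linarith
qed

text \<open>\<open>cm_diam\<close> sees connected pairs only; the complement of
  \<open>distant\<close> supplies connectivity, so a small diameter really forces all pairs to be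
  close.\<close>

lemma cm_diam_lt_all_close:
  assumes "\<sigma> \<notin> distant n d T" "real (cm_diam n d \<sigma>) < T'"
  shows "\<sigma> \<in> all_close n d T'"
  unfolding all_close_def
proof (intro CollectI allI impI)
  fix u v assume uv: "u < n" "v < n"
  let ?X = "{graph_dist (cm_adj n d \<sigma>) u v | u v. u < n \<and> v < n \<and> (u, v) \<in> (cm_adj n d \<sigma>)\<^sup>*}"
  obtain t where t: "(u, v) \<in> cm_adj n d \<sigma> ^^ t" using assms(1) uv unfolding distant_def by blast
  then have "graph_dist (cm_adj n d \<sigma>) u v \<in> ?X" using uv relpow_imp_rtrancl by blast
  then have "graph_dist (cm_adj n d \<sigma>) u v \<le> cm_diam n d \<sigma>" unfolding cm_diam_def by (rule Max_ge[OF finite_cm_dists])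
  moreover have "(u, v) \<in> cm_adj n d \<sigma> ^^ graph_dist (cm_adj n d \<sigma>) u v" unfolding graph_dist_def using t by (rule LeastI)
  ultimately show "\<exists>t. real t < T' \<and> (u, v) \<in> cm_adj n d \<sigma> ^^ t" using assms(2)
    by (intro exI[of _ "graph_dist (cm_adj n d \<sigma>) u v"]) auto
qed

theorem theorem1p3:
  fixes d :: "nat \<Rightarrow> nat \<Rightarrow> nat" and p :: "nat \<Rightarrow> real" and \<tau> :: real
  assumes p_nonneg: "\<And>k. p k \<ge> 0"
    and p_sums: "p sums 1"
    and pos: "\<And>n i. i < n \<Longrightarrow> d n i \<ge> 1"
    and even: "\<And>n. even (\<Sum>i<n. d n i)"
    and reg_a: "\<And>k. (\<lambda>n. emp_pk n (d n) k) \<longlonglongrightarrow> p k"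
    and reg_b1: "summable (\<lambda>k. real k * p k)"
    and reg_b2: "(\<lambda>n. \<Sum>k. real k * emp_pk n (d n) k) \<longlonglongrightarrow> (\<Sum>k. real k * p k)"
    and dmin3: "(LEAST k. p k > 0) \<ge> 3"
    and tau: "2 < \<tau>" "\<tau> < 3"
    and poly: "\<forall>\<delta>>0. \<exists>\<alpha>>1/2. \<exists>c1>0. \<exists>c2>0. \<forall>n\<ge>1.
        (\<forall>x::real. 1 \<le> x \<and> x \<le> real n powr \<alpha> \<longrightarrow>
            1 - emp_F n (d n) x \<ge> c1 * x powr (-(\<tau> - 1 + \<delta>))) \<and>
        (\<forall>x::real. 1 \<le> x \<longrightarrow>
            1 - emp_F n (d n) x \<le> c2 * x powr (-(\<tau> - 1 - \<delta>)))"
    and dmin_lb: "\<And>n i. i < n \<Longrightarrow> d n i \<ge> (LEAST k. p k > 0)"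
  shows "\<forall>\<epsilon>>0. (\<lambda>n. measure_pmf.prob (CM n (d n))
           {\<sigma>. \<bar>real (cm_diam n (d n) \<sigma>) / ln (ln (real n))
                 - (2 / ln (real (LEAST k. p k > 0) - 1) + 2 / \<bar>ln (\<tau> - 2)\<bar>)\<bar> > \<epsilon>})
         \<longlonglongrightarrow> 0"
proof (intro allI impI)
  fix \<epsilon> :: real assume \<epsilon>: "\<epsilon> > 0"
  define D where "D = (LEAST k. p k > 0)"
  define B where "B = ln (real D - 1)"
  define G where "G = 2 / B + 2 / \<bar>ln (\<tau> - 2)\<bar>"
  have D3: "3 \<le> D" using dmin3 by (simp add: D_def)
  have DD: "\<And>n i. i < n \<Longrightarrow> D \<le> d n i" using dmin_lb by (simp add: D_def)
  have "\<exists>k. p k > 0"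
  proof (rule ccontr)
    assume "\<nexists>k. p k > 0"
    then have "p = (\<lambda>_. 0)" using p_nonneg by (metis ext order_antisym_conv not_less)
    then have "(\<lambda>_. 0::real) sums 1" using p_sums by simp
    from sums_unique2[OF sums_zero this] show False by simp
  qed
  then have pD: "p D > 0" unfolding D_def by (rule LeastI_ex)
  have moment: "\<exists>C. \<forall>n. (\<Sum>i<n. real (d n i) powr (1 + s)) \<le> C * real n" if s: "0 < s" "s < \<tau> - 2" for s
  proof -
    \<comment> \<open>Half of the slack, so that \<open>s + 1 < \<tau> - 1 - \<delta>\<close> and
      the moment series converges.\<close>
    define \<delta> where "\<delta> = (\<tau> - 2 - s) / 2"
    have \<delta>0: "\<delta> > 0" using s by (simp add: \<delta>_def)
    obtain c2 where c2: "c2 > 0" "\<And>n x. n \<ge> 1 \<Longrightarrow> 1 \<le> x \<Longrightarrow> 1 - emp_F n (d n) x \<le> c2 * x powr (-(\<tau> - 1 - \<delta>))"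
      using poly \<delta>0 by meson
    have "(\<Sum>i<n. real (d n i) powr (1 + s)) \<le> (1 + 8 * c2 * (\<Sum>x. real x powr (s - (\<tau> - 1 - \<delta>)))) * real n" for n
    proof (cases "n \<ge> 1")
      case True
      show ?thesis
      proof (rule moment_bound)
        show "s < 1" using s tau by simp
        show "s + 1 < \<tau> - 1 - \<delta>" using s by (simp add: \<delta>_def field_simps)
        fix x :: nat assume "1 \<le> x"
        then have "real (card {i. i < n \<and> real x < real (d n i)}) / real n \<le> c2 * real x powr (-(\<tau> - 1 - \<delta>))"
          using c2(2)[OF True, of "real x"] one_minus_emp_F[OF True, of "d n" "real x"] by simp
        then show "real (card {i. i < n \<and> real x < real (d n i)}) \<le> c2 * real n * real x powr (-(\<tau> - 1 - \<delta>))"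
          using True by (simp add: field_simps)
      qed (use s c2 in auto)
    next
      case False
      then have "n = 0" by simp
      then show ?thesis by simp
    qed
    then show ?thesis by blast
  qed
  have upper: "(\<lambda>n. match_prob (half_edges n (d n)) {} (distant n (d n) ((1 + h) * (2 / B + 2 / \<bar>ln (\<tau> - 2 + h)\<bar>) * ln (ln (real n))))) \<longlonglongrightarrow> 0"
    if h: "0 < h" "h < 3 - \<tau>" for h
  proof -
    define \<theta> where "\<theta> = \<tau> - 2 + h"
    obtain \<alpha> c1 where ac: "\<alpha> > 1/2" "c1 > 0"
      "\<And>n x. n \<ge> 1 \<Longrightarrow> 1 \<le> x \<Longrightarrow> x \<le> real n powr \<alpha> \<Longrightarrow> 1 - emp_F n (d n) x \<ge> c1 * x powr (-(\<tau> - 1 + h))"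
      using poly h(1) by meson
    obtain C0 where C0: "\<And>n. (\<Sum>i<n. real (d n i) powr (1 + (\<tau> - 2) / 2)) \<le> C0 * real n"
      using moment[of "(\<tau> - 2) / 2"] tau by auto
    define C where "C = max C0 c1"
    have volb: "c1 * real n * x powr (-\<theta>) \<le> vol n (d n) x" if n: "1 \<le> n" and x: "1 \<le> x" "x \<le> real n powr \<alpha>" for n x
    proof -
      have "c1 * x powr (-(\<tau> - 1 + h)) \<le> real (card {i. i < n \<and> x < real (d n i)}) / real n"
        using ac(3)[OF n x] one_minus_emp_F[OF n] by simp
      then have "c1 * x powr (-(\<tau> - 1 + h)) * real n \<le> real (card {i. i < n \<and> x < real (d n i)})"
        using n by (simp add: field_simps)
      then have "x * (c1 * x powr (-(\<tau> - 1 + h)) * real n) \<le> x * real (card {i. i < n \<and> x < real (d n i)})"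
        using x by (intro mult_left_mono) auto
      also have "\<dots> \<le> vol n (d n) x" using x by (intro vol_ge_card) auto
      also have "x * (c1 * x powr (-(\<tau> - 1 + h)) * real n) = c1 * real n * (x powr 1 * x powr (-(\<tau> - 1 + h)))" using x by simp
      also have "x powr 1 * x powr (-(\<tau> - 1 + h)) = x powr (-\<theta>)" by (simp only: powr_add[symmetric]) (simp add: \<theta>_def algebra_simps)
      finally show ?thesis .
    qed
    have len: "real (card (half_edges n (d n))) \<le> C * real n" for n
    proof -
      have "real (d n i) \<le> real (d n i) powr (1 + (\<tau> - 2) / 2)" if "i < n" for i
      proof -
        have "real (d n i) powr 1 \<le> real (d n i) powr (1 + (\<tau> - 2) / 2)" using pos[OF that] tau by (intro powr_mono) auto
        then show ?thesis using pos[OF that] by simp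
      qed
      then have "(\<Sum>i<n. real (d n i)) \<le> (\<Sum>i<n. real (d n i) powr (1 + (\<tau> - 2) / 2))" by (intro sum_mono) auto
      also have "\<dots> \<le> C0 * real n" by (rule C0)
      also have "\<dots> \<le> C * real n" by (intro mult_right_mono) (auto simp: C_def)
      finally show ?thesis by (simp add: card_half_edges)
    qed
    have "(\<lambda>n. match_prob (half_edges n (d n)) {} (distant n (d n) ((1 + h) * (2 / ln (real D - 1) + 2 / \<bar>ln \<theta>\<bar>) * ln (ln (real n))))) \<longlonglongrightarrow> 0"
      by (rule upper_tail_whp[OF volb len DD D3 ac(2) _ _ _ ac(1) h(1)]) (use h tau in \<open>auto simp: C_def \<theta>_def\<close>)
    then show ?thesis by (simp add: B_def \<theta>_def)
  qed
  \<comment> \<open>Used with \<open>s = \<tau> - 2 - h\<close>; the summand \<open>h\<close> in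
    \<open>1 / (\<tau> - 2 - h) + h\<close> makes \<open>1 / s < lm\<close> strict.\<close>
  have lower: "(\<lambda>n. match_prob (half_edges n (d n)) {} (all_close n (d n) ((1 - h) * (2 / B + 2 / ln (1 / (\<tau> - 2 - h) + h)) * ln (ln (real n))))) \<longlonglongrightarrow> 0"
    if h: "0 < h" "h < \<tau> - 2" for h
  proof -
    obtain C where C: "\<And>n. (\<Sum>i<n. real (d n i) powr (1 + (\<tau> - 2 - h))) \<le> C * real n"
      using moment[of "\<tau> - 2 - h"] h by auto
    have "eventually (\<lambda>n. p D / 2 < emp_pk n (d n) D) sequentially"
      using order_tendstoD(1)[OF reg_a[of D], of "p D / 2"] pD by simp
    then have ev: "eventually (\<lambda>n. p D / 2 * real n \<le> real (card {i. i < n \<and> d n i = D})) sequentially"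
      using eventually_gt_at_top[of 0]
    proof eventually_elim
      case (elim n)
      then show ?case by (simp add: emp_pk_def field_simps)
    qed
    show ?thesis unfolding B_def
      by (rule lower_tail_whp[OF C _ _ _ DD D3 even _ ev]) (use h tau pD in auto)
  qed
  have t0: "0 < \<tau> - 2" "\<tau> - 2 < 1" using tau by auto
  have ln0: "ln (\<tau> - 2) < 0" using t0 by simp
  \<comment> \<open>As \<open>h\<close> tends to \<open>0\<close> the constants of both bounds tend
    to \<open>G\<close>, so one fixed \<open>h\<close> for each side fits within
    \<open>\<epsilon>\<close> before \<open>n\<close> tends to infinity.\<close>
  have "((\<lambda>h. (1 + h) * (2 / B + 2 / \<bar>ln (\<tau> - 2 + h)\<bar>)) \<longlongrightarrow> (1 + 0) * (2 / B + 2 / \<bar>ln (\<tau> - 2 + 0)\<bar>)) (at_right 0)"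
    using t0 ln0 by (intro tendsto_intros) auto
  then have up1: "eventually (\<lambda>h. (1 + h) * (2 / B + 2 / \<bar>ln (\<tau> - 2 + h)\<bar>) < G + \<epsilon>) (at_right 0)"
    using \<epsilon> by (intro order_tendstoD) (auto simp: G_def)
  have up2: "eventually (\<lambda>h. 0 < h \<and> h < 3 - \<tau>) (at_right 0)"
    using eventually_at_right[of 0 1] tau by (intro eventually_conj eventually_at_right_less) (auto simp: eventually_at_right_field intro!: exI[of _ "3 - \<tau>"])
  obtain h1 where h1: "0 < h1" "h1 < 3 - \<tau>" "(1 + h1) * (2 / B + 2 / \<bar>ln (\<tau> - 2 + h1)\<bar>) < G + \<epsilon>"
    using eventually_happens[OF eventually_conj[OF up1 up2]] by auto
  have "((\<lambda>h. (1 - h) * (2 / B + 2 / ln (1 / (\<tau> - 2 - h) + h))) \<longlongrightarrow> (1 - 0) * (2 / B + 2 / ln (1 / (\<tau> - 2 - 0) + 0))) (at_right 0)"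
  proof (intro tendsto_intros)
    show "ln (1 / (\<tau> - 2 - 0) + 0) \<noteq> 0" using t0 ln0 by (simp add: ln_div)
  qed (use t0 in auto)
  moreover have "(1 - 0) * (2 / B + 2 / ln (1 / (\<tau> - 2 - 0) + 0)) = G"
    using t0 ln0 by (simp add: G_def ln_div)
  ultimately have lo1: "eventually (\<lambda>h. G - \<epsilon> < (1 - h) * (2 / B + 2 / ln (1 / (\<tau> - 2 - h) + h))) (at_right 0)"
    using \<epsilon> by (intro order_tendstoD) auto
  have lo2: "eventually (\<lambda>h. 0 < h \<and> h < \<tau> - 2) (at_right 0)"
    using t0 by (intro eventually_conj eventually_at_right_less) (auto simp: eventually_at_right_field intro!: exI[of _ "\<tau> - 2"])
  obtain h2 where h2: "0 < h2" "h2 < \<tau> - 2" "G - \<epsilon> < (1 - h2) * (2 / B + 2 / ln (1 / (\<tau> - 2 - h2) + h2))"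
    using eventually_happens[OF eventually_conj[OF lo1 lo2]] by auto
  define T1 where "T1 = (\<lambda>n. (1 + h1) * (2 / B + 2 / \<bar>ln (\<tau> - 2 + h1)\<bar>) * ln (ln (real n)))"
  define T2 where "T2 = (\<lambda>n. (1 - h2) * (2 / B + 2 / ln (1 / (\<tau> - 2 - h2) + h2)) * ln (ln (real n)))"
  let ?P = "\<lambda>n. measure_pmf.prob (CM n (d n)) {\<sigma>. \<bar>real (cm_diam n (d n) \<sigma>) / ln (ln (real n)) - G\<bar> > \<epsilon>}"
  have pos_ll: "eventually (\<lambda>n::nat. ln (ln (real n)) > 0 \<and> n \<ge> 1) sequentially"
    by (intro eventually_conj eventually_ge_at_top) real_asymp
  have bound: "eventually (\<lambda>n. ?P n \<le> match_prob (half_edges n (d n)) {} (distant n (d n) (T1 n)) + match_prob (half_edges n (d n)) {} (all_close n (d n) (T2 n))) sequentially"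
    using pos_ll
  proof eventually_elim
    case (elim n)
    define L where "L = ln (ln (real n))"
    have L0: "L > 0" and n1: "n \<ge> 1" using elim by (auto simp: L_def)
    let ?X = "{\<sigma>. \<bar>real (cm_diam n (d n) \<sigma>) / L - G\<bar> > \<epsilon>}"
    \<comment> \<open>Outside \<open>distant\<close> the diameter is at most
      \<open>(G + \<epsilon>) * L\<close>, so a deviation can only be downwards, and then all pairs
      are close.\<close>
    have "?X \<subseteq> distant n (d n) (T1 n) \<union> all_close n (d n) (T2 n)"
    proof
      fix \<sigma> assume x: "\<sigma> \<in> ?X"
      show "\<sigma> \<in> distant n (d n) (T1 n) \<union> all_close n (d n) (T2 n)"
      proof (cases "\<sigma> \<in> distant n (d n) (T1 n)")
        case nd: False
        have "real (cm_diam n (d n) \<sigma>) \<le> T1 n" by (rule cm_diam_le[OF n1 nd])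
        also have "\<dots> \<le> (G + \<epsilon>) * L" unfolding T1_def L_def[symmetric] using h1(3) L0 by (intro mult_right_mono) auto
        finally have "real (cm_diam n (d n) \<sigma>) / L \<le> G + \<epsilon>" using L0 by (simp add: pos_divide_le_eq)
        then have "real (cm_diam n (d n) \<sigma>) / L < G - \<epsilon>" using x by auto
        then have "real (cm_diam n (d n) \<sigma>) < (G - \<epsilon>) * L" using L0 by (simp add: pos_divide_less_eq)
        also have "\<dots> \<le> T2 n" unfolding T2_def L_def[symmetric] using h2(3) L0 by (intro mult_right_mono) auto
        finally show ?thesis using cm_diam_lt_all_close[OF nd] by blast
      qed simp
    qed
    then have "match_prob (half_edges n (d n)) {} ?X \<le> match_prob (half_edges n (d n)) {} (distant n (d n) (T1 n) \<union> all_close n (d n) (T2 n))"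
      by (intro match_prob_mono) auto
    also have "\<dots> \<le> match_prob (half_edges n (d n)) {} (distant n (d n) (T1 n)) + match_prob (half_edges n (d n)) {} (all_close n (d n) (T2 n))"
      by (rule match_prob_Un) simp
    finally show ?case using prob_CM[OF even[of n]] by (simp add: L_def)
  qed
  have "(\<lambda>n. match_prob (half_edges n (d n)) {} (distant n (d n) (T1 n)) + match_prob (half_edges n (d n)) {} (all_close n (d n) (T2 n))) \<longlonglongrightarrow> 0 + 0"
    unfolding T1_def T2_def by (intro tendsto_add upper lower h1 h2)
  then have "(\<lambda>n. match_prob (half_edges n (d n)) {} (distant n (d n) (T1 n)) + match_prob (half_edges n (d n)) {} (all_close n (d n) (T2 n))) \<longlonglongrightarrow> 0" by simp
  then have "?P \<longlonglongrightarrow> 0"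
    by (rule tendsto_sandwich[OF always_eventually bound tendsto_const, rotated]) simp
  then show "(\<lambda>n. measure_pmf.prob (CM n (d n))
           {\<sigma>. \<bar>real (cm_diam n (d n) \<sigma>) / ln (ln (real n))
                 - (2 / ln (real (LEAST k. p k > 0) - 1) + 2 / \<bar>ln (\<tau> - 2)\<bar>)\<bar> > \<epsilon>})
         \<longlonglongrightarrow> 0"
    unfolding G_def B_def D_def .
qed

end
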